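(* Let $p>3$ be a prime. Let $W_{\mathrm{iso}}\subset\mathbb{Z}_p^5$ be the set of tuples $[a_1,a_2,a_3,a_4,a_6]\in\mathbb{Z}_p^5$ such that the equation $y^2+a_1xy+a_3y=x^3+a_2x^2+a_4x+a_6$ defines an elliptic curve over $\mathbb{Q}_p$ admitting a $\mathbb{Q}_p$-rational isogeny of degree $3$. Then \[ \mu_{\mathbb{Z}_p^5}(W_{\mathrm{iso}})=\begin{cases} \dfrac{3p^4+3p^3+4p^2+4}{4(p^4+p^3+p^2+p+1)} & \text{if } p\equiv 1\pmod 3,\\[2mm] \dfrac{p^4+p^3+2p^2+2}{2(p^4+p^3+p^2+p+1)} & \text{if } p\equiv 2\pmod 3. \end{cases} \]
   Context: $\mu_{\mathbb{Z}_p^5}$ denotes the Haar measure on $\mathbb{Z}_p^5$ normalized so that $\mu_{\mathbb{Z}_p^5}(\mathbb{Z}_p^5)=1$. A $\mathbb{Q}_p$-rational isogeny of degree $3$ on $E$ is an isogeny $E\to E'$ of degree $3$ defined over $\mathbb{Q}_p$; equivalently, its kernel is a subgroup of order $3$ of $E(\overline{\mathbb{Q}_p})$ stable under $\mathrm{Gal}(\overline{\mathbb{Q}_p}/\mathbb{Q}_p)$. *)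

theory Defs
  imports
    "HOL-Probability.Probability"
    "HOL-Algebra.Algebraic_Closure_Type"
    "Berlekamp_Zassenhaus.Finite_Field"
begin

section \<open>The ring of p-adic integers\<close>

text \<open>
  The prime \<open>p\<close> is the cardinality of the type parameter \<open>'p :: prime_card\<close>.  A p-adic integer
  is an element of the inverse limit of the rings Z/p^n; its n-th component is represented by
  the least nonnegative residue (the equation below forces it to lie between 0 and p^n - 1).
\<close>

typedef ('p :: prime_card) padic_int =
  "{x :: nat \<Rightarrow> int. \<forall>n. x n = x (Suc n) mod int CARD('p) ^ n}"
  morphisms padic_res Abs_padic_int
  by (rule exI[of _ "\<lambda>_. 0"]) simp

setup_lifting type_definition_padic_int

lemma padic_res_Suc: "padic_res (x :: 'p::prime_card padic_int) (Suc n) mod int CARD('p) ^ n = padic_res x n"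
proof -
  have "\<forall>n. padic_res x n = padic_res x (Suc n) mod int CARD('p) ^ n"
    using padic_res[of x] unfolding mem_Collect_eq .
  from spec[OF this, of n] show ?thesis by (rule sym)
qed

lemma padic_res_mod [simp]: "padic_res (x :: 'p::prime_card padic_int) n mod int CARD('p) ^ n = padic_res x n"
  by (subst (1 2) padic_res_Suc[symmetric]) (rule mod_mod_trivial)

lemma padic_res_mod_le:
  "m \<le> n \<Longrightarrow> padic_res (x :: 'p::prime_card padic_int) n mod int CARD('p) ^ m = padic_res x m"
proof (induction n rule: dec_induct)
  case base
  show ?case by simp
next
  case (step n)
  have "padic_res x (Suc n) mod int CARD('p) ^ m
      = padic_res x (Suc n) mod int CARD('p) ^ n mod int CARD('p) ^ m"
    using step by (simp add: mod_mod_cancel le_imp_power_dvd)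
  then show ?case using step by (simp add: padic_res_Suc)
qed

lemma padic_int_eqI: "(\<And>n. padic_res x n = padic_res y n) \<Longrightarrow> x = y"
  by (metis ext padic_res_inject)

instantiation padic_int :: (prime_card) idom
begin

lift_definition zero_padic_int :: "'a padic_int" is "\<lambda>_. 0" by simp

lift_definition one_padic_int :: "'a padic_int" is "\<lambda>n. 1 mod int CARD('a) ^ n"
  by (simp add: mod_mod_cancel le_imp_power_dvd del: power_Suc)

lift_definition plus_padic_int :: "'a padic_int \<Rightarrow> 'a padic_int \<Rightarrow> 'a padic_int"
  is "\<lambda>x y n. (x n + y n) mod int CARD('a) ^ n"
proof goal_cases
  case *: (1 x y)
  have "(x n + y n) mod int CARD('a) ^ n = (x (Suc n) + y (Suc n)) mod int CARD('a) ^ n" for n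
    using * by (metis mod_add_eq)
  then show ?case
    unfolding mod_mod_cancel[OF le_imp_power_dvd[OF le_SucI[OF order_refl]]] by blast
qed

lift_definition times_padic_int :: "'a padic_int \<Rightarrow> 'a padic_int \<Rightarrow> 'a padic_int"
  is "\<lambda>x y n. (x n * y n) mod int CARD('a) ^ n"
proof goal_cases
  case *: (1 x y)
  have "(x n * y n) mod int CARD('a) ^ n = (x (Suc n) * y (Suc n)) mod int CARD('a) ^ n" for n
    using * by (metis mod_mult_eq)
  then show ?case
    unfolding mod_mod_cancel[OF le_imp_power_dvd[OF le_SucI[OF order_refl]]] by blast
qed

lift_definition uminus_padic_int :: "'a padic_int \<Rightarrow> 'a padic_int"
  is "\<lambda>x n. (- x n) mod int CARD('a) ^ n"
proof goal_cases
  case *: (1 x)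
  have "(- x n) mod int CARD('a) ^ n = (- x (Suc n)) mod int CARD('a) ^ n" for n
    using * by (metis mod_minus_eq)
  then show ?case
    unfolding mod_mod_cancel[OF le_imp_power_dvd[OF le_SucI[OF order_refl]]] by blast
qed

definition minus_padic_int :: "'a padic_int \<Rightarrow> 'a padic_int \<Rightarrow> 'a padic_int"
  where "minus_padic_int x y = x + (- y)"

instance
proof
  fix x y z :: "'a padic_int"
  show "x * y * z = x * (y * z)"
    by (rule padic_int_eqI) (simp add: times_padic_int.rep_eq mod_simps mult.assoc)
  show "x * y = y * x"
    by (rule padic_int_eqI) (simp add: times_padic_int.rep_eq mult.commute)
  show "1 * x = x"
    by (rule padic_int_eqI) (simp add: times_padic_int.rep_eq one_padic_int.rep_eq mod_simps)
  show "x + y + z = x + (y + z)"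
    by (rule padic_int_eqI) (simp add: plus_padic_int.rep_eq mod_simps add.assoc)
  show "x + y = y + x"
    by (rule padic_int_eqI) (simp add: plus_padic_int.rep_eq add.commute)
  show "0 + x = x"
    by (rule padic_int_eqI) (simp add: plus_padic_int.rep_eq zero_padic_int.rep_eq)
  show "- x + x = 0"
    by (rule padic_int_eqI)
       (simp add: plus_padic_int.rep_eq uminus_padic_int.rep_eq zero_padic_int.rep_eq mod_simps)
  show "x * (y + z) = x * y + x * z"
    by (rule padic_int_eqI)
       (simp add: plus_padic_int.rep_eq times_padic_int.rep_eq mod_simps distrib_left)
  show "0 * x = 0" and "x * 0 = 0"
    by (rule padic_int_eqI; simp add: times_padic_int.rep_eq zero_padic_int.rep_eq)+
  show "x - y = x + - y"
    by (rule minus_padic_int_def)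
  show "(x + y) * z = x * z + y * z"
    by (rule padic_int_eqI)
       (simp add: plus_padic_int.rep_eq times_padic_int.rep_eq mod_simps distrib_right)
  show "(0 :: 'a padic_int) \<noteq> 1"
  proof
    assume "(0 :: 'a padic_int) = 1"
    then have "padic_res (0 :: 'a padic_int) 1 = padic_res 1 1" by simp
    then show False
      using prime_gt_1_nat[OF prime_card[where 'a = 'a]]
      by (simp add: zero_padic_int.rep_eq one_padic_int.rep_eq)
  qed
  assume "x \<noteq> 0" "y \<noteq> 0"
  then obtain m n where mn: "padic_res x m \<noteq> 0" "padic_res y n \<noteq> 0"
    by (metis padic_int_eqI zero_padic_int.rep_eq)
  let ?p = "int CARD('a)"
  let ?x = "padic_res x (m + n)" and ?y = "padic_res y (m + n)"
  have p: "prime_elem ?p" using prime_card_int[where 'a = 'a] by auto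
  have "\<not> ?p ^ m dvd ?x" "\<not> ?p ^ n dvd ?y"
    using mn padic_res_mod_le[of m "m + n" x] padic_res_mod_le[of n "m + n" y]
    by (auto simp: mod_eq_0_iff_dvd[symmetric])
  moreover from this have nz: "?x \<noteq> 0" "?y \<noteq> 0" by auto
  ultimately have "multiplicity ?p ?x < m" "multiplicity ?p ?y < n"
    using p by (metis multiplicity_dvd' linorder_not_less)+
  then have "multiplicity ?p (?x * ?y) < m + n"
    using nz p by (simp add: prime_elem_multiplicity_mult_distrib)
  then have "\<not> ?p ^ (m + n) dvd ?x * ?y"
    using nz p by (subst power_dvd_iff_le_multiplicity) auto
  then have "padic_res (x * y) (m + n) \<noteq> 0"
    by (simp add: times_padic_int.rep_eq mod_eq_0_iff_dvd)
  then show "x * y \<noteq> 0" by (auto simp: zero_padic_int.rep_eq)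
qed

end


section \<open>Topology and Haar measure\<close>

definition padic_ball :: "nat \<Rightarrow> int \<Rightarrow> 'p::prime_card padic_int set" where
  "padic_ball n r = {x. padic_res x n = r}"

text \<open>The topology is the p-adic one: the residue classes modulo p^n form a base.\<close>

instantiation padic_int :: (prime_card) topological_space
begin

definition open_padic_int :: "'a padic_int set \<Rightarrow> bool" where
  "open_padic_int U \<longleftrightarrow> (\<forall>x\<in>U. \<exists>n. padic_ball n (padic_res x n) \<subseteq> U)"

instance
proof
  show "open (UNIV :: 'a padic_int set)" by (simp add: open_padic_int_def)
next
  fix S T :: "'a padic_int set"
  assume ST: "open S" "open T"
  show "open (S \<inter> T)"
    unfolding open_padic_int_def
  proof
    fix x assume "x \<in> S \<inter> T"
    with ST obtain m n where "padic_ball m (padic_res x m) \<subseteq> S" "padic_ball n (padic_res x n) \<subseteq> T"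
      unfolding open_padic_int_def by blast
    moreover have "(padic_ball (m + n) (padic_res x (m + n)) :: 'a padic_int set) \<subseteq> padic_ball m (padic_res x m)"
      "(padic_ball (m + n) (padic_res x (m + n)) :: 'a padic_int set) \<subseteq> padic_ball n (padic_res x n)"
      unfolding padic_ball_def
      by (auto simp: padic_res_mod_le[symmetric, of m "m + n"] padic_res_mod_le[symmetric, of n "m + n"])
    ultimately show "\<exists>k. padic_ball k (padic_res x k) \<subseteq> S \<inter> T" by blast
  qed
next
  fix K :: "'a padic_int set set"
  assume "\<forall>S\<in>K. open S"
  then show "open (\<Union> K)" unfolding open_padic_int_def by (meson Sup_upper UnionE order_trans)
qed

end

lemma open_padic_ball: "open (padic_ball n r)"
  unfolding open_padic_int_def by (auto simp: padic_ball_def intro!: exI[of _ n])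

instance padic_int :: (prime_card) topological_ab_group_add
proof
  fix a b :: "'a padic_int"
  show "((\<lambda>x. fst x + snd x) \<longlongrightarrow> a + b) (nhds a \<times>\<^sub>F nhds b)"
  proof (rule topological_tendstoI)
    fix S assume "open S" "a + b \<in> S"
    then obtain n where n: "padic_ball n (padic_res (a + b) n) \<subseteq> S"
      unfolding open_padic_int_def by blast
    have "\<forall>\<^sub>F x in nhds a. padic_res x n = padic_res a n" "\<forall>\<^sub>F x in nhds b. padic_res x n = padic_res b n"
      using eventually_nhds_in_open[OF open_padic_ball[of n]] by (auto simp: padic_ball_def)
    then show "\<forall>\<^sub>F x in nhds a \<times>\<^sub>F nhds b. fst x + snd x \<in> S"
      by (rule eventually_prodI[THEN eventually_mono])
         (use n in \<open>auto simp: padic_ball_def plus_padic_int.rep_eq\<close>)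
  qed
  show "(uminus \<longlongrightarrow> - a) (nhds a)"
  proof (rule topological_tendstoI)
    fix S assume "open S" "- a \<in> S"
    then obtain n where n: "padic_ball n (padic_res (- a) n) \<subseteq> S"
      unfolding open_padic_int_def by blast
    have "\<forall>\<^sub>F x in nhds a. padic_res x n = padic_res a n"
      using eventually_nhds_in_open[OF open_padic_ball[of n]] by (auto simp: padic_ball_def)
    then show "\<forall>\<^sub>F x in nhds a. - x \<in> S"
      by (rule eventually_mono) (use n in \<open>auto simp: padic_ball_def uminus_padic_int.rep_eq\<close>)
  qed
qed

lemma topological_basis_padic_ball: "topological_basis (range (\<lambda>(n, r). padic_ball n r))"
proof (rule topological_basisI)
  fix B' :: "'a padic_int set" assume "B' \<in> range (\<lambda>(n, r). padic_ball n r)"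
  then show "open B'" by (auto simp: open_padic_ball)
next
  fix U :: "'a padic_int set" and x assume "open U" "x \<in> U"
  then obtain n where "padic_ball n (padic_res x n) \<subseteq> U" unfolding open_padic_int_def by blast
  then show "\<exists>B'\<in>range (\<lambda>(n, r). padic_ball n r). x \<in> B' \<and> B' \<subseteq> U"
    by (intro bexI[of _ "padic_ball n (padic_res x n)"]) (auto simp: padic_ball_def)
qed

instance padic_int :: (prime_card) second_countable_topology
proof
  show "\<exists>B :: 'a padic_int set set. countable B \<and> open = generate_topology B"
    by (intro exI[of _ "range (\<lambda>(n, r). padic_ball n r)"] conjI
          topological_basis_imp_subbasis topological_basis_padic_ball) simp
qed

lemma continuous_on_padic_add: "continuous_on UNIV (\<lambda>x :: 'p::prime_card padic_int \<times> _. fst x + snd x)"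
  by (intro continuous_intros)

text \<open>
  This is meant for compact, second countable groups: there the regularity of a finite Borel measure
  is automatic, and the normalization makes the Haar measure unique.  The two lemmas
  \<open>normalized_haar_unique\<close> and \<open>normalized_haar_haar_measure_padic5\<close> below show that the definite
  description is meaningful for the fifth power of the p-adic integers.
\<close>

definition normalized_haar :: "'a::{topological_space, ab_group_add} measure \<Rightarrow> bool" where
  "normalized_haar M \<longleftrightarrow>
     sets M = sets borel \<and>
     (\<forall>t. \<forall>A\<in>sets M. emeasure M ((\<lambda>x. t + x) ` A) = emeasure M A) \<and>
     emeasure M UNIV = 1"

definition haar_measure :: "'a::{topological_space, ab_group_add} measure" where
  "haar_measure = (THE M. normalized_haar M)"

lemma image_plus_eq_vimage: "(\<lambda>x. t + x) ` A = (\<lambda>x. - t + x) -` (A :: 'a::ab_group_add set)"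
  by (auto simp: image_iff) (metis add.commute diff_add_cancel)

lemma normalized_haar_prob_space:
  assumes "normalized_haar M" shows "prob_space M"
  using assms sets_eq_imp_space_eq[of M borel] by (intro prob_spaceI) (auto simp: normalized_haar_def)

lemma normalized_haar_vimage:
  assumes "normalized_haar M" "A \<in> sets borel"
  shows "emeasure M ((\<lambda>x. t + x) -` A) = emeasure M A"
  using assms image_plus_eq_vimage[of "- t" A] unfolding normalized_haar_def by (metis minus_minus)

lemma normalized_haar_unique:
  fixes M N :: "'a::{second_countable_topology, ab_group_add} measure"
  assumes cont: "continuous_on UNIV (\<lambda>x :: 'a \<times> 'a. fst x + snd x)"
    and M: "normalized_haar M" and N: "normalized_haar N"
  shows "M = N"
proof (rule measure_eqI)
  have sM [measurable_cong]: "sets M = sets borel" and sN [measurable_cong]: "sets N = sets borel"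
    using M N by (auto simp: normalized_haar_def)
  show "sets M = sets N" by (simp add: sM sN)
  interpret M: prob_space M using M by (rule normalized_haar_prob_space)
  interpret N: prob_space N using N by (rule normalized_haar_prob_space)
  interpret MN: pair_prob_space M N ..
  fix A assume "A \<in> sets M"
  then have A: "A \<in> sets borel" by (simp add: sM)
  have "(\<lambda>x :: 'a \<times> 'a. fst x + snd x) \<in> borel \<rightarrow>\<^sub>M borel"
    by (rule borel_measurable_continuous_onI[OF cont])
  then have "(\<lambda>x :: 'a \<times> 'a. fst x + snd x) -` A \<in> sets borel"
    using A by (metis measurable_sets_borel)
  also have "sets (borel :: ('a \<times> 'a) measure) = sets (M \<Otimes>\<^sub>M N)"
    by (simp add: borel_prod[symmetric] sM sN cong: sets_pair_measure_cong)
  finally have B: "(\<lambda>x :: 'a \<times> 'a. fst x + snd x) -` A \<in> sets (M \<Otimes>\<^sub>M N)" (is "?B \<in> _") .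
  have "emeasure M A = (\<integral>\<^sup>+y. emeasure M ((\<lambda>x. y + x) -` A) \<partial>N)"
    using A by (simp add: normalized_haar_vimage[OF M] N.emeasure_space_1)
  also have "\<dots> = (\<integral>\<^sup>+y. emeasure M ((\<lambda>x. (x, y)) -` ?B) \<partial>N)"
    by (simp add: vimage_def add.commute)
  also have "\<dots> = emeasure (M \<Otimes>\<^sub>M N) ?B" using B by (simp add: MN.emeasure_pair_measure_alt2)
  also have "\<dots> = (\<integral>\<^sup>+x. emeasure N (Pair x -` ?B) \<partial>M)" using B by (simp add: N.emeasure_pair_measure_alt)
  also have "\<dots> = (\<integral>\<^sup>+x. emeasure N ((\<lambda>y. x + y) -` A) \<partial>M)" by (simp add: vimage_def)
  also have "\<dots> = emeasure N A"
    using A by (simp add: normalized_haar_vimage[OF N] M.emeasure_space_1)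
  finally show "emeasure M A = emeasure N A" .
qed

lemma measurable_translation:
  fixes t :: "'a::{second_countable_topology, ab_group_add}"
  assumes cont: "continuous_on UNIV (\<lambda>x :: 'a \<times> 'a. fst x + snd x)"
  shows "(\<lambda>x. t + x) \<in> borel \<rightarrow>\<^sub>M borel"
proof (rule borel_measurable_continuous_onI)
  have "continuous_on UNIV (\<lambda>x :: 'a. fst (t, x) + snd (t, x))"
    by (rule continuous_on_compose2[OF cont]) (auto intro!: continuous_intros)
  then show "continuous_on UNIV (\<lambda>x. t + x)" by simp
qed

lemma normalized_haar_iff_distr:
  fixes M :: "'a::{second_countable_topology, ab_group_add} measure"
  assumes cont: "continuous_on UNIV (\<lambda>x :: 'a \<times> 'a. fst x + snd x)"
  shows "normalized_haar M \<longleftrightarrow>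
    sets M = sets borel \<and> (\<forall>t. distr M borel (\<lambda>x. t + x) = M) \<and> emeasure M UNIV = 1"
proof (cases "sets M = sets borel")
  case True
  then have sp: "space M = UNIV" by (metis sets_eq_imp_space_eq space_borel)
  have "distr M borel (\<lambda>x. t + x) = M \<longleftrightarrow> (\<forall>A\<in>sets M. emeasure M ((\<lambda>x. t + x) -` A) = emeasure M A)" for t
  proof -
    have *: "emeasure (distr M borel (\<lambda>x. t + x)) A = emeasure M ((\<lambda>x. t + x) -` A)" if "A \<in> sets M" for A
      using that True measurable_translation[OF cont, of t] sp
      by (subst emeasure_distr) (auto cong: measurable_cong_sets)
    show ?thesis using * True by (auto intro!: measure_eqI)
  qed
  then show ?thesis unfolding normalized_haar_def
    by (metis image_plus_eq_vimage minus_minus)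
qed (simp add: normalized_haar_def)

lemma normalized_haar_pair:
  fixes M :: "'a::{second_countable_topology, ab_group_add} measure"
    and N :: "'b::{second_countable_topology, ab_group_add} measure"
  assumes contM: "continuous_on UNIV (\<lambda>x :: 'a \<times> 'a. fst x + snd x)"
    and contN: "continuous_on UNIV (\<lambda>x :: 'b \<times> 'b. fst x + snd x)"
    and M: "normalized_haar M" and N: "normalized_haar N"
  shows "continuous_on UNIV (\<lambda>x :: ('a \<times> 'b) \<times> ('a \<times> 'b). fst x + snd x)"
    and "normalized_haar (M \<Otimes>\<^sub>M N)"
proof -
  show cont: "continuous_on UNIV (\<lambda>x :: ('a \<times> 'b) \<times> ('a \<times> 'b). fst x + snd x)"
    unfolding plus_prod_def
  proof (rule continuous_on_Pair)
    have "continuous_on UNIV (\<lambda>x :: ('a \<times> 'b) \<times> ('a \<times> 'b). (fst (fst x), fst (snd x)))"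
      by (intro continuous_intros)
    from continuous_on_compose2[OF contM this]
    show "continuous_on UNIV (\<lambda>x :: ('a \<times> 'b) \<times> ('a \<times> 'b). fst (fst x) + fst (snd x))" by simp
    have "continuous_on UNIV (\<lambda>x :: ('a \<times> 'b) \<times> ('a \<times> 'b). (snd (fst x), snd (snd x)))"
      by (intro continuous_intros)
    from continuous_on_compose2[OF contN this]
    show "continuous_on UNIV (\<lambda>x :: ('a \<times> 'b) \<times> ('a \<times> 'b). snd (fst x) + snd (snd x))" by simp
  qed
  have sM [measurable_cong]: "sets M = sets borel" and sN [measurable_cong]: "sets N = sets borel"
    using M N by (auto simp: normalized_haar_def)
  interpret M: prob_space M using M by (rule normalized_haar_prob_space)
  interpret N: prob_space N using N by (rule normalized_haar_prob_space)
  interpret MN: pair_prob_space M N ..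
  have sMN: "sets (M \<Otimes>\<^sub>M N) = sets borel"
    by (simp add: borel_prod[symmetric] sM sN cong: sets_pair_measure_cong)
  have sp: "space (M \<Otimes>\<^sub>M N) = UNIV" using sMN by (metis sets_eq_imp_space_eq space_borel)
  have "distr (M \<Otimes>\<^sub>M N) borel (\<lambda>x. t + x) = M \<Otimes>\<^sub>M N" for t :: "'a \<times> 'b"
  proof -
    have dM: "distr M borel (\<lambda>x. fst t + x) = M" and dN: "distr N borel (\<lambda>x. snd t + x) = N"
      using M N normalized_haar_iff_distr[OF contM] normalized_haar_iff_distr[OF contN] by auto
    have "distr M borel (\<lambda>x. fst t + x) \<Otimes>\<^sub>M distr N borel (\<lambda>x. snd t + x)
        = distr (M \<Otimes>\<^sub>M N) (borel \<Otimes>\<^sub>M borel) (\<lambda>(x, y). (fst t + x, snd t + y))"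
      using measurable_translation[OF contM, of "fst t"] measurable_translation[OF contN, of "snd t"]
        N.sigma_finite_measure_axioms
      by (intro pair_measure_distr) (auto simp: dN cong: measurable_cong_sets[OF sM refl] measurable_cong_sets[OF sN refl])
    then show ?thesis
      by (simp add: dM dN borel_prod plus_prod_def case_prod_unfold)
  qed
  then show "normalized_haar (M \<Otimes>\<^sub>M N)"
    using MN.emeasure_space_1 by (auto simp: normalized_haar_iff_distr[OF cont] sMN sp)
qed

lemma sum_digits: "(\<Sum>i<n. (r div q ^ i mod q) * q ^ i) = r mod (q::int) ^ n" if "q > 0"
proof (induction n)
  case (Suc n)
  have "r mod (q ^ n * q) = q ^ n * (r div q ^ n mod q) + r mod q ^ n"
    using that by (intro zmod_zmult2_eq) auto
  with Suc show ?case by (simp add: mult.commute)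
qed simp

lemma normalized_haar_padic_int_exists: "\<exists>M :: 'p::prime_card padic_int measure. normalized_haar M"
proof -
  define p where "p = CARD('p)"
  have p: "p > 1" unfolding p_def using prime_gt_1_nat[OF prime_card] .
  define D where "D = measure_pmf (pmf_of_set {..<p})"
  define P where "P = PiM (UNIV :: nat set) (\<lambda>_. D)"
  interpret D: prob_space D unfolding D_def by (rule measure_pmf.prob_space_axioms)
  interpret P: product_prob_space "\<lambda>_ :: nat. D" UNIV ..
  define s where "s d n = (\<Sum>i<n. int (d i) * int p ^ i) mod int p ^ n" for d :: "nat \<Rightarrow> nat" and n
  define \<phi> :: "(nat \<Rightarrow> nat) \<Rightarrow> 'p padic_int" where "\<phi> d = Abs_padic_int (s d)" for d
  have \<phi>: "padic_res (\<phi> d) = s d" for d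
    unfolding \<phi>_def
    by (rule Abs_padic_int_inverse)
       (simp add: s_def p_def[symmetric] mod_mod_cancel le_imp_power_dvd del: power_Suc)
  have meas_s: "{d. s d n = r} \<in> sets P" for n r
  proof -
    have "(\<lambda>d. \<Sum>i<n. real (d i) * real p ^ i) \<in> borel_measurable P"
    proof (rule borel_measurable_sum)
      fix i assume "i \<in> {..<n}"
      have "(\<lambda>k. real k * real p ^ i) \<in> borel_measurable D" by (simp add: D_def)
      then show "(\<lambda>d. real (d i) * real p ^ i) \<in> borel_measurable P"
        unfolding P_def by (rule measurable_compose[OF measurable_component_singleton, rotated]) simp
    qed
    moreover have "real_of_int ` {x. x mod int p ^ n = r} \<in> sets borel"
      by (rule sets.countable) auto
    ultimately have "(\<lambda>d. \<Sum>i<n. real (d i) * real p ^ i) -` (real_of_int ` {x. x mod int p ^ n = r}) \<inter> space P \<in> sets P"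
      by (rule measurable_sets)
    moreover have "(\<Sum>i<n. real (d i) * real p ^ i) = real_of_int (\<Sum>i<n. int (d i) * int p ^ i)" for d
      by simp
    ultimately show ?thesis
      by (simp add: s_def vimage_def P_def space_PiM D_def image_iff del: of_int_sum of_int_mult of_int_power)
  qed
  have borel: "borel = sigma UNIV (range (\<lambda>(n, r). padic_ball n r :: 'p padic_int set))"
    by (rule borel_eq_countable_basis[OF _ topological_basis_padic_ball]) simp
  have sets_borel: "sets borel = sigma_sets UNIV (range (\<lambda>(n, r). padic_ball n r :: 'p padic_int set))"
    unfolding borel by simp
  have spP: "space P = UNIV" by (simp add: P_def space_PiM D_def)
  have \<phi>_ball: "\<phi> -` padic_ball n r = {d. s d n = r}" for n r
    by (auto simp: padic_ball_def \<phi>)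
  have meas: "\<phi> \<in> P \<rightarrow>\<^sub>M borel"
    unfolding borel using meas_s by (intro measurable_measure_of) (auto simp: spP \<phi>_ball)
  define Q where "Q = distr P borel \<phi>"
  interpret Q: prob_space Q unfolding Q_def using meas P.P.prob_space_distr unfolding P_def by blast
  have sQ: "sets Q = sets borel" and spQ: "space Q = UNIV" by (auto simp: Q_def)
  have ball_sets [simp]: "padic_ball n r \<in> sets borel" for n r
    by (intro borel_open open_padic_ball)
  have lower: "measure Q (padic_ball n r) \<ge> (1 / p) ^ n" if "r \<in> {0..<int p ^ n}" for n r
  proof -
    define A where "A = P.emb UNIV {..<n} (Pi\<^sub>E {..<n} (\<lambda>i. {nat (r div int p ^ i mod int p)}))"
    have dig: "nat (r div int p ^ i mod int p) < p" for i
      using p by (simp add: nat_less_iff)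
    have "emeasure P A = (\<Prod>i<n. emeasure D {nat (r div int p ^ i mod int p)})"
      unfolding A_def P_def by (rule P.emeasure_PiM_emb) (auto simp: D_def)
    also have "\<dots> = (\<Prod>i<n. ennreal (1 / p))"
      using dig p by (intro prod.cong) (auto simp: D_def emeasure_pmf_single lessThan_empty_iff)
    also have "\<dots> = ennreal ((1 / p) ^ n)" by (simp add: ennreal_power)
    finally have "emeasure P A = ennreal ((1 / p) ^ n)" .
    moreover have "A \<subseteq> {d. s d n = r}"
    proof
      fix d assume "d \<in> A"
      then have "\<forall>i<n. d i = nat (r div int p ^ i mod int p)"
        by (auto simp: A_def prod_emb_def PiE_iff restrict_def split: if_splits)
      then have "s d n = (\<Sum>i<n. (r div int p ^ i mod int p) * int p ^ i) mod int p ^ n"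
        using p unfolding s_def by (intro arg_cong[where f = "\<lambda>x. x mod _"] sum.cong) auto
      also have "\<dots> = r" using that p by (simp add: sum_digits)
      finally show "d \<in> {d. s d n = r}" by simp
    qed
    ultimately have "ennreal ((1 / p) ^ n) \<le> emeasure P {d. s d n = r}"
      by (metis emeasure_mono meas_s)
    also have "\<dots> = emeasure Q (padic_ball n r)"
      unfolding Q_def using meas by (subst emeasure_distr) (auto simp: \<phi>_ball spP)
    finally show ?thesis by (simp add: Q.emeasure_eq_measure)
  qed
  have empty: "padic_ball n r = ({} :: 'p padic_int set)" if "r \<notin> {0..<int p ^ n}" for n r
    using that p unfolding padic_ball_def p_def
    by (auto simp: not_le) (metis padic_res_mod pos_mod_bound pos_mod_sign linorder_not_le zero_less_card_finite of_nat_0_less_iff zero_less_power)+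
  have ball: "measure Q (padic_ball n r) = (1 / p) ^ n" if "r \<in> {0..<int p ^ n}" for n r
  proof -
    have "(\<Union>r\<in>{0..<int p ^ n}. padic_ball n r) = (UNIV :: 'p padic_int set)"
    proof (intro equalityI subset_UNIV subsetI)
      fix x :: "'p padic_int"
      have x: "x \<in> padic_ball n (padic_res x n)" by (simp add: padic_ball_def)
      then have "padic_res x n \<in> {0..<int p ^ n}" using empty by blast
      with x show "x \<in> (\<Union>r\<in>{0..<int p ^ n}. padic_ball n r)" by blast
    qed
    then have "1 = measure Q (\<Union>r\<in>{0..<int p ^ n}. padic_ball n r)"
      using Q.prob_space by (simp add: spQ)
    also have "\<dots> = (\<Sum>r\<in>{0..<int p ^ n}. measure Q (padic_ball n r))"
    proof (rule Q.finite_measure_finite_Union)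
      show "disjoint_family_on (padic_ball n :: _ \<Rightarrow> 'p padic_int set) {0..<int p ^ n}"
        by (auto simp: disjoint_family_on_def padic_ball_def)
    qed (auto simp: sQ)
    finally have sum: "(\<Sum>r\<in>{0..<int p ^ n}. measure Q (padic_ball n r)) = (\<Sum>r\<in>{0..<int p ^ n}. (1 / p) ^ n)"
      using p by (simp add: power_one_over)
    show ?thesis
    proof (rule ccontr)
      assume "\<not> ?thesis"
      with lower[OF that] have "(1 / p) ^ n < measure Q (padic_ball n r)" by simp
      with that lower have "(\<Sum>r\<in>{0..<int p ^ n}. (1 / p) ^ n) < (\<Sum>r\<in>{0..<int p ^ n}. measure Q (padic_ball n r))"
        by (intro sum_strict_mono_ex1) auto
      with sum show False by simp
    qed
  qed
  have "distr Q borel (\<lambda>x. t + x) = Q" for t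
  proof (rule sym, rule measure_eqI_generator_eq[where E = "range (\<lambda>(n, r). padic_ball n r)" and \<Omega> = UNIV and A = "\<lambda>_. padic_ball 0 0"])
    have int1: "padic_ball m r \<inter> padic_ball n s \<in> range (\<lambda>(n, r). padic_ball n r :: 'p padic_int set)" if "m \<le> n" for m n r s
    proof (cases "s mod int CARD('p) ^ m = r")
      case True
      then have "padic_ball m r \<inter> padic_ball n s = (padic_ball n s :: 'p padic_int set)"
        using that by (auto simp: padic_ball_def padic_res_mod_le)
      then show ?thesis by auto
    next
      case False
      then have "padic_ball m r \<inter> padic_ball n s = ({} :: 'p padic_int set)"
        using that by (auto simp: padic_ball_def padic_res_mod_le)
      also have "\<dots> = padic_ball 0 1" using empty[of 1 0] by simp
      finally show ?thesis by auto
    qed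
    show "Int_stable (range (\<lambda>(n, r). padic_ball n r :: 'p padic_int set))"
    proof (rule Int_stableI, clarsimp)
      fix m r n s
      show "padic_ball m r \<inter> padic_ball n s \<in> range (\<lambda>(n, r). padic_ball n r :: 'p padic_int set)"
        using int1[of m n r s] int1[of n m s r] by (cases "m \<le> n") (auto simp: Int_commute)
    qed
    have tr: "(\<lambda>x. t + x) \<in> Q \<rightarrow>\<^sub>M borel"
      using measurable_translation[OF continuous_on_padic_add] by (simp cong: measurable_cong_sets add: sQ)
    fix C :: "'p padic_int set" assume "C \<in> range (\<lambda>(n, r). padic_ball n r)"
    then obtain n r where C: "C = padic_ball n r" by auto
    show "emeasure Q C = emeasure (distr Q borel (\<lambda>x. t + x)) C"
    proof (cases "r \<in> {0..<int p ^ n}")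
      case True
      define r' where "r' = (r - padic_res t n) mod int p ^ n"
      have r': "r' \<in> {0..<int p ^ n}" using p by (simp add: r'_def)
      have "(\<lambda>x. t + x) -` padic_ball n r = padic_ball n r'"
      proof (rule equalityI; rule subsetI)
        fix x assume "x \<in> (\<lambda>x. t + x) -` padic_ball n r"
        then have "r = (padic_res t n + padic_res x n) mod int p ^ n"
          by (simp add: padic_ball_def plus_padic_int.rep_eq p_def)
        then show "x \<in> padic_ball n r'"
          by (simp add: padic_ball_def r'_def mod_simps p_def)
      next
        fix x :: "'p padic_int" assume "x \<in> padic_ball n r'"
        then have "(padic_res t n + padic_res x n) mod int p ^ n = r mod int p ^ n"
          by (simp add: padic_ball_def r'_def mod_simps)
        then show "x \<in> (\<lambda>x. t + x) -` padic_ball n r"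
          using True by (simp add: padic_ball_def plus_padic_int.rep_eq p_def)
      qed
      then show ?thesis
        using tr ball[OF True] ball[OF r'] by (simp add: C emeasure_distr spQ Q.emeasure_eq_measure)
    next
      case False
      then show ?thesis by (simp add: C empty)
    qed
  next
    show "(\<Union>i::nat. padic_ball 0 0 :: 'p padic_int set) = UNIV"
    proof -
      have "padic_res x 0 = 0" for x :: "'p padic_int" using padic_res_mod[of x 0] by simp
      then show ?thesis by (simp add: padic_ball_def)
    qed
  qed (auto simp: sQ sets_borel Q.emeasure_eq_measure)
  then have "normalized_haar Q"
    using Q.emeasure_space_1 by (auto simp: normalized_haar_iff_distr[OF continuous_on_padic_add] sQ spQ)
  then show ?thesis ..
qed

type_synonym 'a coeffs = "'a \<times> 'a \<times> 'a \<times> 'a \<times> 'a"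

lemma normalized_haar_haar_measure_padic5:
  "normalized_haar (haar_measure :: 'p::prime_card padic_int coeffs measure)"
proof -
  obtain M :: "'p padic_int measure" where M: "normalized_haar M"
    using normalized_haar_padic_int_exists by blast
  note c1 = continuous_on_padic_add[where 'p = 'p]
  note M2 = normalized_haar_pair[OF c1 c1 M M]
  note M3 = normalized_haar_pair[OF c1 M2(1) M M2(2)]
  note M4 = normalized_haar_pair[OF c1 M3(1) M M3(2)]
  note M5 = normalized_haar_pair[OF c1 M4(1) M M4(2)]
  show ?thesis
    unfolding haar_measure_def
    by (rule theI) (fact M5(2), rule normalized_haar_unique[OF M5(1) _ M5(2)])
qed


section \<open>Weierstrass curves\<close>

datatype 'a point = Infinity | Affine 'a 'a

text \<open>A tuple \<open>(a1, a2, a3, a4, a6)\<close> stands for y^2 + a1 xy + a3 y = x^3 + a2 x^2 + a4 x + a6.\<close>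

fun on_curve :: "'a::field coeffs \<Rightarrow> 'a point \<Rightarrow> bool" where
  "on_curve _ Infinity \<longleftrightarrow> True"
| "on_curve (a1, a2, a3, a4, a6) (Affine x y) \<longleftrightarrow>
     y^2 + a1 * x * y + a3 * y = x^3 + a2 * x^2 + a4 * x + a6"

text \<open>
  Vanishing of both partial derivatives.  The point at infinity of a Weierstrass cubic is always
  smooth.
\<close>

fun singular_at :: "'a::field coeffs \<Rightarrow> 'a point \<Rightarrow> bool" where
  "singular_at _ Infinity \<longleftrightarrow> False"
| "singular_at (a1, a2, a3, a4, a6) (Affine x y) \<longleftrightarrow>
     a1 * y = 3 * x^2 + 2 * a2 * x + a4 \<and> 2 * y + a1 * x + a3 = 0"

fun map_coeffs :: "('a \<Rightarrow> 'b) \<Rightarrow> 'a coeffs \<Rightarrow> 'b coeffs" where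
  "map_coeffs f (a1, a2, a3, a4, a6) = (f a1, f a2, f a3, f a4, f a6)"

definition elliptic_curve :: "'k::field coeffs \<Rightarrow> bool" where
  "elliptic_curve E \<longleftrightarrow>
     (\<forall>P. on_curve (map_coeffs to_ac E) P \<longrightarrow> \<not> singular_at (map_coeffs to_ac E) P)"

text \<open>The chord-tangent law.\<close>

fun point_add :: "'a::field coeffs \<Rightarrow> 'a point \<Rightarrow> 'a point \<Rightarrow> 'a point" where
  "point_add _ Infinity P = P"
| "point_add _ P Infinity = P"
| "point_add (a1, a2, a3, a4, a6) (Affine x1 y1) (Affine x2 y2) =
     (if x1 = x2 \<and> y1 + y2 + a1 * x2 + a3 = 0 then Infinity
      else
        let l = (if x1 = x2
                 then (3 * x1^2 + 2 * a2 * x1 + a4 - a1 * y1) / (2 * y1 + a1 * x1 + a3)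
                 else (y2 - y1) / (x2 - x1));
            v = y1 - l * x1;
            x3 = l^2 + a1 * l - a2 - x1 - x2
        in Affine x3 (- (l + a1) * x3 - v - a3))"

definition point_group :: "'a::field coeffs \<Rightarrow> 'a point monoid" where
  "point_group E = \<lparr>carrier = {P. on_curve E P}, monoid.mult = point_add E, one = Infinity\<rparr>"

text \<open>The absolute Galois group, provided the base field is perfect.\<close>

definition galois_group :: "('k::field alg_closure \<Rightarrow> 'k alg_closure) set" where
  "galois_group = {\<sigma>. bij \<sigma> \<and> (\<forall>x y. \<sigma> (x + y) = \<sigma> x + \<sigma> y) \<and> (\<forall>x y. \<sigma> (x * y) = \<sigma> x * \<sigma> y) \<and>
                      (\<forall>c. \<sigma> (to_ac c) = to_ac c)}"

text \<open>
  For base fields of characteristic 0.  Isogenies from \<open>E\<close> that are defined over the base field are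
  then given, up to isomorphism of the target, by their kernels, the finite Galois-stable subgroups
  of the group of geometric points, and the degree is the order of the kernel.
\<close>

definition has_rational_isogeny :: "'k::field coeffs \<Rightarrow> nat \<Rightarrow> bool" where
  "has_rational_isogeny E d \<longleftrightarrow>
     (\<exists>H. subgroup H (point_group (map_coeffs to_ac E)) \<and> finite H \<and> card H = d \<and>
          (\<forall>\<sigma>\<in>galois_group. map_point \<sigma> ` H = H))"


section \<open>The set of Weierstrass equations with a rational 3-isogeny\<close>

type_synonym 'p padic = "'p padic_int fract"

definition W_iso :: "'p::prime_card padic_int coeffs set" where
  "W_iso = {a. let E = map_coeffs (\<lambda>c. Fract c 1 :: 'p padic) a
               in elliptic_curve E \<and> has_rational_isogeny E 3}"

end

theory Submission
  imports Defs
begin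

text \<open>
  A subgroup of order 3 is \<open>{O, P, -P}\<close> with \<open>2 P = -P\<close>, that is, the x-coordinate of \<open>P\<close> is a root of
  the 3-division polynomial, and the subgroup is Galois stable iff this root is rational. Since 6 is
  a unit of the p-adic integers, completing the square and the cube preserves the measure, so it
  suffices to compute the measure of the set \<open>L\<close> of pairs \<open>(A, B)\<close> of p-adic integers for which
  \<open>3 x^4 + 6 A x^2 + 12 B x - A^2\<close> has a root.

  If \<open>(A, B)\<close> is nonzero modulo \<open>p\<close>, Hensel's lemma applies to a suitable root modulo \<open>p\<close>, and one has
  to count over the residue field: given one root \<open>x\<close>, the other ones are \<open>- x (1 + c)^2 / 3\<close> with
  \<open>c^3 = - 1 - 3 A / x^2\<close>, so that the number of roots depends on the number of cube roots only.
  If \<open>p\<close> divides \<open>A\<close> and \<open>B\<close>, the Newton polygon decides, except when \<open>p^2\<close> divides \<open>A\<close> and \<open>p^3\<close>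
  divides \<open>B\<close>. In that case \<open>(A / p^2, B / p^3)\<close> lies in \<open>L\<close> iff \<open>(A, B)\<close> does, hence the measure of \<open>L\<close>
  is the measure of the part settled before divided by \<open>1 - p^(-5)\<close>.
\<close>

section \<open>Elements fixed by the Galois group\<close>

text \<open>Associativity of the chord-tangent law is never established, so Lagrange's theorem is
  not at hand: that a subgroup of order 3 has the shape above, rather than consisting of
  \<open>Infinity\<close> and two points of order 2, is shown by geometry. Rationality of a
  Galois-fixed x-coordinate requires enough automorphisms of the whole algebraic closure; they come
  from extending partial homomorphisms.

  Hensel's lemma needs a simple root. The derivative of the quartic is 12 (x^3 + A x + B), so a
  multiple root modulo p forces 4 A^3 + 27 B^2 = 0 modulo p; if (A, B) is nonzero there, - 3 x is
  then a simple root.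

  To count residue pairs having at least one root, every pair is counted once for each of its roots
  with weight the inverse of the number of roots. These weights depend on one parameter k, whose
  cube roots produce the other roots. Their average over k is 1/2 if cubing is bijective and 3/4 if
  there are nontrivial cube roots of unity, which is the origin of the leading coefficients in the
  two cases of the formula.\<close>

text \<open>The graph of a homomorphism over the base field from a subring of the algebraic closure to
  the closure.\<close>

definition hom_graph :: "('k::field alg_closure \<times> 'k alg_closure) set \<Rightarrow> bool" where
  "hom_graph G \<longleftrightarrow> (\<forall>c. (to_ac c, to_ac c) \<in> G) \<and>
     (\<forall>a b c d. (a, b) \<in> G \<longrightarrow> (c, d) \<in> G \<longrightarrow> (a + c, b + d) \<in> G \<and> (a * c, b * d) \<in> G) \<and>
     (\<forall>b. (0, b) \<in> G \<longrightarrow> b = 0)"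

text \<open>Says that \<open>g\<close> is the image of \<open>f\<close> under the homomorphism with
  graph \<open>G\<close>. The relational form avoids both a type for the domain, which is only a
  subring, and a function that would need values outside of it.\<close>

definition graph_polys ::
    "('k::field alg_closure \<times> 'k alg_closure) set \<Rightarrow> 'k alg_closure poly \<Rightarrow> 'k alg_closure poly \<Rightarrow> bool" where
  "graph_polys G f g \<longleftrightarrow> (\<forall>i. (poly.coeff f i, poly.coeff g i) \<in> G)"

context
  fixes G :: "('k::field alg_closure \<times> 'k alg_closure) set"
  assumes G: "hom_graph G"
begin

lemma hom_graph_const: "(to_ac c, to_ac c) \<in> G"
  using G by (auto simp: hom_graph_def)

lemma hom_graph_0: "(0, 0) \<in> G" and hom_graph_1: "(1, 1) \<in> G"
  using hom_graph_const[of 0] hom_graph_const[of 1] by auto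

lemma hom_graph_add: "(a, b) \<in> G \<Longrightarrow> (c, d) \<in> G \<Longrightarrow> (a + c, b + d) \<in> G"
  and hom_graph_mult: "(a, b) \<in> G \<Longrightarrow> (c, d) \<in> G \<Longrightarrow> (a * c, b * d) \<in> G"
  using G unfolding hom_graph_def by blast+

lemma hom_graph_zeroD: "(0, b) \<in> G \<Longrightarrow> b = 0"
  using G by (auto simp: hom_graph_def)

lemma hom_graph_diff: "(a, b) \<in> G \<Longrightarrow> (c, d) \<in> G \<Longrightarrow> (a - c, b - d) \<in> G"
  using hom_graph_add[of a b "to_ac (-1) * c" "to_ac (-1) * d"] hom_graph_mult[OF hom_graph_const[of "-1"], of c d]
  by simp

lemma hom_graph_functional: "(a, b) \<in> G \<Longrightarrow> (a, c) \<in> G \<Longrightarrow> b = c"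
  using hom_graph_diff[of a b a c] hom_graph_zeroD by fastforce

lemma hom_graph_power: "(a, b) \<in> G \<Longrightarrow> (a ^ n, b ^ n) \<in> G"
  by (induction n) (auto intro: hom_graph_1 hom_graph_mult)

lemma hom_graph_sum: "(\<And>i. i \<in> I \<Longrightarrow> (f i, g i) \<in> G) \<Longrightarrow> (sum f I, sum g I) \<in> G"
  by (induction I rule: infinite_finite_induct) (auto intro: hom_graph_0 hom_graph_add)

lemma graph_polys_const: "graph_polys G (map_poly to_ac q) (map_poly to_ac q)"
  by (auto simp: graph_polys_def coeff_map_poly hom_graph_const)

lemma graph_polys_pCons: "(a, b) \<in> G \<Longrightarrow> graph_polys G f g \<Longrightarrow> graph_polys G (pCons a f) (pCons b g)"
  by (auto simp: graph_polys_def coeff_pCons split: nat.splits)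

lemma graph_polys_0: "graph_polys G 0 0"
  by (auto simp: graph_polys_def hom_graph_0)

lemma graph_polys_add: "graph_polys G f g \<Longrightarrow> graph_polys G f' g' \<Longrightarrow> graph_polys G (f + f') (g + g')"
  by (auto simp: graph_polys_def hom_graph_add)

lemma graph_polys_diff: "graph_polys G f g \<Longrightarrow> graph_polys G f' g' \<Longrightarrow> graph_polys G (f - f') (g - g')"
  by (auto simp: graph_polys_def hom_graph_diff)

lemma graph_polys_mult: "graph_polys G f g \<Longrightarrow> graph_polys G f' g' \<Longrightarrow> graph_polys G (f * f') (g * g')"
  by (auto simp: graph_polys_def coeff_mult intro!: hom_graph_sum hom_graph_mult)

lemma graph_polys_smult: "(a, b) \<in> G \<Longrightarrow> graph_polys G f g \<Longrightarrow> graph_polys G (Polynomial.smult a f) (Polynomial.smult b g)"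
  by (auto simp: graph_polys_def hom_graph_mult)

lemma graph_polys_monom: "graph_polys G (Polynomial.monom 1 k) (Polynomial.monom 1 k)"
  by (auto simp: graph_polys_def hom_graph_0 hom_graph_1)

lemma graph_polys_eval:
  assumes "graph_polys G f g" "(a, b) \<in> G"
  shows "(poly f a, poly g b) \<in> G"
proof -
  define N where "N = max (Polynomial.degree f) (Polynomial.degree g)"
  have eval: "poly h x = (\<Sum>i\<le>N. poly.coeff h i * x ^ i)" if "Polynomial.degree h \<le> N"
    for h :: "'k alg_closure poly" and x
    unfolding poly_altdef using that
    by (intro sum.mono_neutral_left) (auto simp: coeff_eq_0 not_le)
  have "poly f a = (\<Sum>i\<le>N. poly.coeff f i * a ^ i)" "poly g b = (\<Sum>i\<le>N. poly.coeff g i * b ^ i)"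
    by (rule eval; simp add: N_def)+
  then show ?thesis
    using assms by (auto simp: graph_polys_def intro!: hom_graph_sum hom_graph_mult hom_graph_power)
qed

text \<open>A nonzero element of the closure is a root of a polynomial with nonzero constant term, which
  cannot vanish at 0.\<close>

lemma hom_graph_injective:
  assumes "(c, 0) \<in> G" shows "c = 0"
proof (rule ccontr)
  assume c: "c \<noteq> 0"
  obtain p :: "'k poly" where p: "p \<noteq> 0" "poly (map_poly to_ac p) c = 0"
    by (rule alg_closure_algebraic)
  have "p \<noteq> 0 \<Longrightarrow> poly (map_poly to_ac p) c = 0 \<Longrightarrow> False"
  proof (induction p)
    case (pCons a p)
    show False
    proof (cases "a = 0")
      case True
      then show False using pCons c by (auto simp: map_poly_pCons)
    next
      case False
      have "(poly (map_poly to_ac (pCons a p)) c, poly (map_poly to_ac (pCons a p)) 0) \<in> G"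
        by (rule graph_polys_eval[OF graph_polys_const assms])
      with pCons.prems have "(0, to_ac a) \<in> G" by (simp add: map_poly_pCons)
      then show False using hom_graph_zeroD False by fastforce
    qed
  qed auto
  with p show False by blast
qed

text \<open>\<open>m\<close> plays the role of a minimal polynomial of \<alpha> over the domain of
  \<open>G\<close>, and \<open>n\<close> is its image. The extension sends f(\<alpha>) to g(\<beta>)
  whenever \<open>f\<close> corresponds to \<open>g\<close>. It is well defined because f(\<alpha>)
  = 0 implies g(\<beta>) = 0, by descent on the degree of \<open>f\<close>.\<close>

lemma hom_graph_extend:
  assumes mn: "graph_polys G m n" "m \<noteq> 0"
    and min: "\<And>f g. graph_polys G f g \<Longrightarrow> f \<noteq> 0 \<Longrightarrow> poly f \<alpha> = 0 \<Longrightarrow> Polynomial.degree m \<le> Polynomial.degree f"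
    and \<beta>: "poly m \<alpha> = 0" "poly n \<beta> = 0"
  shows "\<exists>G'. hom_graph G' \<and> G \<subseteq> G' \<and> (\<alpha>, \<beta>) \<in> G'"
proof -
  have key: "poly g \<beta> = 0" if "graph_polys G f g" "poly f \<alpha> = 0" for f g
    using that
  proof (induction "Polynomial.degree f" arbitrary: f g rule: less_induct)
    case less
    show ?case
    proof (cases "f = 0")
      case True
      then have "g = 0"
        using less.prems hom_graph_zeroD by (auto simp: graph_polys_def poly_eq_iff)
      then show ?thesis by simp
    next
      case False
      have df: "Polynomial.degree f > 0"
      proof (rule ccontr)
        assume "\<not> Polynomial.degree f > 0"
        then obtain a where "f = [:a:]" using degree_eq_zeroE by blast
        then show False using False less.prems by auto
      qed
      let ?d = "Polynomial.degree"
      have le: "?d m \<le> ?d f" using min less.prems False by blast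
      define k where "k = ?d f - ?d m"
      define lm ln lf lg where l_defs: "lm = poly.coeff m (?d m)" "ln = poly.coeff n (?d m)"
        "lf = poly.coeff f (?d f)" "lg = poly.coeff g (?d f)"
      \<comment> \<open>Pseudo-division: the domain need not be a field, so leading coefficients are
        cross-multiplied instead of inverted. The same operation on the image side gives a
        corresponding pair with \<open>f'\<close> of smaller degree.\<close>
      define f' where "f' = Polynomial.smult lm f - Polynomial.smult lf (Polynomial.monom 1 k * m)"
      define g' where "g' = Polynomial.smult ln g - Polynomial.smult lg (Polynomial.monom 1 k * n)"
      have l: "(lm, ln) \<in> G" "(lf, lg) \<in> G" using mn less.prems by (auto simp: graph_polys_def l_defs)
      \<comment> \<open>Injectivity is what allows \<open>ln\<close> to be cancelled from
        g'(\<beta>) = 0 at the end.\<close>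
      have ln: "ln \<noteq> 0" using hom_graph_injective[of lm] l mn(2) by (auto simp: l_defs)
      have gp: "graph_polys G f' g'"
        unfolding f'_def g'_def using l mn less.prems
        by (intro graph_polys_diff graph_polys_smult graph_polys_mult graph_polys_monom)
      have root: "poly f' \<alpha> = 0" using less.prems \<beta> by (simp add: f'_def)
      have "?d (Polynomial.monom 1 k * m) \<le> ?d f"
        using le by (intro order.trans[OF degree_mult_le]) (auto simp: k_def Polynomial.degree_monom_eq)
      then have "?d f' \<le> ?d f"
        unfolding f'_def by (intro degree_diff_le order.trans[OF degree_smult_le]) auto
      moreover have "poly.coeff f' (?d f) = 0"
        using le by (simp add: f'_def coeff_monom_mult k_def l_defs)
      ultimately have "f' = 0 \<or> ?d f' < ?d f" by (rule eq_zero_or_degree_less)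
      then have "?d f' < ?d f" using df by auto
      from less.hyps[OF this gp root] have "poly g' \<beta> = 0" .
      then show ?thesis using ln \<beta> by (simp add: g'_def)
    qed
  qed
  define G' where "G' = {(poly f \<alpha>, poly g \<beta>) | f g. graph_polys G f g}"
  have sub: "G \<subseteq> G'"
  proof clarify
    fix a b assume "(a, b) \<in> G"
    then have "graph_polys G [:a:] [:b:]" by (intro graph_polys_pCons graph_polys_0)
    then show "(a, b) \<in> G'" by (force simp: G'_def)
  qed
  have "graph_polys G [:0, 1:] [:0, 1:]"
    by (intro graph_polys_pCons graph_polys_0 hom_graph_0 hom_graph_1)
  then have "(\<alpha>, \<beta>) \<in> G'" by (force simp: G'_def)
  moreover have "hom_graph G'"
    unfolding hom_graph_def
  proof (intro conjI allI impI)
    show "(to_ac c, to_ac c) \<in> G'" for c using sub hom_graph_const by blast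
    show "b = 0" if "(0, b) \<in> G'" for b using that key by (auto simp: G'_def)
    fix a b c d assume "(a, b) \<in> G'" "(c, d) \<in> G'"
    then obtain f g f' g' where fg: "a = poly f \<alpha>" "b = poly g \<beta>" "c = poly f' \<alpha>" "d = poly g' \<beta>"
      "graph_polys G f g" "graph_polys G f' g'" unfolding G'_def by blast
    show "(a + c, b + d) \<in> G'" unfolding G'_def mem_Collect_eq
      by (rule exI[of _ "f + f'"], rule exI[of _ "g + g'"]) (auto simp: fg graph_polys_add)
    show "(a * c, b * d) \<in> G'" unfolding G'_def mem_Collect_eq
      by (rule exI[of _ "f * f'"], rule exI[of _ "g * g'"]) (auto simp: fg graph_polys_mult)
  qed
  ultimately show ?thesis using sub by blast
qed

lemma minimal_graph_polys:
  obtains m n where "graph_polys G m n" "m \<noteq> 0" "poly m \<alpha> = 0"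
    "\<And>f g. graph_polys G f g \<Longrightarrow> f \<noteq> 0 \<Longrightarrow> poly f \<alpha> = 0 \<Longrightarrow> Polynomial.degree m \<le> Polynomial.degree f"
proof -
  define P where "P z \<longleftrightarrow> graph_polys G (fst z) (snd z) \<and> fst z \<noteq> 0 \<and> poly (fst z) \<alpha> = 0" for z
  obtain p :: "'k poly" where p: "p \<noteq> 0" "poly (map_poly to_ac p) \<alpha> = 0"
    by (rule alg_closure_algebraic)
  then have "P (map_poly to_ac p, map_poly to_ac p)"
    by (auto simp: P_def graph_polys_const poly_eq_iff coeff_map_poly)
  from ex_has_least_nat[of P, OF this, of "\<lambda>z. Polynomial.degree (fst z)"]
  obtain z where "P z" "\<And>y. P y \<Longrightarrow> Polynomial.degree (fst z) \<le> Polynomial.degree (fst y)" by blast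
  then show ?thesis using that[of "fst z" "snd z"] unfolding P_def by force
qed

end

text \<open>Zorn's lemma yields a maximal partial homomorphism. Adjoining one more element would
  contradict maximality, so it is total; it is onto because it permutes the finite root set of each
  polynomial over the base field.\<close>

lemma hom_graph_imp_galois:
  fixes G :: "('k::field alg_closure \<times> 'k alg_closure) set"
  assumes "hom_graph G"
  obtains \<sigma> where "\<sigma> \<in> galois_group" "\<And>a b. (a, b) \<in> G \<Longrightarrow> \<sigma> a = b"
proof -
  define A where "A = {H. hom_graph H \<and> G \<subseteq> H}"
  have "\<exists>M\<in>A. \<forall>Y\<in>A. M \<subseteq> Y \<longrightarrow> Y = M"
  proof (rule subset_Zorn_nonempty)
    fix C assume "C \<noteq> {}" "subset.chain A C"
    note C = this[unfolded A_def]
    have "hom_graph (\<Union> C)"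
      unfolding hom_graph_def
    proof (intro conjI allI impI)
      show "(to_ac c, to_ac c) \<in> \<Union> C" for c
        using C hom_graph_const[of _ c] by (fastforce simp: subset.chain_def)
      show "b = 0" if "(0, b) \<in> \<Union> C" for b
        using C that hom_graph_zeroD[of _ b] by (fastforce simp: subset.chain_def)
      fix a b c d assume "(a, b) \<in> \<Union> C" "(c, d) \<in> \<Union> C"
      then obtain U V where UV: "U \<in> C" "V \<in> C" "(a, b) \<in> U" "(c, d) \<in> V" by blast
      with C have "U \<subseteq> V \<or> V \<subseteq> U" unfolding subset.chain_def by blast
      then obtain Z where Z: "Z \<in> C" "(a, b) \<in> Z" "(c, d) \<in> Z" using UV by blast
      with C have "hom_graph Z" by (auto simp: subset.chain_def)
      with Z show "(a + c, b + d) \<in> \<Union> C" "(a * c, b * d) \<in> \<Union> C"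
        using hom_graph_add[of Z a b c d] hom_graph_mult[of Z a b c d] by blast+
    qed
    then show "\<Union> C \<in> A"
      using C unfolding A_def by (fastforce simp: subset.chain_def)
  qed (use assms A_def in blast)
  then obtain M where M: "hom_graph M" "G \<subseteq> M"
    and max: "\<And>Y. hom_graph Y \<Longrightarrow> M \<subseteq> Y \<Longrightarrow> Y = M" unfolding A_def by auto
  have total: "\<exists>\<beta>. (\<alpha>, \<beta>) \<in> M" for \<alpha>
  proof -
    obtain m n where mn: "graph_polys M m n" "m \<noteq> 0" "poly m \<alpha> = 0"
      "\<And>f g. graph_polys M f g \<Longrightarrow> f \<noteq> 0 \<Longrightarrow> poly f \<alpha> = 0 \<Longrightarrow> Polynomial.degree m \<le> Polynomial.degree f"
      using minimal_graph_polys[OF M(1), of \<alpha>] by blast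
    \<comment> \<open>\<open>m\<close> and \<open>n\<close> have the same nonzero coefficients.
      Hence \<open>n\<close> is nonconstant along with \<open>m\<close>, and a root \<beta> exists
      to which \<alpha> can be sent.\<close>
    have zero_iff: "poly.coeff m i = 0 \<longleftrightarrow> poly.coeff n i = 0" for i
      using mn(1) hom_graph_zeroD[OF M(1)] hom_graph_injective[OF M(1)] by (metis graph_polys_def)
    have "Polynomial.degree n > 0"
    proof (rule ccontr)
      assume "\<not> Polynomial.degree n > 0"
      then have "poly.coeff m i = 0" if "i > 0" for i
        using that zero_iff[of i] by (simp add: coeff_eq_0)
      then have "Polynomial.degree m = 0" by (metis gr0I leading_coeff_0_iff mn(2))
      then obtain a where "m = [:a:]" using degree_eq_zeroE by blast
      then show False using mn by auto
    qed
    then obtain \<beta> where "poly n \<beta> = 0" using alg_closed_imp_poly_has_root by blast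
    have "\<exists>G'. hom_graph G' \<and> M \<subseteq> G' \<and> (\<alpha>, \<beta>) \<in> G'"
      by (rule hom_graph_extend[OF M(1), of m n]) (use mn \<open>poly n \<beta> = 0\<close> in auto)
    then show ?thesis using max by blast
  qed
  define \<sigma> where "\<sigma> a = (THE b. (a, b) \<in> M)" for a
  have \<sigma>_iff: "(a, b) \<in> M \<longleftrightarrow> \<sigma> a = b" for a b
    using total[of a] hom_graph_functional[OF M(1)] unfolding \<sigma>_def by (metis the_equality)
  then have \<sigma>: "(a, \<sigma> a) \<in> M" for a by blast
  have add: "\<sigma> (a + b) = \<sigma> a + \<sigma> b" and mult: "\<sigma> (a * b) = \<sigma> a * \<sigma> b"
    and diff: "\<sigma> (a - b) = \<sigma> a - \<sigma> b" for a b
    using hom_graph_add[OF M(1) \<sigma> \<sigma>] hom_graph_mult[OF M(1) \<sigma> \<sigma>] hom_graph_diff[OF M(1) \<sigma> \<sigma>] \<sigma>_iff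
    by blast+
  have inj: "inj \<sigma>"
  proof (rule injI)
    fix a b assume "\<sigma> a = \<sigma> b"
    then have "(a - b, 0) \<in> M" using \<sigma>_iff by (simp add: diff)
    then show "a = b" using hom_graph_injective[OF M(1)] by fastforce
  qed
  have surj: "\<exists>x. \<sigma> x = y" for y
  proof -
    obtain p :: "'k poly" where p: "p \<noteq> 0" "poly (map_poly to_ac p) y = 0"
      by (rule alg_closure_algebraic)
    define R where "R = {z. poly (map_poly to_ac p) z = 0}"
    have "map_poly to_ac p \<noteq> 0" using p by (auto simp: poly_eq_iff coeff_map_poly)
    then have "finite R" unfolding R_def by (rule poly_roots_finite)
    moreover have "\<sigma> ` R \<subseteq> R"
    proof (rule image_subsetI)
      fix z assume "z \<in> R"
      then have "(0, poly (map_poly to_ac p) (\<sigma> z)) \<in> M"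
        using graph_polys_eval[OF M(1) graph_polys_const[OF M(1)] \<sigma>, of p z] by (simp add: R_def)
      then show "\<sigma> z \<in> R" using hom_graph_zeroD[OF M(1)] by (simp add: R_def)
    qed
    ultimately have "\<sigma> ` R = R"
      using inj by (intro endo_inj_surj) (auto intro: inj_on_subset)
    moreover have "y \<in> R" using p by (simp add: R_def)
    ultimately show ?thesis by (metis imageE)
  qed
  have "\<sigma> \<in> galois_group"
    using add mult inj surj \<sigma>_iff hom_graph_const[OF M(1)]
    by (auto simp: galois_group_def bij_def surj_def) metis
  then show ?thesis using that \<sigma>_iff M(2) by blast
qed

text \<open>Over the diagonal of the base field, \<open>m\<close> is a minimal polynomial of
  \<open>x\<close>. If its degree exceeds 1 it has a root \<open>y\<close> other than
  \<open>x\<close>, since in characteristic 0 a double root would be a root of the nonzero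
  derivative of smaller degree. The homomorphism sending \<open>x\<close> to \<open>y\<close>
  extends to an automorphism that moves \<open>x\<close>.\<close>

theorem galois_fixed_imp_base:
  fixes x :: "'k::field_char_0 alg_closure"
  assumes fixed: "\<And>\<sigma>. \<sigma> \<in> galois_group \<Longrightarrow> \<sigma> x = x"
  shows "x \<in> range to_ac"
proof -
  define G where "G = range (\<lambda>c::'k. (to_ac c, to_ac c))"
  have G: "hom_graph G"
    unfolding hom_graph_def G_def
    by (auto simp flip: to_ac_add to_ac_mult)
  obtain m n where mn: "graph_polys G m n" "m \<noteq> 0" "poly m x = 0"
    and min: "\<And>f g. graph_polys G f g \<Longrightarrow> f \<noteq> 0 \<Longrightarrow> poly f x = 0 \<Longrightarrow> Polynomial.degree m \<le> Polynomial.degree f"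
    using minimal_graph_polys[OF G, of x] by blast
  have coeff_range: "poly.coeff m i \<in> range to_ac" for i
    using mn(1) by (auto simp: graph_polys_def G_def dest: spec[of _ i])
  have nm: "n = m"
    using mn(1) unfolding graph_polys_def G_def poly_eq_iff by (metis (no_types, lifting) Pair_inject imageE)
  obtain q where q: "m = [:-x, 1:] * q" using mn(3) by (auto simp: poly_eq_0_iff_dvd)
  have degm: "Polynomial.degree m = Suc (Polynomial.degree q)"
    using mn(2) q by (subst q, subst degree_mult_eq) auto
  show ?thesis
  proof (cases "Polynomial.degree q = 0")
    case True
    then obtain a where a: "q = [:a:]" using degree_eq_zeroE by blast
    then have "m = [:- (x * a), a:]" using q by simp
    then have "- (x * a) \<in> range to_ac" "a \<in> range to_ac" "a \<noteq> 0"
      using coeff_range[of 0] coeff_range[of 1] mn(2) by auto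
    then obtain b c where "- (x * to_ac b) = to_ac c" "to_ac b \<noteq> 0" by auto
    then have "x = to_ac (- c / b)" by (simp add: field_simps) (metis minus_minus)
    then show ?thesis by blast
  next
    case False
    then obtain y where y: "poly q y = 0" using alg_closed_imp_poly_has_root by blast
    have "y \<noteq> x"
    proof
      assume "y = x"
      have "graph_polys G (pderiv m) (pderiv m)"
        unfolding graph_polys_def G_def
      proof
        fix i
        obtain c where "poly.coeff m (Suc i) = to_ac c" using coeff_range by blast
        then have "poly.coeff (pderiv m) i = to_ac (of_nat (Suc i) * c)" by (simp add: coeff_pderiv)
        then show "(poly.coeff (pderiv m) i, poly.coeff (pderiv m) i) \<in> range (\<lambda>c. (to_ac c, to_ac c))"
          by blast
      qed
      moreover have "poly (pderiv m) x = 0"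
        using y \<open>y = x\<close> by (simp add: q pderiv_mult del: mult_pCons_left)
      moreover have "pderiv m \<noteq> 0" using degm by (simp add: pderiv_eq_0_iff)
      ultimately have "Polynomial.degree m \<le> Polynomial.degree (pderiv m)" using min by blast
      then show False using degm by (simp add: degree_pderiv)
    qed
    have "poly m y = 0" using y q by simp
    have "\<exists>G'. hom_graph G' \<and> G \<subseteq> G' \<and> (x, y) \<in> G'"
      by (rule hom_graph_extend[OF G, of m m]) (use mn min nm \<open>poly m y = 0\<close> in auto)
    then obtain G' where "hom_graph G'" "(x, y) \<in> G'" by blast
    then show ?thesis
      using hom_graph_imp_galois[of G'] fixed \<open>y \<noteq> x\<close> by metis
  qed
qed

section \<open>Isogenies of degree 3 and the 3-division polynomial\<close>

text \<open>The classical form is 3 x^4 + b2 x^3 + 3 b4 x^2 + 3 b6 x + b8, with the b-invariants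
  written out.\<close>

fun psi3 :: "'a::comm_ring_1 coeffs \<Rightarrow> 'a \<Rightarrow> 'a" where
  "psi3 (a1, a2, a3, a4, a6) x = 3 * x^4 + (a1^2 + 4 * a2) * x^3 + 3 * (2 * a4 + a1 * a3) * x^2
     + 3 * (a3^2 + 4 * a6) * x + (a1^2 * a6 + 4 * a2 * a6 - a1 * a3 * a4 + a2 * a3^2 - a4^2)"

fun point_neg :: "'a::field coeffs \<Rightarrow> 'a point \<Rightarrow> 'a point" where
  "point_neg _ Infinity = Infinity"
| "point_neg (a1, a2, a3, a4, a6) (Affine x y) = Affine x (- y - a1 * x - a3)"

text \<open>\<open>N / u\<close> is the slope of the tangent at P = (x, y), so the left side is u^2
  (x(2P) - x). The difference of the two sides is a multiple of the curve equation with cofactor 12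
  x + b2.\<close>

lemma tangent_psi3:
  fixes x y :: "'a::comm_ring_1"
  assumes "y^2 + a1 * x * y + a3 * y = x^3 + a2 * x^2 + a4 * x + a6"
  defines "N \<equiv> 3 * x^2 + 2 * a2 * x + a4 - a1 * y" and "u \<equiv> 2 * y + a1 * x + a3"
  shows "N^2 + a1 * N * u - (a2 + 3 * x) * u^2 = - psi3 (a1, a2, a3, a4, a6) x"
proof -
  have "N^2 + a1 * N * u - (a2 + 3 * x) * u^2 + psi3 (a1, a2, a3, a4, a6) x
    = - (12 * x + a1^2 + 4 * a2) * (y^2 + a1 * x * y + a3 * y - (x^3 + a2 * x^2 + a4 * x + a6))"
    by (simp add: N_def u_def algebra_simps power2_eq_square power3_eq_cube power4_eq_xxxx)
  then show ?thesis using assms(1) by (simp add: eq_neg_iff_add_eq_0 del: psi3.simps)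
qed

lemma on_curve_point_neg: "on_curve E P \<Longrightarrow> on_curve E (point_neg E P)"
  by (cases E; cases P) (simp_all add: algebra_simps power2_eq_square)

lemma point_neg_neg [simp]: "point_neg E (point_neg E P) = P"
  by (cases E; cases P) auto

lemma point_add_neg [simp]: "point_add E P (point_neg E P) = Infinity" "point_add E (point_neg E P) P = Infinity"
  by (cases E; cases P; simp)+

lemma point_add_eq_Infinity: "point_add E P Q = Infinity \<Longrightarrow> Q = point_neg E P"
  by (cases E; cases P; cases Q) (auto simp: Let_def algebra_simps eq_neg_iff_add_eq_0 split: if_splits)

lemma m_inv_point_group:
  assumes "on_curve E P" shows "m_inv (point_group E) P = point_neg E P"
  unfolding m_inv_def
  by (rule the_equality) (use assms in \<open>auto simp: point_group_def on_curve_point_neg dest: point_add_eq_Infinity\<close>)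

lemma tripling_imp_psi3:
  fixes E :: "'a::field coeffs"
  assumes "on_curve E (Affine x y)" "point_add E (Affine x y) (Affine x y) = Affine x z"
  shows "psi3 E x = 0"
proof -
  obtain a1 a2 a3 a4 a6 where E: "E = (a1, a2, a3, a4, a6)" by (metis prod_cases5)
  define N u where Nu: "N = 3 * x^2 + 2 * a2 * x + a4 - a1 * y" "u = 2 * y + a1 * x + a3"
  have u: "u \<noteq> 0" using assms by (auto simp: E Nu)
  then have "y + y + a1 * x + a3 \<noteq> 0" by (simp add: Nu)
  then have "(N / u)^2 + a1 * (N / u) - a2 - x - x = x"
    using assms by (simp add: E Let_def Nu)
  then have "N^2 + a1 * N * u - (a2 + 3 * x) * u^2 = 0"
    using u by (simp add: field_simps power2_eq_square)
  with tangent_psi3[of y a1 x a3 a2 a4 a6] assms(1) show ?thesis by (simp add: E Nu del: psi3.simps)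
qed

lemma psi3_imp_double:
  fixes E :: "'a::field coeffs"
  assumes "on_curve E (Affine x y)" "psi3 E x = 0" "point_neg E (Affine x y) \<noteq> Affine x y"
  shows "point_add E (Affine x y) (Affine x y) = point_neg E (Affine x y)"
proof -
  obtain a1 a2 a3 a4 a6 where E: "E = (a1, a2, a3, a4, a6)" by (metis prod_cases5)
  define N u where Nu: "N = 3 * x^2 + 2 * a2 * x + a4 - a1 * y" "u = 2 * y + a1 * x + a3"
  have u: "u \<noteq> 0" using assms(3) by (auto simp: E Nu algebra_simps eq_neg_iff_add_eq_0)
  then have yy: "y + y + a1 * x + a3 \<noteq> 0" by (simp add: Nu)
  have "N^2 + a1 * N * u - (a2 + 3 * x) * u^2 = 0"
    using tangent_psi3[of y a1 x a3 a2 a4 a6] assms(1,2) by (simp add: E Nu del: psi3.simps)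
  then have *: "(N / u)^2 + a1 * (N / u) - a2 - x - x = x"
    using u by (simp add: field_simps power2_eq_square)
  have "point_add E (Affine x y) (Affine x y) = Affine x (- (N / u + a1) * x - (y - N / u * x) - a3)"
    using yy * by (simp add: E Let_def Nu)
  then show ?thesis by (simp add: E algebra_simps)
qed

text \<open>At a point with P = -P one has u = 0, and the tangent identity leaves N^2 = 0, so both
  partial derivatives vanish.\<close>

lemma psi3_imp_not_2_torsion:
  fixes E :: "'a::field_char_0 coeffs"
  assumes "\<And>P. on_curve E P \<Longrightarrow> \<not> singular_at E P" "on_curve E (Affine x y)" "psi3 E x = 0"
  shows "point_neg E (Affine x y) \<noteq> Affine x y"
proof
  obtain a1 a2 a3 a4 a6 where E: "E = (a1, a2, a3, a4, a6)" by (metis prod_cases5)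
  assume "point_neg E (Affine x y) = Affine x y"
  then have u: "2 * y + a1 * x + a3 = 0" by (simp add: E algebra_simps eq_neg_iff_add_eq_0 mult_2)
  then have "(3 * x^2 + 2 * a2 * x + a4 - a1 * y)^2 = 0"
    using tangent_psi3[of y a1 x a3 a2 a4 a6] assms(2,3) by (simp add: E del: psi3.simps)
  then have "singular_at E (Affine x y)" using u by (simp add: E)
  then show False using assms(1,2) by blast
qed

text \<open>If the third intersection point of the chord through two points of order 2 is one of the two,
  then the cubic in x has a double root there.\<close>

lemma two_torsion_chord_singular:
  fixes E :: "'a::field_char_0 coeffs"
  assumes E: "E = (a1, a2, a3, a4, a6)"
    and P: "on_curve E (Affine x1 y1)" "2 * y1 + a1 * x1 + a3 = 0"
    and Q: "on_curve E (Affine x2 y2)" "2 * y2 + a1 * x2 + a3 = 0"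
    and "x1 \<noteq> x2" and l: "l * (x2 - x1) = y2 - y1" and x3: "l^2 + a1 * l - a2 - x1 - x2 = x1"
  shows "singular_at E (Affine x1 y1)"
proof -
  have "(2 * l + a1) * (x2 - x1) = 2 * (l * (x2 - x1) - (y2 - y1)) + (2 * y2 + a1 * x2 + a3) - (2 * y1 + a1 * x1 + a3)"
    by (simp add: algebra_simps)
  then have "(2 * l + a1) * (x2 - x1) = 0" using l P(2) Q(2) by simp
  then have a1: "a1 = - 2 * l" using \<open>x1 \<noteq> x2\<close> by (simp add: eq_neg_iff_add_eq_0 add.commute)
  have a2: "a2 = l^2 + a1 * l - 2 * x1 - x2" using x3 by (simp add: algebra_simps)
  have b2: "a1^2 + 4 * a2 = - 4 * (2 * x1 + x2)"
    by (simp add: a2 a1 algebra_simps power2_eq_square)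
  have cubic: "4 * x^3 + (a1^2 + 4 * a2) * x^2 + 2 * (2 * a4 + a1 * a3) * x + (a3^2 + 4 * a6) = 0"
    if "on_curve E (Affine x y)" "2 * y + a1 * x + a3 = 0" for x y
  proof -
    have a3: "a3 = - 2 * y - a1 * x" using that(2) by (simp add: algebra_simps eq_neg_iff_add_eq_0)
    have a6: "a6 = y^2 + a1 * x * y + a3 * y - x^3 - a2 * x^2 - a4 * x"
      using that(1) by (simp add: E algebra_simps)
    show ?thesis by (simp add: a6 a3 algebra_simps power2_eq_square power3_eq_cube)
  qed
  define b2 b4 b6 where b: "b2 = a1^2 + 4 * a2" "b4 = 2 * a4 + a1 * a3" "b6 = a3^2 + 4 * a6"
  have "(x1 - x2) * (4 * (x1^2 + x1 * x2 + x2^2) + b2 * (x1 + x2) + 2 * b4)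
      = (4 * x1^3 + b2 * x1^2 + 2 * b4 * x1 + b6) - (4 * x2^3 + b2 * x2^2 + 2 * b4 * x2 + b6)"
    by (simp add: algebra_simps power2_eq_square power3_eq_cube)
  then have "4 * (x1^2 + x1 * x2 + x2^2) + b2 * (x1 + x2) + 2 * b4 = 0"
    using cubic[OF P, folded b] cubic[OF Q, folded b] \<open>x1 \<noteq> x2\<close> by simp
  then have b4: "2 * b4 = - (4 * (x1^2 + x1 * x2 + x2^2) + b2 * (x1 + x2))"
    unfolding eq_neg_iff_add_eq_0 by (simp add: ac_simps)
  have "4 * (3 * x1^2 + 2 * a2 * x1 + a4 - a1 * y1) = 12 * x1^2 + 2 * b2 * x1 + 2 * b4 - 2 * a1 * (2 * y1 + a1 * x1 + a3)"
    by (simp add: b algebra_simps power2_eq_square)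
  also have "\<dots> = 0" unfolding P(2) b4 b2[folded b(1)] by (simp add: algebra_simps power2_eq_square)
  finally have "3 * x1^2 + 2 * a2 * x1 + a4 - a1 * y1 = 0" by (metis mult_eq_0_iff zero_neq_numeral)
  then show ?thesis using P(2) by (simp add: E)
qed

text \<open>If the nonzero elements P and Q are opposite, they share their x-coordinate, and 2P is
  one of them, so x(2P) = x(P). Otherwise both are their own inverses; then the chord through them
  has to meet the curve again at P or Q, which smoothness forbids.\<close>

lemma order_3_subgroup_psi3:
  fixes E :: "'a::field_char_0 coeffs"
  assumes smooth: "\<And>P. on_curve E P \<Longrightarrow> \<not> singular_at E P"
    and H: "subgroup H (point_group E)" "card H = 3"
  obtains x y where "H = {Infinity, Affine x y, point_neg E (Affine x y)}" "psi3 E x = 0"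
proof -
  interpret subgroup H "point_group E" by (rule H)
  have on: "on_curve E P" if "P \<in> H" for P using subset that by (auto simp: point_group_def)
  have Inf: "Infinity \<in> H" using one_closed by (simp add: point_group_def)
  have add: "point_add E P Q \<in> H" if "P \<in> H" "Q \<in> H" for P Q
    using m_closed[OF that] by (simp add: point_group_def)
  have neg: "point_neg E P \<in> H" if "P \<in> H" for P
    using m_inv_closed[OF that] that by (simp add: m_inv_point_group on)
  have "finite H" using H(2) by (metis card.infinite zero_neq_numeral)
  then have "card (H - {Infinity}) = 2" using H(2) Inf by simp
  then obtain P Q where PQ: "H - {Infinity} = {P, Q}" "P \<noteq> Q" by (auto simp: card_2_iff)
  then have Heq: "H = {Infinity, P, Q}" and nI: "P \<noteq> Infinity" "Q \<noteq> Infinity" using Inf by blast+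
  obtain x1 y1 x2 y2 where P: "P = Affine x1 y1" and Q: "Q = Affine x2 y2"
    using nI by (metis point.exhaust)
  obtain a1 a2 a3 a4 a6 where E: "E = (a1, a2, a3, a4, a6)" by (metis prod_cases5)
  have negP: "point_neg E P \<in> {P, Q}" and negQ: "point_neg E Q \<in> {P, Q}"
    using neg[of P] neg[of Q] Heq P Q by (auto simp: E)
  show ?thesis
  proof (cases "point_neg E P = Q")
    case True
    have "point_add E P P \<noteq> Infinity" using point_add_eq_Infinity[of E P P] True PQ by auto
    then have "point_add E P P \<in> {P, Q}" using add[of P P] Heq by auto
    then obtain z where "point_add E P P = Affine x1 z" using True by (auto simp: P E)
    then have "psi3 E x1 = 0" using tripling_imp_psi3 on[of P] Heq P by blast
    then show ?thesis using that[of x1 y1] True Heq P by simp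
  next
    case False
    then have PP: "point_neg E P = P" using negP by blast
    then have QQ: "point_neg E Q = Q" using negQ PQ(2) by (metis insertE point_neg_neg singletonD)
    have u: "2 * y1 + a1 * x1 + a3 = 0" "2 * y2 + a1 * x2 + a3 = 0"
      using PP QQ by (simp_all add: P Q E algebra_simps eq_neg_iff_add_eq_0 mult_2)
    have ne: "x1 \<noteq> x2"
    proof
      assume "x1 = x2"
      then have "2 * y1 = 2 * y2" using u by (metis add_right_imp_eq add.assoc)
      then show False using PQ(2) P Q \<open>x1 = x2\<close> by simp
    qed
    define l where "l = (y2 - y1) / (x2 - x1)"
    have l: "l * (x2 - x1) = y2 - y1" "l * (x1 - x2) = y1 - y2" using ne by (simp_all add: l_def field_simps)
    have "point_add E P Q = Affine (l^2 + a1 * l - a2 - x1 - x2) (- (l + a1) * (l^2 + a1 * l - a2 - x1 - x2) - (y1 - l * x1) - a3)"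
      using ne by (simp add: E P Q l_def Let_def)
    moreover have "point_add E P Q \<in> {Infinity, P, Q}" using add[of P Q] Heq by blast
    \<comment> \<open>The sum is affine, hence equal to P or Q. The second alternative is written
      with the indices exchanged, so that the singularity criterion applies to it with the roles of
      the points swapped.\<close>
    ultimately have "l^2 + a1 * l - a2 - x1 - x2 = x1 \<or> l^2 + a1 * l - a2 - x2 - x1 = x2"
      by (auto simp: P Q algebra_simps)
    then have "singular_at E P \<or> singular_at E Q"
      using two_torsion_chord_singular[OF E, of x1 y1 x2 y2 l] two_torsion_chord_singular[OF E, of x2 y2 x1 y1 l]
        on[of P] on[of Q] Heq u ne l unfolding P Q by blast
    then show ?thesis using smooth on Heq by blast
  qed
qed

lemma psi3_order_3_subgroup:
  fixes E :: "'a::field_char_0 coeffs"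
  assumes smooth: "\<And>P. on_curve E P \<Longrightarrow> \<not> singular_at E P"
    and on: "on_curve E (Affine x y)" and x: "psi3 E x = 0"
  defines "H \<equiv> {Infinity, Affine x y, point_neg E (Affine x y)}"
  shows "subgroup H (point_group E)" "card H = 3"
proof -
  define P where "P = Affine x y"
  have ne: "point_neg E P \<noteq> P" using psi3_imp_not_2_torsion[OF assms(1) on x] by (auto simp: P_def)
  have onP: "on_curve E P" using on by (simp add: P_def)
  obtain a1 a2 a3 a4 a6 where E: "E = (a1, a2, a3, a4, a6)" by (metis prod_cases5)
  obtain z where N: "point_neg E P = Affine x z" by (simp add: E P_def)
  have PP: "point_add E P P = point_neg E P"
    using psi3_imp_double[OF on x] ne by (simp add: P_def)
  have NN: "point_add E (point_neg E P) (point_neg E P) = P"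
    using psi3_imp_double[of E x z] x ne on_curve_point_neg[OF onP] point_neg_neg[of E P] unfolding N by metis
  have H: "H = {Infinity, P, point_neg E P}" by (simp add: H_def P_def)
  show "card H = 3" using ne N by (simp add: H P_def)
  have right: "point_add E Q Infinity = Q" for Q by (cases E; cases Q) auto
  show "subgroup H (point_group E)"
  proof
    show "H \<subseteq> carrier (point_group E)"
      using onP on_curve_point_neg[OF onP] by (auto simp: H point_group_def)
    show "mult (point_group E) Q R \<in> H" if "Q \<in> H" "R \<in> H" for Q R
      using that PP NN by (auto simp: H point_group_def right)
    show "one (point_group E) \<in> H" by (simp add: H point_group_def)
    show "m_inv (point_group E) Q \<in> H" if "Q \<in> H" for Q
      using that onP on_curve_point_neg[OF onP] by (auto simp: H m_inv_point_group)
  qed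
qed

lemma galois_group_hom:
  assumes "\<sigma> \<in> galois_group"
  shows "\<sigma> (x + y) = \<sigma> x + \<sigma> y" "\<sigma> (x * y) = \<sigma> x * \<sigma> y" "\<sigma> (to_ac c) = to_ac c" "inj \<sigma>"
  using assms by (auto simp: galois_group_def bij_def)

lemma galois_group_minus:
  assumes "\<sigma> \<in> galois_group" shows "\<sigma> (- x) = - \<sigma> x" "\<sigma> (x - y) = \<sigma> x - \<sigma> y"
proof -
  show *: "\<sigma> (- x) = - \<sigma> x" for x
    using galois_group_hom[OF assms] by (metis add.right_inverse eq_neg_iff_add_eq_0 add.commute to_ac_0)
  show "\<sigma> (x - y) = \<sigma> x - \<sigma> y"
    using galois_group_hom(1)[OF assms, of x "- y"] by (simp add: *)
qed

lemma psi3_to_ac: "psi3 (map_coeffs to_ac E) (to_ac x) = to_ac (psi3 E x)"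
  by (cases E) simp

text \<open>An automorphism that preserves {O, P, -P} fixes x(P), since P and -P have the same
  x-coordinate. Conversely, over a rational \<open>x\<close> the values of y at P and -P are the two
  roots of a monic quadratic over the base field. An automorphism therefore fixes or exchanges them,
  even when P itself is not rational.\<close>

theorem has_rational_3_isogeny_iff:
  fixes E :: "'k::field_char_0 coeffs"
  assumes "elliptic_curve E"
  shows "has_rational_isogeny E 3 \<longleftrightarrow> (\<exists>x. psi3 E x = 0)"
proof
  let ?E = "map_coeffs to_ac E"
  have smooth: "\<not> singular_at ?E P" if "on_curve ?E P" for P
    using assms that by (auto simp: elliptic_curve_def)
  obtain a1 a2 a3 a4 a6 where E: "E = (a1, a2, a3, a4, a6)" by (metis prod_cases5)
  {
    assume "has_rational_isogeny E 3"
    then obtain H where H: "subgroup H (point_group ?E)" "card H = 3"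
      and stable: "\<And>\<sigma>. \<sigma> \<in> galois_group \<Longrightarrow> map_point \<sigma> ` H = H"
      unfolding has_rational_isogeny_def by blast
    obtain x y where xy: "H = {Infinity, Affine x y, point_neg ?E (Affine x y)}" "psi3 ?E x = 0"
      using order_3_subgroup_psi3[OF smooth H] by blast
    have "\<sigma> x = x" if "\<sigma> \<in> galois_group" for \<sigma>
    proof -
      have "map_point \<sigma> (Affine x y) \<in> H" using stable[OF that] xy(1) by blast
      then show ?thesis by (auto simp: xy(1) E)
    qed
    then obtain z where "x = to_ac z" using galois_fixed_imp_base by blast
    then show "\<exists>x. psi3 E x = 0" using xy(2) by (auto simp: psi3_to_ac simp del: psi3.simps)
  next
    assume "\<exists>x. psi3 E x = 0"
    then obtain x where x: "psi3 E x = 0" by blast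
    define b c where bc: "b = a1 * x + a3" "c = x^3 + a2 * x^2 + a4 * x + a6"
    obtain y :: "'k alg_closure" where "poly [:- to_ac c, to_ac b, 1:] y = 0"
      using alg_closed_imp_poly_has_root[of "[:- to_ac c, to_ac b, 1:]"] by auto
    then have y: "y * y + to_ac b * y = to_ac c" by (simp add: algebra_simps eq_neg_iff_add_eq_0)
    have on: "on_curve ?E (Affine (to_ac x) y)"
      using y by (simp add: E bc algebra_simps power2_eq_square)
    define H where "H = {Infinity, Affine (to_ac x) y, point_neg ?E (Affine (to_ac x) y)}"
    have psi: "psi3 ?E (to_ac x) = 0" using x by (simp add: psi3_to_ac del: psi3.simps)
    note H = psi3_order_3_subgroup[OF smooth on psi, folded H_def]
    have neg: "point_neg ?E (Affine (to_ac x) y) = Affine (to_ac x) (- y - to_ac b)"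
      by (simp add: E bc)
    have fin: "finite H" using H(2) by (metis card.infinite zero_neq_numeral)
    have "map_point \<sigma> ` H = H" if \<sigma>: "\<sigma> \<in> galois_group" for \<sigma>
    proof (rule endo_inj_surj[OF fin])
      note hom = galois_group_hom[OF \<sigma>] galois_group_minus[OF \<sigma>]
      show "inj_on (map_point \<sigma>) H"
        using point.inj_map[OF hom(4)] by (rule inj_on_subset) simp
      have "\<sigma> y * \<sigma> y + to_ac b * \<sigma> y = to_ac c" using y hom by metis
      then have "\<sigma> y * \<sigma> y + to_ac b * \<sigma> y = y * y + to_ac b * y" using y by simp
      then have "(\<sigma> y - y) * (\<sigma> y + y + to_ac b) = 0" by (simp add: algebra_simps)
      then have "\<sigma> y - y = 0 \<or> \<sigma> y + y + to_ac b = 0" by (metis mult_eq_0_iff)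
      then have "\<sigma> y = y \<or> \<sigma> y = - y - to_ac b" by (auto simp: algebra_simps eq_neg_iff_add_eq_0)
      then show "map_point \<sigma> ` H \<subseteq> H" unfolding H_def neg using hom by auto
    qed
    then show "has_rational_isogeny E 3"
      unfolding has_rational_isogeny_def using H fin by blast
  }
qed

section \<open>Arithmetic of p-adic integers\<close>

lemma padic_res_of_nat: "padic_res (of_nat k :: 'p::prime_card padic_int) n = int k mod int CARD('p) ^ n"
  by (induction k) (simp_all add: zero_padic_int.rep_eq one_padic_int.rep_eq plus_padic_int.rep_eq mod_simps)

lemma padic_res_of_int: "padic_res (of_int k :: 'p::prime_card padic_int) n = k mod int CARD('p) ^ n"
  by (cases k rule: int_cases2)
     (simp_all add: padic_res_of_nat uminus_padic_int.rep_eq mod_simps)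

lemma padic_res_diff:
  "padic_res (x - y :: 'p::prime_card padic_int) n = (padic_res x n - padic_res y n) mod int CARD('p) ^ n"
  unfolding minus_padic_int_def plus_padic_int.rep_eq uminus_padic_int.rep_eq by (simp add: mod_simps)

lemma padic_res_range:
  "0 \<le> padic_res (x :: 'p::prime_card padic_int) n" "padic_res x n < int CARD('p) ^ n"
  using pos_mod_sign[of "int CARD('p) ^ n" "padic_res x n"] pos_mod_bound[of "int CARD('p) ^ n" "padic_res x n"]
    prime_gt_0_nat[OF prime_card[where 'a = 'p]] by simp_all

instance padic_int :: (prime_card) ring_char_0
proof
  show "inj (of_nat :: nat \<Rightarrow> 'a padic_int)"
  proof (rule injI)
    fix m n :: nat assume eq: "(of_nat m :: 'a padic_int) = of_nat n"
    define p where "p = CARD('a)"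
    have p: "p > 1" unfolding p_def using prime_gt_1_nat[OF prime_card] .
    \<comment> \<open>At this level p^k exceeds both numbers, so each is its own residue.\<close>
    define k where "k = m + n"
    have "k < p ^ k" by (rule power_gt_expt) (use p in simp)
    then have "m < p ^ k" "n < p ^ k" using k_def by linarith+
    then have "int m < int p ^ k" "int n < int p ^ k" by (simp_all flip: of_nat_power)
    moreover have "int m mod int p ^ k = int n mod int p ^ k"
      using arg_cong[OF eq, of "\<lambda>x. padic_res x k"] by (simp add: padic_res_of_nat p_def)
    ultimately have "int m = int n" by (metis mod_pos_pos_trivial of_nat_0_le_iff)
    then show "m = n" by simp
  qed
qed

instance fract :: ("{idom, ring_char_0}") field_char_0
proof
  show "inj (of_nat :: nat \<Rightarrow> 'a fract)"
    by (rule injI) (simp add: of_nat_fract eq_fract)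
qed

text \<open>Dropping the last digit: \<open>(x - x mod p) / p\<close>.\<close>

lift_definition padic_shift :: "'p::prime_card padic_int \<Rightarrow> 'p padic_int"
  is "\<lambda>x n. x (Suc n) div int CARD('p)"
proof -
  fix x :: "nat \<Rightarrow> int" and n
  assume "\<And>n. x n = x (Suc n) mod int CARD('p) ^ n"
  then have "x (Suc n) = x (Suc (Suc n)) mod int CARD('p) ^ Suc n" .
  then show "x (Suc n) div int CARD('p) = x (Suc (Suc n)) div int CARD('p) mod int CARD('p) ^ n"
    using prime_gt_0_nat[OF prime_card[where 'a = 'p]] by (simp add: zmod_zmult2_eq)
qed

lemma padic_shift_mult: "padic_shift (of_nat CARD('p) * x) = (x :: 'p::prime_card padic_int)"
proof (rule padic_int_eqI)
  fix n
  let ?p = "int CARD('p)"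
  have "?p * padic_res x (Suc n) mod (?p * ?p ^ n) div ?p = padic_res x (Suc n) mod ?p ^ n"
    by (simp add: mod_mult_mult1)
  then show "padic_res (padic_shift (of_nat CARD('p) * x)) n = padic_res x n"
    by (simp add: padic_shift.rep_eq times_padic_int.rep_eq padic_res_of_nat mod_simps padic_res_Suc)
qed

lemma mult_padic_shift:
  assumes "padic_res x 1 = 0" shows "of_nat CARD('p) * padic_shift x = (x :: 'p::prime_card padic_int)"
proof (rule padic_int_eqI)
  fix n
  let ?p = "int CARD('p)"
  have "padic_res x (Suc n) mod ?p = 0" using padic_res_mod_le[of 1 "Suc n" x] assms by simp
  then have "?p * (padic_res x (Suc n) div ?p) = padic_res x (Suc n)" by auto
  then show "padic_res (of_nat CARD('p) * padic_shift x) n = padic_res x n"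
    by (simp add: padic_shift.rep_eq times_padic_int.rep_eq padic_res_of_nat mod_simps padic_res_Suc)
qed

lemma padic_power_dvd_iff: "of_nat CARD('p) ^ n dvd (x :: 'p::prime_card padic_int) \<longleftrightarrow> padic_res x n = 0"
proof
  assume "of_nat CARD('p) ^ n dvd x"
  then obtain y where "x = of_nat (CARD('p) ^ n) * y" by auto
  then show "padic_res x n = 0"
    by (simp add: times_padic_int.rep_eq padic_res_of_nat flip: of_nat_power)
next
  show "padic_res x n = 0 \<Longrightarrow> of_nat CARD('p) ^ n dvd x"
  proof (induction n arbitrary: x)
    case (Suc n)
    have "padic_res x 1 = 0" using padic_res_mod_le[of 1 "Suc n" x] Suc.prems by simp
    from mult_padic_shift[OF this] have x: "x = of_nat CARD('p) * padic_shift x" by simp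
    have "of_nat CARD('p) ^ n dvd padic_shift x" using Suc by (simp add: padic_shift.rep_eq)
    then show ?case by (subst x) (simp add: mult_dvd_mono)
  qed simp
qed

lemma padic_dvd_iff: "of_nat CARD('p) dvd (x :: 'p::prime_card padic_int) \<longleftrightarrow> padic_res x 1 = 0"
  using padic_power_dvd_iff[of 1 x] by simp

lemma padic_eq_0_iff: "(x :: 'p::prime_card padic_int) = 0 \<longleftrightarrow> (\<forall>n. of_nat CARD('p) ^ n dvd x)"
  using padic_int_eqI[of x 0] by (auto simp: padic_power_dvd_iff zero_padic_int.rep_eq)

lemma padic_limit:
  fixes s :: "nat \<Rightarrow> 'p::prime_card padic_int"
  assumes "\<And>n. of_nat CARD('p) ^ n dvd s (Suc n) - s n"
  obtains L where "\<And>n. of_nat CARD('p) ^ n dvd L - s n"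
proof -
  \<comment> \<open>Diagonal choice: by assumption the n-th residue no longer changes from
    \<open>s n\<close> on.\<close>
  define L :: "'p padic_int" where "L = Abs_padic_int (\<lambda>n. padic_res (s n) n)"
  have step: "padic_res (s (Suc n)) n = padic_res (s n) n" for n
  proof -
    have "(padic_res (s (Suc n)) n - padic_res (s n) n) mod int CARD('p) ^ n = 0"
      using assms[of n] by (simp add: padic_power_dvd_iff padic_res_diff)
    then have "padic_res (s (Suc n)) n mod int CARD('p) ^ n = padic_res (s n) n mod int CARD('p) ^ n"
      unfolding mod_eq_dvd_iff mod_eq_0_iff_dvd .
    then show ?thesis by simp
  qed
  have "padic_res L n = padic_res (s n) n" for n
    unfolding L_def by (subst Abs_padic_int_inverse) (simp_all add: padic_res_Suc step del: power_Suc)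
  then show ?thesis using that[of L] by (simp add: padic_power_dvd_iff padic_res_diff)
qed

lemma padic_inverse_mod:
  assumes "\<not> of_nat CARD('p) dvd (a :: 'p::prime_card padic_int)"
  obtains v where "of_nat CARD('p) dvd a * v - 1"
proof -
  let ?p = "int CARD('p)"
  have "\<not> ?p dvd padic_res a 1"
    using assms padic_res_mod[of a 1] by (auto simp: padic_dvd_iff mod_eq_0_iff_dvd)
  then have "coprime (padic_res a 1) ?p"
    using prime_card_int[where 'a = 'p] by (metis prime_imp_coprime coprime_commute)
  then obtain v where "?p dvd padic_res a 1 * v - 1"
    by (metis cong_solve_coprime_int cong_iff_dvd_diff)
  then have "of_nat CARD('p) dvd a * of_int v - 1"
    by (simp add: padic_dvd_iff padic_res_diff times_padic_int.rep_eq padic_res_of_int one_padic_int.rep_eq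
        mod_simps mod_eq_0_iff_dvd)
  then show ?thesis by (rule that)
qed

section \<open>Hensel's lemma, units and divisibility\<close>

lemma poly_taylor2: "\<exists>r. poly f (x + h) = poly f x + h * poly (pderiv f) x + h^2 * r"
  for x h :: "'a::idom"
proof (induction f)
  case (pCons a f)
  define d where "d = poly (pderiv f) x"
  obtain r where "poly f (x + h) = poly f x + h * d + h^2 * r" using pCons.IH unfolding d_def by blast
  then have "poly (pCons a f) (x + h) = a + (x + h) * (poly f x + h * d + h^2 * r)" by simp
  also have "\<dots> = poly (pCons a f) x + h * (poly f x + x * d) + h^2 * (d + (x + h) * r)"
    by (simp add: algebra_simps power2_eq_square)
  finally show ?case by (auto simp: pderiv_pCons d_def)
qed simp

lemma poly_diff_dvd: "x - y dvd poly f x - poly f (y :: 'a::idom)"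
proof -
  obtain r where "poly f (y + (x - y)) = poly f y + (x - y) * poly (pderiv f) y + (x - y)^2 * r"
    using poly_taylor2 by blast
  then have "poly f x - poly f y = (x - y) * (poly (pderiv f) y + (x - y) * r)"
    by (simp add: algebra_simps power2_eq_square)
  then show ?thesis by simp
qed

lemma padic_hensel:
  fixes f :: "'p::prime_card padic_int poly"
  assumes f: "of_nat CARD('p) dvd poly f x0" and f': "\<not> of_nat CARD('p) dvd poly (pderiv f) x0"
  obtains x where "poly f x = 0" "of_nat CARD('p) dvd x - x0"
proof -
  let ?p = "of_nat CARD('p) :: 'p padic_int"
  define P where "P n x \<longleftrightarrow> ?p ^ Suc n dvd poly f x \<and> ?p dvd x - x0" for n x
  have "\<exists>s. \<forall>n. P n (s n) \<and> ?p ^ n dvd s (Suc n) - s n"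
  proof (rule dependent_nat_choice)
    show "\<exists>x. P 0 x" using f by (auto simp: P_def intro: exI[of _ x0])
    fix x n assume "P n x"
    then have x: "?p ^ Suc n dvd poly f x" "?p dvd x - x0" by (auto simp: P_def)
    have "?p dvd poly (pderiv f) x - poly (pderiv f) x0" using x(2) poly_diff_dvd dvd_trans by blast
    then have "\<not> ?p dvd poly (pderiv f) x" using f' by (metis dvd_diff_right_iff)
    then obtain v where v: "?p dvd poly (pderiv f) x * v - 1" by (rule padic_inverse_mod)
    then obtain k where k: "poly (pderiv f) x * v = 1 + ?p * k"
      by (metis dvdE diff_eq_eq add.commute)
    obtain u where u: "poly f x = ?p ^ Suc n * u" using x(1) by blast
    \<comment> \<open>A Newton step with \<open>v\<close>, an inverse of f'(x) modulo p only, in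
      place of 1/f'(x). It gains one power of p, which is enough for convergence.\<close>
    define h where "h = - (?p ^ Suc n * u * v)"
    obtain r where "poly f (x + h) = poly f x + h * poly (pderiv f) x + h^2 * r"
      using poly_taylor2 by blast
    also have "\<dots> = ?p ^ Suc n * u - ?p ^ Suc n * u * (poly (pderiv f) x * v) + (?p ^ Suc n * (u * v))^2 * r"
      by (simp add: u h_def algebra_simps power2_eq_square)
    also have "\<dots> = ?p ^ Suc (Suc n) * (?p ^ n * (u * v)^2 * r - u * k)"
      unfolding k by (simp add: algebra_simps power2_eq_square power_mult_distrib)
    finally have "?p ^ Suc (Suc n) dvd poly f (x + h)" by simp
    moreover have "?p dvd (x - x0) + h" using x(2) by (intro dvd_add) (auto simp: h_def)
    then have "?p dvd x + h - x0" by (simp add: algebra_simps)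
    moreover have "?p ^ n dvd h" by (simp add: h_def mult.assoc)
    then have "?p ^ n dvd x + h - x" by simp
    ultimately show "\<exists>y. P (Suc n) y \<and> ?p ^ n dvd y - x" unfolding P_def by blast
  qed
  then obtain s where s: "\<And>n. P n (s n)" "\<And>n. ?p ^ n dvd s (Suc n) - s n" by blast
  obtain L where L: "\<And>n. ?p ^ n dvd L - s n" using padic_limit[OF s(2)] by blast
  have "poly f L = 0"
    unfolding padic_eq_0_iff
  proof
    fix n
    have "?p ^ n dvd poly f L - poly f (s n)" using L poly_diff_dvd dvd_trans by blast
    moreover have "?p ^ n dvd poly f (s n)" using s(1)[of n] unfolding P_def
      by (metis dvd_trans dvd_triv_right power_Suc)
    ultimately show "?p ^ n dvd poly f L" by (metis dvd_diff_left_iff)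
  qed
  moreover have "?p dvd (L - s 1) + (s 1 - x0)"
    using L[of 1] s(1)[of 1] unfolding P_def by (intro dvd_add) auto
  ultimately show ?thesis using that by simp
qed

text \<open>Hensel's lemma for the linear polynomial a X - 1 lifts an inverse modulo p to an
  inverse.\<close>

lemma padic_unit:
  assumes "\<not> of_nat CARD('p) dvd (a :: 'p::prime_card padic_int)"
  shows "a dvd 1"
proof -
  obtain v where v: "of_nat CARD('p) dvd a * v - 1" using padic_inverse_mod[OF assms] by blast
  obtain x where "poly [:- 1, a:] x = 0"
    by (rule padic_hensel[of "[:- 1, a:]" v]) (use v assms in \<open>simp_all add: pderiv_pCons mult.commute\<close>)
  then have "a * x = 1" by (simp add: mult.commute)
  then show ?thesis by (metis dvd_triv_left)
qed

lemma padic_decompose: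
  assumes "(x :: 'p::prime_card padic_int) \<noteq> 0"
  obtains n u where "x = of_nat CARD('p) ^ n * u" "u dvd 1"
proof -
  let ?p = "of_nat CARD('p) :: 'p padic_int"
  obtain k where k: "\<not> ?p ^ k dvd x" using assms unfolding padic_eq_0_iff by blast
  define n where "n = (LEAST k. \<not> ?p ^ k dvd x) - 1"
  have "(LEAST k. \<not> ?p ^ k dvd x) \<noteq> 0"
    using LeastI[of "\<lambda>k. \<not> ?p ^ k dvd x", OF k] by (metis one_dvd power_0)
  then have n: "\<not> ?p ^ Suc n dvd x" "?p ^ n dvd x"
    using LeastI[of "\<lambda>k. \<not> ?p ^ k dvd x", OF k] not_less_Least[of n "\<lambda>k. \<not> ?p ^ k dvd x"]
    by (auto simp: n_def simp del: power_Suc)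
  then obtain u where u: "x = ?p ^ n * u" by blast
  then have "\<not> ?p dvd u" using n(1) by (metis dvd_refl mult_dvd_mono power_Suc2)
  then show ?thesis using that u padic_unit by blast
qed

lemma padic_dvd_total: "(a :: 'p::prime_card padic_int) dvd b \<or> b dvd a"
proof (cases "a = 0 \<or> b = 0")
  case False
  then obtain m u n v where uv: "a = of_nat CARD('p) ^ m * u" "u dvd 1" "b = of_nat CARD('p) ^ n * v" "v dvd 1"
    using padic_decompose by metis
  have "x * u dvd y * v" if "x dvd y" "u dvd 1" for x y u v :: "'p padic_int"
    using that by (meson dvd_trans mult_dvd_mono one_dvd dvd_refl)
  then show ?thesis using uv by (metis le_imp_power_dvd linear)
qed auto

section \<open>Reduction modulo p to the residue field\<close>

definition padic_red :: "'p::prime_card padic_int \<Rightarrow> 'p mod_ring" where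
  "padic_red x = of_int (padic_res x 1)"

lemma of_int_mod_card: "(of_int (k mod int CARD('p)) :: 'p::prime_card mod_ring) = of_int k"
proof -
  have "(of_int k :: 'p mod_ring) = of_int (k div int CARD('p) * int CARD('p) + k mod int CARD('p))"
    by (simp only: div_mult_mod_eq)
  also have "\<dots> = of_int (k mod int CARD('p))"
    by (simp only: of_int_add of_int_mult of_int_of_nat_eq of_nat_card_eq_0 mult_zero_right add_0_left)
  finally show ?thesis ..
qed

lemma padic_red_simps [simp]:
  fixes x y :: "'p::prime_card padic_int"
  shows "padic_red 0 = (0 :: 'p mod_ring)" "padic_red 1 = (1 :: 'p mod_ring)"
    "padic_red (x + y) = padic_red x + padic_red y" "padic_red (x * y) = padic_red x * padic_red y"
    "padic_red (- x) = - padic_red x" "padic_red (x - y) = padic_red x - padic_red y"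
    "padic_red (of_int k :: 'p padic_int) = of_int k" 
proof -
  show "padic_red 0 = (0 :: 'p mod_ring)" by (simp add: padic_red_def zero_padic_int.rep_eq)
  show "padic_red 1 = (1 :: 'p mod_ring)"
    using of_int_mod_card[of 1, where 'p = 'p] by (simp add: padic_red_def one_padic_int.rep_eq)
  show "padic_red (x + y) = padic_red x + padic_red y"
    by (simp add: padic_red_def plus_padic_int.rep_eq of_int_mod_card)
  show "padic_red (x * y) = padic_red x * padic_red y"
    by (simp add: padic_red_def times_padic_int.rep_eq of_int_mod_card)
  show "padic_red (- x) = - padic_red x"
    by (simp add: padic_red_def uminus_padic_int.rep_eq of_int_mod_card)
  show "padic_red (x - y) = padic_red x - padic_red y"
    by (simp add: padic_red_def padic_res_diff of_int_mod_card)
  show "padic_red (of_int k :: 'p padic_int) = of_int k"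
    by (simp add: padic_red_def padic_res_of_int of_int_mod_card)
qed

lemma padic_red_of_nat [simp]: "padic_red (of_nat k :: 'p::prime_card padic_int) = of_nat k"
  using padic_red_simps(7)[of "int k"] by simp

lemma padic_red_numeral [simp]: "padic_red (numeral k :: 'p::prime_card padic_int) = numeral k"
  using padic_red_of_nat[of "numeral k"] by simp

lemma padic_red_power [simp]: "padic_red (x ^ n :: 'p::prime_card padic_int) = padic_red x ^ n"
  by (induction n) auto

lemma of_nat_mod_ring_eq_0_iff: "(of_nat k :: 'p::prime_card mod_ring) = 0 \<longleftrightarrow> CARD('p) dvd k"
  using of_nat_0_mod_ring_dvd[of k] by (auto elim!: dvdE)

lemma padic_red_eq_0_iff: "padic_red (x :: 'p::prime_card padic_int) = 0 \<longleftrightarrow> of_nat CARD('p) dvd x"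
proof -
  define k where "k = nat (padic_res x 1)"
  have k: "padic_res x 1 = int k" "k < CARD('p)"
    using padic_res_range[of x 1] by (auto simp: k_def)
  then have "CARD('p) dvd k \<longleftrightarrow> k = 0" by (metis dvd_0_right gr0I nat_dvd_not_less)
  then show ?thesis using k(1) by (simp add: padic_red_def padic_dvd_iff of_nat_mod_ring_eq_0_iff)
qed

lemma padic_red_surj: "\<exists>x. padic_red (x :: 'p::prime_card padic_int) = y"
  by (metis padic_red_of_nat surj_of_nat_mod_ring)

section \<open>Counting over the residue field\<close>

text \<open>The 3-division polynomial of \<open>y^2 = x^3 + a x + b\<close>.\<close>

definition short_psi3 :: "'a::comm_ring_1 \<Rightarrow> 'a \<Rightarrow> 'a \<Rightarrow> 'a" where
  "short_psi3 a b x = 3 * x^4 + 6 * a * x^2 + 12 * b * x - a^2"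

lemma short_psi3_at_0 [simp]: "short_psi3 a b 0 = - (a^2)"
  by (simp add: short_psi3_def)

text \<open>Eliminating \<open>b\<close> between the equations for two distinct roots.\<close>

lemma short_psi3_two_roots:
  fixes a b x y :: "'a::idom"
  assumes "short_psi3 a b x = 0" "x \<noteq> 0" "y \<noteq> x"
  shows "short_psi3 a b y = 0 \<longleftrightarrow> (a + 3 * x * y)^2 + 3 * x * y * (x - y)^2 = 0"
proof -
  have "x * short_psi3 a b y - y * short_psi3 a b x
      = (y - x) * ((a + 3 * x * y)^2 + 3 * x * y * (x - y)^2)"
    by (simp add: short_psi3_def algebra_simps power2_eq_square power3_eq_cube power4_eq_xxxx)
  then show ?thesis using assms by auto
qed

text \<open>The roots other than \<open>x\<close> are thus parametrized by the square root
  \<open>1 + c = (a + 3 x y) / (x (y - x))\<close> of \<open>-3 y / x\<close>, and \<open>c\<close> turns out to be a cube root.\<close>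

lemma short_psi3_other_root_iff:
  fixes a b x y :: "'a::field"
  assumes x: "short_psi3 a b x = 0" "x \<noteq> 0" and "y \<noteq> x" and 3: "(3::'a) \<noteq> 0"
  shows "short_psi3 a b y = 0 \<longleftrightarrow> (\<exists>c. x^2 * (1 + c^3) = - 3 * a \<and> 3 * y = - x * (1 + c)^2)"
proof -
  have "(\<exists>c. x^2 * (1 + c^3) = - 3 * a \<and> 3 * y = - x * (1 + c)^2)"
    if eq: "(a + 3 * x * y)^2 + 3 * x * y * (x - y)^2 = 0"
  proof -
    define e where "e = (a + 3 * x * y) / (x * (y - x))"
    have e: "a = e * x * (y - x) - 3 * x * y" using \<open>y \<noteq> x\<close> x by (simp add: e_def field_simps)
    have "x * (x - y)^2 * (x * e^2 + 3 * y) = 0" using eq unfolding e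
      by (simp add: algebra_simps power2_eq_square)
    then have y: "3 * y = - x * e^2" using \<open>y \<noteq> x\<close> x by (simp add: eq_neg_iff_add_eq_0 add.commute)
    have "3 * a = e * x * (3 * y - 3 * x) - 3 * x * (3 * y)" unfolding e by (simp add: algebra_simps)
    also have "\<dots> = - (x^2 * (1 + (e - 1)^3))" unfolding y
      by (simp add: algebra_simps power2_eq_square power3_eq_cube)
    finally show ?thesis using y by (intro exI[of _ "e - 1"]) simp
  qed
  moreover have "(a + 3 * x * y)^2 + 3 * x * y * (x - y)^2 = 0"
    if c: "x^2 * (1 + c^3) = - 3 * a" "3 * y = - x * (1 + c)^2" for c
  proof -
    have "9 * ((a + 3 * x * y)^2 + 3 * x * y * (x - y)^2)
        = (3 * a + 3 * x * (3 * y))^2 + x * (3 * y) * (3 * x - 3 * y)^2"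
      by (simp add: algebra_simps power2_eq_square)
    also have "3 * a = - (x^2 * (1 + c^3))" using c(1) by simp
    also have "(- (x^2 * (1 + c^3)) + 3 * x * (3 * y))^2 + x * (3 * y) * (3 * x - 3 * y)^2 = 0"
      unfolding c(2) by (simp add: algebra_simps power2_eq_square power3_eq_cube)
    finally have "3 * (3 * ((a + 3 * x * y)^2 + 3 * x * y * (x - y)^2)) = 0" by simp
    then show ?thesis using 3 by (metis mult_eq_0_iff)
  qed
  ultimately show ?thesis using short_psi3_two_roots[OF x \<open>y \<noteq> x\<close>] by blast
qed

text \<open>Each admissible \<open>c\<close> gives the root - x (1 + c)^2 / 3. The excluded values
  are those for which this is \<open>x\<close> itself, which is counted by
  \<open>Suc\<close>.\<close>

lemma card_short_psi3_roots:
  fixes a b x :: "'a::{field, finite}"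
  assumes x: "short_psi3 a b x = 0" "x \<noteq> 0" and 3: "(3::'a) \<noteq> 0"
  shows "card {y. short_psi3 a b y = 0} = Suc (card {c. x^2 * (1 + c^3) = - 3 * a \<and> (1 + c)^2 \<noteq> - 3})"
proof -
  define C where "C = {c. x^2 * (1 + c^3) = - 3 * a \<and> (1 + c)^2 \<noteq> - 3}"
  define g where "g c = - x * (1 + c)^2 / 3" for c
  have g: "3 * g c = - x * (1 + c)^2" for c using 3 by (simp add: g_def)
  have g_eq: "3 * y = - x * (1 + c)^2 \<longleftrightarrow> y = g c" for c y
    using 3 by (metis g mult_left_cancel)
  have gx: "g c = x \<longleftrightarrow> (1 + c)^2 = - 3" for c
  proof -
    have "g c = x \<longleftrightarrow> 3 * g c = 3 * x" using 3 by simp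
    also have "\<dots> \<longleftrightarrow> x * ((1 + c)^2 + 3) = 0"
    proof -
      have "x * ((1 + c)^2 + 3) = 3 * x - 3 * g c" unfolding g by (simp add: algebra_simps)
      then show ?thesis by auto
    qed
    also have "\<dots> \<longleftrightarrow> (1 + c)^2 = - 3" using x by (simp add: eq_neg_iff_add_eq_0)
    finally show ?thesis .
  qed
  have "{y. short_psi3 a b y = 0} = insert x (g ` C)"
  proof (rule Set.set_eqI)
    fix y
    show "y \<in> {y. short_psi3 a b y = 0} \<longleftrightarrow> y \<in> insert x (g ` C)"
    proof (cases "y = x")
      case True
      then show ?thesis using x by simp
    next
      case False
      have "short_psi3 a b y = 0 \<longleftrightarrow> (\<exists>c. x^2 * (1 + c^3) = - 3 * a \<and> y = g c)"
        using short_psi3_other_root_iff[OF x False 3] unfolding g_eq .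
      also have "\<dots> \<longleftrightarrow> y \<in> g ` C" using False gx unfolding C_def image_iff by blast
      finally show ?thesis using False by simp
    qed
  qed
  moreover have "x \<notin> g ` C" using gx by (auto simp: C_def)
  moreover have "inj_on g C"
  proof (rule inj_onI, rule ccontr)
    fix c d assume cd: "c \<in> C" "d \<in> C" "g c = g d" "c \<noteq> d"
    have "x * ((1 + c)^2 - (1 + d)^2) = 3 * g d - 3 * g c" unfolding g by (simp add: algebra_simps)
    then have "(1 + c)^2 - (1 + d)^2 = 0" using x cd(3) by simp
    moreover have "(1 + c)^2 - (1 + d)^2 = (c - d) * (c - (- d - 2))" by (simp add: algebra_simps power2_eq_square)
    \<comment> \<open>Two parameters with the same root satisfy 1 + c = - (1 + d). Their cubes agree
      as well, which then forces d = -1 = c because the factor (1 + d)^2 + 3 is excluded.\<close>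
    ultimately have c: "c = - d - 2" using cd(4) by (metis eq_iff_diff_eq_0 mult_eq_0_iff)
    have "x^2 * (1 + c^3) = x^2 * (1 + d^3)" using cd by (simp add: C_def)
    then have "c^3 = d^3" using x by simp
    then have "2 * (d + 1) * ((1 + d)^2 + 3) = 0" unfolding c
      by (simp add: algebra_simps power2_eq_square power3_eq_cube)
    moreover have "(1 + d)^2 + 3 \<noteq> 0" using cd by (simp add: C_def eq_neg_iff_add_eq_0)
    ultimately have "2 * (d + 1) = 0" by simp
    moreover have "c - d = - (2 * (d + 1))" unfolding c by simp
    ultimately show False using cd(4) by simp
  qed
  ultimately show ?thesis by (subst C_def[symmetric]) (simp add: card_image)
qed

definition cube_roots :: "'a::field \<Rightarrow> 'a set" where
  "cube_roots k = {c. c^3 = k}"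

text \<open>For a root x \<noteq> 0 of \<open>short_psi3 a b\<close> and k = - 1 - 3 a / x^2, this
  is the number of all its roots by \<open>card_short_psi3_roots\<close> (over a finite field with 3
  \<noteq> 0). It does not depend on \<open>x\<close> and \<open>a\<close> otherwise.\<close>

definition root_count :: "'a::field \<Rightarrow> nat" where
  "root_count k = Suc (card {c :: 'a. c^3 = k \<and> (1 + c)^2 \<noteq> - 3})"

definition residue_pairs :: "('a::field \<times> 'a) set" where
  "residue_pairs = {(a, b). (a, b) \<noteq> (0, 0) \<and> (\<exists>x. short_psi3 a b x = 0)}"

context
  assumes card_gt_3: "CARD('p::prime_card) > 3"
begin

lemma mod_ring_2_3: "(2 :: 'p mod_ring) \<noteq> 0" "(3 :: 'p mod_ring) \<noteq> 0" "(4 :: 'p mod_ring) \<noteq> 0" "(12 :: 'p mod_ring) \<noteq> 0"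
proof -
  have "\<not> CARD('p) dvd 2" "\<not> CARD('p) dvd 3"
    using card_gt_3 by (auto dest!: dvd_imp_le)
  then show *: "(2 :: 'p mod_ring) \<noteq> 0" "(3 :: 'p mod_ring) \<noteq> 0"
    using of_nat_mod_ring_eq_0_iff[of 2, where 'p = 'p] of_nat_mod_ring_eq_0_iff[of 3, where 'p = 'p] by simp_all
  have "(4 :: 'p mod_ring) = 2 * 2" "(12 :: 'p mod_ring) = 2 * 2 * 3" by simp_all
  then show "(4 :: 'p mod_ring) \<noteq> 0" "(12 :: 'p mod_ring) \<noteq> 0" using * by (metis mult_eq_0_iff)+
qed

lemma mod_ring_fermat: "x \<noteq> 0 \<Longrightarrow> x ^ (CARD('p) - 1) = (1 :: 'p mod_ring)"
proof -
  assume x: "x \<noteq> 0"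
  have "CARD('p) - 1 = Suc (nat (int CARD('p) - 2))" using card_gt_3 by simp
  then have "x ^ (CARD('p) - 1) = x * inverse x"
    using x by (simp add: inverse_mod_ring_def)
  then show ?thesis using x by simp
qed

section \<open>Cube roots in the residue field and the sums of weights\<close>

lemma cube_roots_0 [simp]: "cube_roots 0 = {0}"
  by (auto simp: cube_roots_def)

lemma sum_card_cube_roots: "(\<Sum>k\<in>(UNIV :: 'p mod_ring set). card (cube_roots k)) = CARD('p)"
proof -
  have "(\<Sum>k\<in>(UNIV :: 'p mod_ring set). card (cube_roots k)) = card (\<Union>k\<in>(UNIV :: 'p mod_ring set). cube_roots k)"
    by (rule card_UN_disjoint[symmetric]) (auto simp: cube_roots_def)
  also have "(\<Union>k\<in>(UNIV :: 'p mod_ring set). cube_roots k) = UNIV" by (auto simp: cube_roots_def)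
  finally show ?thesis by simp
qed

text \<open>Here p - 1 = 3 m + 1 is prime to 3, so e^3 = 1 and e^(p-1) = 1 force e = 1; cubing is
  injective, hence bijective.\<close>

lemma cube_roots_mod_3_2:
  assumes "CARD('p) mod 3 = 2" shows "card (cube_roots (k :: 'p mod_ring)) = 1"
proof -
  define m where "m = CARD('p) div 3"
  have m: "CARD('p) - 1 = 3 * m + 1" using assms card_gt_3 unfolding m_def by presburger
  have "inj (\<lambda>c :: 'p mod_ring. c ^ 3)"
  proof (rule injI)
    fix c d :: "'p mod_ring" assume "c ^ 3 = d ^ 3"
    show "c = d"
    proof (cases "d = 0")
      case True
      with \<open>c ^ 3 = d ^ 3\<close> show ?thesis by simp
    next
      case False
      define e where "e = c / d"
      have e: "e^3 = 1" using \<open>c ^ 3 = d ^ 3\<close> False by (simp add: e_def power_divide)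
      then have "e \<noteq> 0" by auto
      have "1 = e ^ (3 * m + 1)" using mod_ring_fermat[OF \<open>e \<noteq> 0\<close>] m by simp
      also have "\<dots> = (e ^ 3) ^ m * e" by (simp add: power_mult)
      finally show ?thesis using False e by (simp add: e_def)
    qed
  qed
  moreover from this have "surj (\<lambda>c :: 'p mod_ring. c ^ 3)" by (rule finite_UNIV_inj_surj[OF finite])
  ultimately obtain c where "\<And>d. d^3 = k \<longleftrightarrow> d = c" by (metis injD surjD)
  then have "cube_roots k = {c}" by (auto simp: cube_roots_def)
  then show ?thesis by simp
qed

text \<open>With m = (p - 1) / 3, the polynomial X^m - 1 has too few roots to vanish on all nonzero
  elements. Any x^m \<noteq> 1 is a primitive cube root of unity \<omega>, and the cube roots of
  \<open>k\<close>, if any, form an orbit under multiplication by \<omega>.\<close>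

lemma cube_roots_mod_3_1:
  assumes "CARD('p) mod 3 = 1" "k \<noteq> (0 :: 'p mod_ring)" shows "card (cube_roots k) = 0 \<or> card (cube_roots k) = 3"
proof -
  define m where "m = CARD('p) div 3"
  have m: "CARD('p) - 1 = 3 * m" "m > 0" using assms(1) card_gt_3 unfolding m_def by presburger+
  have "\<exists>x :: 'p mod_ring. x \<noteq> 0 \<and> x ^ m \<noteq> 1"
  proof (rule ccontr)
    assume "\<not> ?thesis"
    then have sub: "UNIV - {0} \<subseteq> {x :: 'p mod_ring. poly (Polynomial.monom 1 m - 1) x = 0}"
      by (auto simp: poly_monom)
    have ne: "Polynomial.monom 1 m - (1 :: 'p mod_ring poly) \<noteq> 0"
    proof
      assume "Polynomial.monom 1 m - (1 :: 'p mod_ring poly) = 0"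
      then have "poly (Polynomial.monom 1 m - (1 :: 'p mod_ring poly)) 0 = 0" by simp
      then show False using m(2) by (simp add: poly_monom zero_power)
    qed
    have "CARD('p) - 1 = card (UNIV - {0 :: 'p mod_ring})" by (simp add: card_Diff_singleton)
    also have "\<dots> \<le> card {x :: 'p mod_ring. poly (Polynomial.monom 1 m - 1) x = 0}"
      by (rule card_mono[OF _ sub]) simp
    also have "\<dots> \<le> Polynomial.degree (Polynomial.monom 1 m - (1 :: 'p mod_ring poly))"
      by (rule card_poly_roots_bound[OF ne])
    also have "\<dots> \<le> m" by (intro degree_diff_le) (auto simp: Polynomial.degree_monom_le)
    finally show False using m by simp
  qed
  then obtain x :: "'p mod_ring" where x: "x \<noteq> 0" "x ^ m \<noteq> 1" by blast
  define \<omega> where "\<omega> = x ^ m"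
  have \<omega>: "\<omega> ^ 3 = 1" "\<omega> \<noteq> 1"
    using x mod_ring_fermat[OF x(1)] m by (simp_all add: \<omega>_def power_mult[symmetric] mult.commute)
  have "(\<omega> - 1) * (\<omega>^2 + \<omega> + 1) = \<omega>^3 - 1"
    by (simp add: algebra_simps power2_eq_square power3_eq_cube)
  then have "\<omega>^2 + \<omega> + 1 = 0" using \<omega> by (metis eq_iff_diff_eq_0 mult_eq_0_iff)
  then have q: "1 + \<omega> + \<omega>^2 = 0" "\<omega> + \<omega>^2 + 1 = 0" by (simp_all add: ac_simps)
  show ?thesis
  proof (cases "cube_roots k = {}")
    case False
    then obtain c where c: "c^3 = k" by (auto simp: cube_roots_def)
    have c0: "c \<noteq> 0" using c \<open>k \<noteq> 0\<close> by auto
    have "d^3 = k \<longleftrightarrow> d = c \<or> d = \<omega> * c \<or> d = \<omega>^2 * c" for d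
    proof -
      have "(d - c) * (d - \<omega> * c) * (d - \<omega>^2 * c) = d^3 - (1 + \<omega> + \<omega>^2) * (d^2 * c) + (\<omega> + \<omega>^2 + \<omega>^3) * (d * c^2) - \<omega>^3 * c^3"
        by (simp add: algebra_simps power2_eq_square power3_eq_cube)
      also have "\<dots> = d^3 - k" using q \<omega> c by simp
      finally show ?thesis by (metis eq_iff_diff_eq_0 mult_eq_0_iff)
    qed
    then have "cube_roots k = {c, \<omega> * c, \<omega>^2 * c}" by (auto simp: cube_roots_def)
    moreover have "\<omega>^2 \<noteq> 1"
    proof
      assume "\<omega>^2 = 1"
      then have "\<omega>^3 = \<omega>" by (simp add: power3_eq_cube power2_eq_square)
      then show False using \<omega> by simp
    qed
    moreover have "\<omega>^2 \<noteq> \<omega>" using \<omega> by (auto simp: power2_eq_square)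
    ultimately show ?thesis using c0 \<omega>(2) by auto
  qed auto
qed

text \<open>The value 8 is exceptional because c^3 - 8 = (c - 2) ((1 + c)^2 + 3): the excluded
  \<open>c\<close> are cube roots of 8, and 2 is not among them. In terms of the quartic, k = 8
  means a = - 3 x^2, the case where \<open>x\<close> is a multiple root.\<close>

lemma card_cube_roots_8:
  "card {c :: 'p mod_ring. c^3 = 8 \<and> (1 + c)^2 \<noteq> - 3} = 1"
proof -
  have "c = 2" if "c^3 = 8" "(1 + c)^2 \<noteq> - 3" for c :: "'p mod_ring"
  proof -
    have "(c - 2) * ((1 + c)^2 + 3) = c^3 - 8"
      by (simp add: algebra_simps power2_eq_square power3_eq_cube)
    then show ?thesis using that by (simp add: eq_neg_iff_add_eq_0)
  qed
  moreover have "(1 + 2)^2 \<noteq> (- 3 :: 'p mod_ring)"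
    using mod_ring_2_3(4) by (simp add: eq_neg_iff_add_eq_0)
  ultimately have "{c :: 'p mod_ring. c^3 = 8 \<and> (1 + c)^2 \<noteq> - 3} = {2}" by auto
  then show ?thesis by simp
qed

lemma card_cube_roots_not_8:
  assumes "k \<noteq> (8 :: 'p mod_ring)" shows "{c :: 'p mod_ring. c^3 = k \<and> (1 + c)^2 \<noteq> - 3} = cube_roots k"
proof -
  have "c^3 = 8" if "(1 + c)^2 = - 3" for c :: "'p mod_ring"
  proof -
    have "c^3 - 8 = (c - 2) * ((1 + c)^2 + 3)"
      by (simp add: algebra_simps power2_eq_square power3_eq_cube)
    then show ?thesis using that by simp
  qed
  then show ?thesis using assms by (auto simp: cube_roots_def)
qed

lemma sum_root_count_mod_3_2:
  assumes "CARD('p) mod 3 = 2"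
  shows "(\<Sum>k\<in>(UNIV :: 'p mod_ring set). 1 / real (root_count k)) = real CARD('p) / 2"
    "(\<Sum>k\<in>(UNIV :: 'p mod_ring set) - {0}. 1 / real (Suc (card (cube_roots k)))) = (real CARD('p) - 1) / 2"
proof -
  have "root_count k = 2" for k :: "'p mod_ring"
    using card_cube_roots_8 card_cube_roots_not_8[of k] cube_roots_mod_3_2[OF assms, of k]
    by (cases "k = 8") (simp_all add: root_count_def)
  then show "(\<Sum>k\<in>(UNIV :: 'p mod_ring set). 1 / real (root_count k)) = real CARD('p) / 2" by simp
  show "(\<Sum>k\<in>(UNIV :: 'p mod_ring set) - {0}. 1 / real (Suc (card (cube_roots k)))) = (real CARD('p) - 1) / 2"
    using card_gt_3 by (simp add: cube_roots_mod_3_2[OF assms] card_Diff_singleton of_nat_diff)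
qed

text \<open>A nonzero \<open>k\<close> has t = 0 or t = 3 cube roots, and for both values 1 / (1 +
  t) = 1 - t / 4. This is linear in t, so knowing the total number of cube roots suffices. The
  values 0 and 8 are treated apart: 0 has one cube root, and only one of the three cube roots of 8
  is admissible, so both have weight 1/2.\<close>

lemma sum_root_count_mod_3_1:
  assumes "CARD('p) mod 3 = 1"
  shows "(\<Sum>k\<in>(UNIV :: 'p mod_ring set). 1 / real (root_count k)) = 3 * real CARD('p) / 4"
    "(\<Sum>k\<in>(UNIV :: 'p mod_ring set) - {0}. 1 / real (Suc (card (cube_roots k)))) = 3 * (real CARD('p) - 1) / 4"
proof -
  have inv: "1 / real (Suc (card (cube_roots k))) = 1 - real (card (cube_roots k)) / 4" if "k \<noteq> 0" for k :: "'p mod_ring"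
    using cube_roots_mod_3_1[OF assms that] by auto
  have N: "(\<Sum>k\<in>(UNIV :: 'p mod_ring set). real (card (cube_roots k))) = real CARD('p)"
    using sum_card_cube_roots by (metis of_nat_sum)
  have *: "(\<Sum>k\<in>(UNIV :: 'p mod_ring set) - {0}. 1 / real (Suc (card (cube_roots k)))) = (\<Sum>k\<in>(UNIV :: 'p mod_ring set) - {0}. 1 - real (card (cube_roots k)) / 4)"
    by (rule sum.cong) (use inv in auto)
  have "(\<Sum>k\<in>(UNIV :: 'p mod_ring set) - {0}. real (card (cube_roots k))) = real CARD('p) - 1"
    using N by (simp add: sum_diff1)
  then show 1: "(\<Sum>k\<in>(UNIV :: 'p mod_ring set) - {0}. 1 / real (Suc (card (cube_roots k)))) = 3 * (real CARD('p) - 1) / 4"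
    unfolding * using card_gt_3
    by (simp add: sum_subtractf card_Diff_singleton of_nat_diff sum_divide_distrib[symmetric] field_simps)
  have "(8 :: 'p mod_ring) = 2 * 4" by simp
  then have 8: "(8 :: 'p mod_ring) \<noteq> 0" using mod_ring_2_3 by (metis mult_eq_0_iff)
  have "(2 :: 'p mod_ring) \<in> cube_roots 8" by (simp add: cube_roots_def)
  then have card8: "card (cube_roots (8 :: 'p mod_ring)) = 3"
    using cube_roots_mod_3_1[OF assms 8] by (metis card_eq_0_iff empty_iff finite)
  have "(\<Sum>k\<in>(UNIV :: 'p mod_ring set). 1 / real (root_count k))
      = 1 / real (root_count (0 :: 'p mod_ring)) + (1 / real (root_count (8 :: 'p mod_ring)) + (\<Sum>k\<in>(UNIV :: 'p mod_ring set) - {0} - {8}. 1 / real (root_count k)))"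
    using 8 by (subst sum.remove[of UNIV 0], simp, simp, subst sum.remove[of "UNIV - {0}" 8]) auto
  also have "(\<Sum>k\<in>(UNIV :: 'p mod_ring set) - {0} - {8}. 1 / real (root_count k)) = (\<Sum>k\<in>(UNIV :: 'p mod_ring set) - {0} - {8}. 1 / real (Suc (card (cube_roots k))))"
    by (rule sum.cong) (auto simp: root_count_def card_cube_roots_not_8)
  also have "\<dots> = 3 * (real CARD('p) - 1) / 4 - 1 / 4"
  proof -
    have "(\<Sum>k\<in>(UNIV :: 'p mod_ring set) - {0}. 1 / real (Suc (card (cube_roots k))))
        = 1 / real (Suc (card (cube_roots (8 :: 'p mod_ring))))
          + (\<Sum>k\<in>(UNIV :: 'p mod_ring set) - {0} - {8}. 1 / real (Suc (card (cube_roots k))))"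
      by (rule sum.remove) (use 8 in auto)
    then show ?thesis unfolding 1 card8 by simp
  qed
  also have "root_count (0 :: 'p mod_ring) = 2"
    using card_cube_roots_not_8[of 0] 8 by (simp add: root_count_def)
  also have "root_count (8 :: 'p mod_ring) = 2" by (simp add: root_count_def card_cube_roots_8)
  finally show "(\<Sum>k\<in>(UNIV :: 'p mod_ring set). 1 / real (root_count k)) = 3 * real CARD('p) / 4" by (simp add: field_simps)
qed

section \<open>Counting residue pairs by pairs with a marked root\<close>

lemma short_psi3_solve:
  fixes a b x :: "'p mod_ring"
  assumes "x \<noteq> 0"
  shows "short_psi3 a b x = 0 \<longleftrightarrow> b = (a^2 - 6 * a * x^2 - 3 * x^4) / (12 * x)"
proof -
  have "short_psi3 a b x = b * (12 * x) - (a^2 - 6 * a * x^2 - 3 * x^4)"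
    by (simp add: short_psi3_def algebra_simps)
  then show ?thesis using assms mod_ring_2_3 by (simp add: nonzero_eq_divide_eq)
qed

text \<open>Weighting a marked root by the inverse number of roots makes each pair contribute 1.
  Marked roots x \<noteq> 0 are parametrized freely by (x, k), which gives the factor p - 1. The
  marked root 0 forces a = 0 and b \<noteq> 0; the quartic is then 3 x (x^3 + 4 b), and its other
  roots are the cube roots of - 4 b.\<close>

lemma card_residue_pairs_eq:
  "real (card (residue_pairs :: ('p mod_ring \<times> 'p mod_ring) set))
    = (real CARD('p) - 1) * (\<Sum>k\<in>(UNIV :: 'p mod_ring set). 1 / real (root_count k))
     + (\<Sum>k\<in>(UNIV :: 'p mod_ring set) - {0}. 1 / real (Suc (card (cube_roots k))))"
proof -
  note nz = mod_ring_2_3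
  define rt where "rt z = {x. short_psi3 (fst z) (snd z) x = 0}" for z :: "'p mod_ring \<times> 'p mod_ring"
  define w where "w zx = 1 / real (card (rt (fst zx)))" for zx :: "('p mod_ring \<times> 'p mod_ring) \<times> 'p mod_ring"
  define T1 where "T1 = {zx. zx \<in> Sigma residue_pairs rt \<and> snd zx \<noteq> 0}"
  define T0 where "T0 = {zx. zx \<in> Sigma residue_pairs rt \<and> snd zx = 0}"
  have "real (card (residue_pairs :: ('p mod_ring \<times> 'p mod_ring) set)) = (\<Sum>z\<in>residue_pairs. \<Sum>x\<in>rt z. w (z, x))"
  proof -
    have "(\<Sum>x\<in>rt z. w (z, x)) = 1" if "z \<in> residue_pairs" for z
    proof -
      have "rt z \<noteq> {}" using that by (auto simp: residue_pairs_def rt_def)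
      then have "card (rt z) \<noteq> 0" by simp
      then show ?thesis by (simp add: w_def)
    qed
    then show ?thesis by simp
  qed
  also have "\<dots> = sum w (Sigma residue_pairs rt)" by (subst sum.Sigma) (auto simp: case_prod_unfold)
  also have "Sigma residue_pairs rt = T1 \<union> T0" by (auto simp: T1_def T0_def)
  also have "sum w \<dots> = sum w T1 + sum w T0"
    by (rule sum.union_disjoint) (auto simp: T1_def T0_def)
  also have "sum w T1 = (\<Sum>xk\<in>(UNIV - {0 :: 'p mod_ring}) \<times> (UNIV :: 'p mod_ring set). 1 / real (root_count (snd xk)))"
  proof -
    \<comment> \<open>For fixed x \<noteq> 0, \<open>A\<close> and \<open>K\<close> are inverse to
      each other: \<open>K\<close> is the value whose cube roots give the other roots, and
      \<open>A\<close> recovers the coefficient a. \<open>B\<close> is the unique b for which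
      \<open>x\<close> is a root.\<close>
    define A where "A xk = - ((fst xk)^2 * (1 + snd xk)) / 3" for xk :: "'p mod_ring \<times> 'p mod_ring"
    define B where "B a x = (a^2 - 6 * a * x^2 - 3 * x^4) / (12 * x)" for a x :: "'p mod_ring"
    define K where "K a x = - 1 - 3 * a / x^2" for a x :: "'p mod_ring"
    have AK: "A (x, K a x) = a" "K (A (x, k)) x = k" if "x \<noteq> 0" for a x k
      using that nz by (simp_all add: A_def K_def field_simps)
    show ?thesis
    proof (rule sum.reindex_bij_witness[where i = "\<lambda>xk. ((A xk, B (A xk) (fst xk)), fst xk)" and j = "\<lambda>zx. (snd zx, K (fst (fst zx)) (snd zx))"])
      fix zx assume zx: "zx \<in> T1"
      obtain a b x where z: "zx = ((a, b), x)" by (metis surj_pair)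
      have x: "x \<noteq> 0" "short_psi3 a b x = 0" using zx by (auto simp: T1_def rt_def z)
      show "((A (snd zx, K (fst (fst zx)) (snd zx)), B (A (snd zx, K (fst (fst zx)) (snd zx))) (fst (snd zx, K (fst (fst zx)) (snd zx)))), fst (snd zx, K (fst (fst zx)) (snd zx))) = zx"
        using x short_psi3_solve[OF x(1)] by (simp add: z AK B_def)
      show "(snd zx, K (fst (fst zx)) (snd zx)) \<in> (UNIV - {0}) \<times> UNIV" using x by (simp add: z)
      have "x^2 * (1 + c^3) = - 3 * a \<longleftrightarrow> c^3 = K a x" for c
      proof -
        have "x^2 * (1 + c^3) - - 3 * a = x^2 * (c^3 - K a x)" using x(1) by (simp add: K_def field_simps)
        then show ?thesis using x(1) by (metis eq_iff_diff_eq_0 mult_eq_0_iff power_eq_0_iff)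
      qed
      then have "card (rt (a, b)) = root_count (K a x)"
        using card_short_psi3_roots[OF x(2,1) nz(2)] by (simp add: rt_def root_count_def)
      then show "1 / real (root_count (snd (snd zx, K (fst (fst zx)) (snd zx)))) = w zx"
        by (simp add: w_def z)
    next
      fix xk :: "'p mod_ring \<times> 'p mod_ring" assume "xk \<in> (UNIV - {0}) \<times> UNIV"
      then obtain x k where xk: "xk = (x, k)" "x \<noteq> 0" by auto
      show "(snd ((A xk, B (A xk) (fst xk)), fst xk), K (fst (fst ((A xk, B (A xk) (fst xk)), fst xk))) (snd ((A xk, B (A xk) (fst xk)), fst xk))) = xk"
        using xk AK by simp
      have root: "short_psi3 (A xk) (B (A xk) x) x = 0" using short_psi3_solve[OF xk(2)] by (simp add: B_def)
      moreover have "(A xk, B (A xk) x) \<noteq> (0, 0)"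
      proof
        assume "(A xk, B (A xk) x) = (0, 0)"
        then have "A xk = 0" "B (A xk) x = 0" by blast+
        then have "short_psi3 0 0 x = 0" using root by metis
        then show False using xk(2) nz by (simp add: short_psi3_def)
      qed
      ultimately show "((A xk, B (A xk) (fst xk)), fst xk) \<in> T1"
        using xk by (auto simp: T1_def rt_def residue_pairs_def)
    qed
  qed
  also have "\<dots> = (\<Sum>x\<in>UNIV - {0 :: 'p mod_ring}. \<Sum>k\<in>UNIV. 1 / real (root_count (k :: 'p mod_ring)))"
    by (subst sum.Sigma) (auto simp: case_prod_unfold)
  also have "\<dots> = (real CARD('p) - 1) * (\<Sum>k\<in>(UNIV :: 'p mod_ring set). 1 / real (root_count (k :: 'p mod_ring)))"
    using card_gt_3 by (simp add: card_Diff_singleton of_nat_diff)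
  also have "sum w T0 = (\<Sum>k\<in>(UNIV :: 'p mod_ring set) - {0}. 1 / real (Suc (card (cube_roots (k :: 'p mod_ring)))))"
  proof (rule sum.reindex_bij_witness[where i = "\<lambda>k. ((0, - k / 4), 0)" and j = "\<lambda>zx. - 4 * snd (fst zx)"])
    fix zx assume zx: "zx \<in> T0"
    then obtain b where z: "zx = ((0, b), 0)" "b \<noteq> 0" by (auto simp: T0_def rt_def residue_pairs_def)
    show "((0, - (- 4 * snd (fst zx)) / 4), 0) = zx" using z nz by simp
    show "- 4 * snd (fst zx) \<in> UNIV - {0}" using z nz by simp
    have root: "short_psi3 0 b y = 0 \<longleftrightarrow> y = 0 \<or> y^3 = - 4 * b" for y
    proof -
      have "short_psi3 0 b y = 3 * (y * (y^3 - - 4 * b))"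
        by (simp add: short_psi3_def algebra_simps power3_eq_cube power4_eq_xxxx)
      then show ?thesis using nz by (metis eq_iff_diff_eq_0 mult_eq_0_iff)
    qed
    have "rt (0, b) = insert 0 (cube_roots (- 4 * b))"
      by (auto simp: rt_def cube_roots_def root)
    moreover have "0 \<notin> cube_roots (- 4 * b)" using z nz by (simp add: cube_roots_def)
    ultimately show "1 / real (Suc (card (cube_roots (- 4 * snd (fst zx))))) = w zx"
      by (simp add: w_def z)
  next
    fix k :: "'p mod_ring" assume "k \<in> UNIV - {0}"
    then show "- 4 * snd (fst ((0, - k / 4), 0)) = k" "((0, - k / 4), 0) \<in> T0"
      using nz by (auto simp: T0_def rt_def residue_pairs_def intro: exI[of _ 0])
  qed
  finally show ?thesis .
qed

lemma card_residue_pairs: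
  "CARD('p) mod 3 = 1 \<Longrightarrow> real (card (residue_pairs :: ('p mod_ring \<times> 'p mod_ring) set)) = 3 * (real CARD('p) ^ 2 - 1) / 4"
  "CARD('p) mod 3 = 2 \<Longrightarrow> real (card (residue_pairs :: ('p mod_ring \<times> 'p mod_ring) set)) = (real CARD('p) ^ 2 - 1) / 2"
  by (simp_all only: card_residue_pairs_eq sum_root_count_mod_3_1 sum_root_count_mod_3_2)
    (simp_all add: field_simps power2_eq_square)

end

abbreviation padic_p :: "'p::prime_card padic_int" where
  "padic_p \<equiv> of_nat CARD('p)"

section \<open>Short Weierstrass form\<close>

text \<open>Here \<open>i\<close> stands for \<open>1/12\<close>; the substitution is \<open>x \<mapsto> x - b2/12\<close>.\<close>

fun short_coeffs :: "'a::comm_ring_1 \<Rightarrow> 'a coeffs \<Rightarrow> 'a \<times> 'a" where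
  "short_coeffs i (a1, a2, a3, a4, a6) =
     (let c = i * (a1^2 + 4 * a2); b4 = 2 * a4 + a1 * a3; b6 = a3^2 + 4 * a6
      in (6 * i * b4 - 3 * c^2, 3 * i * b6 - 6 * i * c * b4 + 2 * c^3))"

text \<open>The pair (A, B) is (- c4 / 48, - c6 / 864). Solving for the b-invariants turns the
  identities that follow into polynomial ones in A, B and c, without the inverse
  \<open>i\<close>.\<close>

lemma short_coeffs_expand:
  fixes i :: "'a::comm_ring_1"
  assumes "12 * i = 1" and AB: "short_coeffs i (a1, a2, a3, a4, a6) = (A, B)"
  defines "c \<equiv> i * (a1^2 + 4 * a2)"
  shows "a1^2 + 4 * a2 = 12 * c" "2 * a4 + a1 * a3 = 2 * A + 6 * c^2" "a3^2 + 4 * a6 = 4 * B + 4 * c * A + 4 * c^3"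
proof -
  have i: "12 * (i * z) = z" for z using assms(1) by (metis mult.assoc mult_1)
  define b4 b6 where b: "b4 = 2 * a4 + a1 * a3" "b6 = a3^2 + 4 * a6"
  have A: "A = 6 * (i * b4) - 3 * c^2" and B: "B = 3 * (i * b6) - 6 * (i * b4) * c + 2 * c^3"
    using AB by (simp_all add: Let_def c_def b mult.assoc mult.commute mult.left_commute)
  show "a1^2 + 4 * a2 = 12 * c" unfolding c_def by (rule i[symmetric])
  have "2 * A + 6 * c^2 = 12 * (i * b4)" unfolding A by (simp add: algebra_simps)
  then show "2 * a4 + a1 * a3 = 2 * A + 6 * c^2" unfolding i b ..
  have "4 * B + 4 * c * A + 4 * c^3 = 12 * (i * b6)"
    unfolding A B by (simp add: algebra_simps power2_eq_square power3_eq_cube)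
  then show "a3^2 + 4 * a6 = 4 * B + 4 * c * A + 4 * c^3" unfolding i b ..
qed

lemma psi3_short_coeffs:
  fixes i :: "'a::{idom, ring_char_0}"
  assumes "12 * i = 1" "short_coeffs i (a1, a2, a3, a4, a6) = (A, B)"
  shows "psi3 (a1, a2, a3, a4, a6) x = short_psi3 A B (x + i * (a1^2 + 4 * a2))"
proof -
  define c where "c = i * (a1^2 + 4 * a2)"
  define b2 b4 b6 where b: "b2 = a1^2 + 4 * a2" "b4 = 2 * a4 + a1 * a3" "b6 = a3^2 + 4 * a6"
  note e = short_coeffs_expand[OF assms, folded c_def b]
  \<comment> \<open>The factor 4 eliminates b8 through 4 b8 = b2 b6 - b4^2.\<close>
  have "4 * psi3 (a1, a2, a3, a4, a6) x = 12 * x^4 + 4 * b2 * x^3 + 12 * b4 * x^2 + 12 * b6 * x + b2 * b6 - b4^2"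
    by (simp add: b algebra_simps power2_eq_square)
  also have "\<dots> = 4 * short_psi3 A B (x + c)"
    unfolding e short_psi3_def
    by (simp add: algebra_simps power2_eq_square power3_eq_cube power4_eq_xxxx)
  finally show ?thesis by (simp add: c_def del: psi3.simps)
qed

text \<open>On the curve u^2 = 4 (z^3 + A z + B). By the two identities, over a field with 4
  \<noteq> 0, a point is a singular point of the curve iff u = 0 and z is a double root of this
  cubic.\<close>

lemma short_coeffs_singular_identities:
  fixes i :: "'a::idom"
  assumes "12 * i = 1" "short_coeffs i (a1, a2, a3, a4, a6) = (A, B)"
  defines "u \<equiv> \<lambda>x y. 2 * y + a1 * x + a3" and "z \<equiv> \<lambda>x. x + i * (a1^2 + 4 * a2)"
  shows "4 * (3 * (z x)^2 + A) = 4 * (3 * x^2 + 2 * a2 * x + a4 - a1 * y) + 2 * a1 * u x y"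
    and "4 * ((z x)^3 + A * z x + B) = (u x y)^2 - 4 * (y^2 + a1 * x * y + a3 * y - (x^3 + a2 * x^2 + a4 * x + a6))"
proof -
  define c where "c = i * (a1^2 + 4 * a2)"
  define b2 b4 b6 where b: "b2 = a1^2 + 4 * a2" "b4 = 2 * a4 + a1 * a3" "b6 = a3^2 + 4 * a6"
  note e = short_coeffs_expand[OF assms(1,2), folded c_def b]
  have "4 * (3 * (x + c)^2 + A) = 12 * x^2 + 2 * b2 * x + 2 * b4"
    unfolding e by (simp add: algebra_simps power2_eq_square)
  also have "\<dots> = 4 * (3 * x^2 + 2 * a2 * x + a4 - a1 * y) + 2 * a1 * u x y"
    by (simp add: b u_def algebra_simps power2_eq_square)
  finally show "4 * (3 * (z x)^2 + A) = 4 * (3 * x^2 + 2 * a2 * x + a4 - a1 * y) + 2 * a1 * u x y"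
    by (simp only: z_def c_def)
  have "4 * ((x + c)^3 + A * (x + c) + B) = 4 * x^3 + b2 * x^2 + 2 * b4 * x + b6"
    unfolding e by (simp add: algebra_simps power2_eq_square power3_eq_cube)
  also have "\<dots> = (u x y)^2 - 4 * (y^2 + a1 * x * y + a3 * y - (x^3 + a2 * x^2 + a4 * x + a6))"
    by (simp add: b u_def algebra_simps power2_eq_square power3_eq_cube)
  finally show "4 * ((z x)^3 + A * z x + B) = (u x y)^2 - 4 * (y^2 + a1 * x * y + a3 * y - (x^3 + a2 * x^2 + a4 * x + a6))"
    by (simp only: z_def c_def)
qed

lemma exists_singular_iff:
  fixes i :: "'a::field_char_0"
  assumes "12 * i = 1" "short_coeffs i E = (A, B)"
  shows "(\<exists>P. on_curve E P \<and> singular_at E P) \<longleftrightarrow> 4 * A^3 + 27 * B^2 = 0"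
proof -
  obtain a1 a2 a3 a4 a6 where E: "E = (a1, a2, a3, a4, a6)" by (metis prod_cases5)
  define c where "c = i * (a1^2 + 4 * a2)"
  note id = short_coeffs_singular_identities[OF assms(1) assms(2)[unfolded E], folded c_def]
  have four: "4 * t = 0 \<longleftrightarrow> t = 0" for t :: 'a by simp
  show ?thesis
  proof
    assume "\<exists>P. on_curve E P \<and> singular_at E P"
    then obtain P where "on_curve E P" "singular_at E P" by blast
    moreover from this obtain x y where "P = Affine x y" by (cases P) auto
    ultimately have u: "2 * y + a1 * x + a3 = 0" and N: "3 * x^2 + 2 * a2 * x + a4 - a1 * y = 0"
      and C: "y^2 + a1 * x * y + a3 * y - (x^3 + a2 * x^2 + a4 * x + a6) = 0" by (simp_all add: E)
    define z where "z = x + c"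
    have "3 * z^2 + A = 0" using id(1)[of x y] unfolding N u z_def four[symmetric, of "_ + _"] by simp
    then have A: "A = - 3 * z^2" by (simp add: eq_neg_iff_add_eq_0 add.commute)
    have "z^3 + A * z + B = 0" using id(2)[of x y] unfolding C u z_def four[symmetric, of "_ + _"] by simp
    moreover have "z^3 + A * z + B = B - 2 * z^3" by (simp add: A power2_eq_square power3_eq_cube)
    ultimately have "B = 2 * z^3" by simp
    then show "4 * A^3 + 27 * B^2 = 0" by (simp add: A power2_eq_square power3_eq_cube)
  next
    assume disc: "4 * A^3 + 27 * B^2 = 0"
    obtain z where z: "3 * z^2 + A = 0" "z^3 + A * z + B = 0"
    proof (cases "A = 0")
      case True
      then show ?thesis using that[of 0] disc by simp
    next
      case False
      \<comment> \<open>A double root z gives A = - 3 z^2 and B = 2 z^3, whence this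
        quotient.\<close>
      define z where "z = - 3 * B / (2 * A)"
      have zA: "2 * A * z = - 3 * B" using False by (simp add: z_def)
      have "4 * A^2 * (3 * z^2 + A) = 3 * (2 * A * z)^2 + 4 * A^3"
        by (simp add: algebra_simps power2_eq_square power3_eq_cube)
      also have "\<dots> = 4 * A^3 + 27 * B^2" unfolding zA by (simp add: power2_eq_square)
      finally have 1: "3 * z^2 + A = 0" using disc False by simp
      have "3 * (z^3 + A * z + B) = z * (3 * z^2 + A) + (2 * A * z + 3 * B)"
        by (simp add: algebra_simps power2_eq_square power3_eq_cube)
      also have "\<dots> = 0" unfolding 1 zA by simp
      finally have "z^3 + A * z + B = 0" by (metis mult_eq_0_iff zero_neq_numeral)
      then show ?thesis using 1 that by blast
    qed
    define x where "x = z - c"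
    define y where "y = - (a1 * x + a3) / 2"
    have "2 * y = - (a1 * x + a3)"
      unfolding y_def by (metis nonzero_mult_div_cancel_left times_divide_eq_right zero_neq_numeral)
    then have u: "2 * y + a1 * x + a3 = 0" by (metis add.assoc add.left_inverse)
    have xz: "x + c = z" by (simp add: x_def)
    have N: "3 * x^2 + 2 * a2 * x + a4 - a1 * y = 0"
      using id(1)[of x y, unfolded u xz z(1)] by (metis add.right_neutral four mult_zero_right)
    have C: "y^2 + a1 * x * y + a3 * y - (x^3 + a2 * x^2 + a4 * x + a6) = 0"
      using id(2)[of x y, unfolded u xz z(2)]
      by (metis diff_0 four mult_zero_right neg_equal_0_iff_equal zero_power2)
    have "on_curve E (Affine x y)" "singular_at E (Affine x y)"
      using u N C by (simp_all add: E)
    then show "\<exists>P. on_curve E P \<and> singular_at E P" by blast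
  qed
qed

lemma elliptic_curve_iff:
  fixes i :: "'k::field_char_0"
  assumes "12 * i = 1" "short_coeffs i E = (A, B)"
  shows "elliptic_curve E \<longleftrightarrow> 4 * A^3 + 27 * B^2 \<noteq> 0"
proof -
  have "short_coeffs (to_ac i) (map_coeffs to_ac E) = (to_ac A, to_ac B)"
    using assms(2) by (cases E) (auto simp: Let_def)
  moreover have "12 * to_ac i = 1" using arg_cong[OF assms(1), of to_ac] by simp
  ultimately have "(\<exists>P. on_curve (map_coeffs to_ac E) P \<and> singular_at (map_coeffs to_ac E) P)
      \<longleftrightarrow> 4 * (to_ac A)^3 + 27 * (to_ac B)^2 = 0"
    using exists_singular_iff by blast
  also have "\<dots> \<longleftrightarrow> to_ac (4 * A^3 + 27 * B^2) = 0" by simp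
  also have "\<dots> \<longleftrightarrow> 4 * A^3 + 27 * B^2 = 0" by (rule to_ac_eq_0_iff)
  finally show ?thesis unfolding elliptic_curve_def by blast
qed

section \<open>Passage between the p-adic integers and their field of fractions\<close>

lemma Fract_hom:
  fixes x y :: "'a::idom"
  shows "Fract (x + y) 1 = Fract x 1 + Fract y 1" "Fract (x * y) 1 = Fract x 1 * Fract y 1"
    "Fract (x - y) 1 = Fract x 1 - Fract y 1" "Fract x 1 = 0 \<longleftrightarrow> x = 0"
  by (simp_all add: Zero_fract_def eq_fract)

lemma Fract_hom_numeral: "Fract (numeral k :: 'a::idom) 1 = numeral k"
  using of_nat_fract[of "numeral k", where 'a = 'a] by simp

lemma Fract_hom_power: "Fract (x ^ n :: 'a::idom) 1 = Fract x 1 ^ n"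
proof (induction n)
  case (Suc n)
  then show ?case by (simp only: power_Suc Fract_hom)
qed (simp add: One_fract_def)

lemmas Fract_homs = Fract_hom(1-3) Fract_hom_numeral Fract_hom_power

text \<open>A root \<open>1/w\<close> with \<open>p\<close> dividing \<open>w\<close> would make \<open>p\<close> divide the leading coefficient 3.\<close>

lemma padic_psi3_root_integral:
  fixes a :: "'p::prime_card padic_int coeffs"
  assumes "CARD('p) > 3"
  shows "(\<exists>z. psi3 (map_coeffs (\<lambda>c. Fract c 1) a) z = 0) \<longleftrightarrow> (\<exists>x. psi3 a x = 0)"
proof
  obtain a1 a2 a3 a4 a6 where a: "a = (a1, a2, a3, a4, a6)" by (metis prod_cases5)
  have hom: "psi3 (map_coeffs (\<lambda>c. Fract c 1) a) (Fract x 1) = Fract (psi3 a x) 1" for x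
    by (simp add: a Fract_homs del: mult_fract add_fract diff_fract)
  {
    assume "\<exists>x. psi3 a x = 0"
    then show "\<exists>z. psi3 (map_coeffs (\<lambda>c. Fract c 1) a) z = 0" using hom Fract_hom(4) by metis
  next
    assume "\<exists>z. psi3 (map_coeffs (\<lambda>c. Fract c 1) a) z = 0"
    then obtain u v where v: "v \<noteq> 0" and root: "psi3 (map_coeffs (\<lambda>c. Fract c 1) a) (Fract u v) = 0"
      by (metis Fract_cases)
    show "\<exists>x. psi3 a x = 0"
    proof (cases "v dvd u")
      case True
      then obtain w where "u = v * w" by blast
      then have "Fract u v = Fract w 1" using v by (simp add: eq_fract mult.commute)
      then show ?thesis using root hom Fract_hom(4) by metis
    next
      case False
      then obtain w where w: "v = u * w" using padic_dvd_total[of u v] by blast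
      have "padic_p dvd w"
      proof (rule ccontr)
        assume "\<not> padic_p dvd w"
        then have "w dvd 1" by (rule padic_unit)
        then have "u * w dvd u * 1" by (intro mult_dvd_mono) auto
        then show False using False w by simp
      qed
      define b2 b4 b6 b8 where b: "b2 = a1^2 + 4 * a2" "b4 = 2 * a4 + a1 * a3" "b6 = a3^2 + 4 * a6"
        "b8 = a1^2 * a6 + 4 * a2 * a6 - a1 * a3 * a4 + a2 * a3^2 - a4^2"
      define z W where "z = Fract u v" and "W = Fract w 1"
      have zW: "z * W = 1" using v w by (simp add: z_def W_def One_fract_def eq_fract)
      have "0 = psi3 (map_coeffs (\<lambda>c. Fract c 1) a) z * W^4" using root by (simp add: z_def)
      also have "psi3 (map_coeffs (\<lambda>c. Fract c 1) a) z
          = 3 * z^4 + Fract b2 1 * z^3 + 3 * Fract b4 1 * z^2 + 3 * Fract b6 1 * z + Fract b8 1"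
        by (simp add: a b Fract_homs del: mult_fract add_fract diff_fract)
      also have "\<dots> * W^4 = 3 * (z * W)^4 + Fract b2 1 * (z * W)^3 * W + 3 * Fract b4 1 * (z * W)^2 * W^2
          + 3 * Fract b6 1 * (z * W) * W^3 + Fract b8 1 * W^4"
        by (simp add: algebra_simps power2_eq_square power3_eq_cube power4_eq_xxxx)
      also have "\<dots> = Fract (3 + b2 * w + 3 * b4 * w^2 + 3 * b6 * w^3 + b8 * w^4) 1"
        unfolding zW by (simp add: W_def Fract_homs del: mult_fract add_fract diff_fract)
      finally have "3 + b2 * w + 3 * b4 * w^2 + 3 * b6 * w^3 + b8 * w^4 = 0" using Fract_hom(4) by metis
      then have "3 = w * (- (b2 + 3 * b4 * w + 3 * b6 * w^2 + b8 * w^3))"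
        by (simp add: algebra_simps power2_eq_square power3_eq_cube power4_eq_xxxx eq_neg_iff_add_eq_0)
      then have "w dvd 3" by (metis dvd_triv_left)
      with \<open>padic_p dvd w\<close> have "padic_p dvd (3 :: 'p padic_int)" by (rule dvd_trans)
      then have "padic_red (3 :: 'p padic_int) = 0" by (subst padic_red_eq_0_iff)
      then show ?thesis using mod_ring_2_3(2)[OF assms] by simp
    qed
  }
qed

section \<open>Roots of the 3-division polynomial over the p-adic integers\<close>

definition psi3_locus :: "('p::prime_card padic_int \<times> 'p padic_int) set" where
  "psi3_locus = {(A, B). \<exists>x. short_psi3 A B x = 0}"

lemma padic_p_dvd_power_iff: "n > 0 \<Longrightarrow> padic_p dvd x ^ n \<longleftrightarrow> padic_p dvd (x :: 'p::prime_card padic_int)"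
  by (simp flip: padic_red_eq_0_iff)

lemma padic_red_short_psi3:
  "padic_red (short_psi3 A B x) = short_psi3 (padic_red A) (padic_red B) (padic_red (x :: 'p::prime_card padic_int))"
  by (simp add: short_psi3_def)

text \<open>Modulo p the equation is linear, u z = w, with invertible slope, so Hensel's lemma
  applies. The rescaled quartics below take this form when the linear and the constant term
  dominate.\<close>

lemma padic_quartic_root:
  fixes u w c2 c4 :: "'p::prime_card padic_int"
  assumes "\<not> padic_p dvd u"
  obtains z where "padic_p * c4 * z^4 + padic_p * c2 * z^2 + u * z - w = 0"
proof -
  define f where "f = [:- w, u, padic_p * c2, 0, padic_p * c4:]"
  have f: "poly f z = padic_p * c4 * z^4 + padic_p * c2 * z^2 + u * z - w" for z
    by (simp add: f_def algebra_simps power2_eq_square power4_eq_xxxx)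
  obtain v where v: "padic_p dvd u * v - 1" using padic_inverse_mod[OF assms] by blast
  obtain z where "poly f z = 0"
  proof (rule padic_hensel[of f "v * w"])
    have "poly f (v * w) = padic_p * (c4 * (v * w)^4 + c2 * (v * w)^2) + (u * v - 1) * w"
      unfolding f by (simp add: algebra_simps)
    then show "padic_p dvd poly f (v * w)" using v by simp
    have "poly (pderiv f) (v * w) = u + padic_p * (2 * c2 * (v * w) + 4 * c4 * (v * w)^3)"
      by (simp add: f_def pderiv_pCons algebra_simps power2_eq_square power3_eq_cube)
    then show "\<not> padic_p dvd poly (pderiv f) (v * w)"
      using assms by (simp add: dvd_add_left_iff)
  qed
  then show ?thesis using that unfolding f by blast
qed

context
  assumes card_gt_3: "CARD('p::prime_card) > 3"
begin

lemma padic_p_dvd_12: "padic_p dvd 12 * x \<longleftrightarrow> padic_p dvd (x :: 'p padic_int)"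
  "padic_p dvd 3 * x \<longleftrightarrow> padic_p dvd (x :: 'p padic_int)"
  using mod_ring_2_3[OF card_gt_3] by (simp_all flip: padic_red_eq_0_iff)

text \<open>The value x^3 + a x + b is the derivative of the quartic up to the factor 12. If it
  vanishes at a root, then 3 x^2 + a = 0, so a = - 3 x^2 and b = 2 x^3 with x \<noteq> 0. In that
  case - 3 x is a root too, and there the cubic has the nonzero value - 16 x^3.\<close>

lemma residue_pairs_simple_root:
  fixes a b :: "'p mod_ring"
  assumes "(a, b) \<in> residue_pairs"
  obtains x where "short_psi3 a b x = 0" "x^3 + a * x + b \<noteq> 0"
proof -
  note nz = mod_ring_2_3[OF card_gt_3]
  from assms obtain x where ab: "(a, b) \<noteq> (0, 0)" and x: "short_psi3 a b x = 0"
    by (auto simp: residue_pairs_def)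
  show ?thesis
  proof (cases "x^3 + a * x + b = 0")
    case True
    have "short_psi3 a b x = 12 * x * (x^3 + a * x + b) - (3 * x^2 + a)^2"
      by (simp add: short_psi3_def algebra_simps power2_eq_square power3_eq_cube power4_eq_xxxx)
    then have "3 * x^2 + a = 0" using x True by simp
    then have a: "a = - 3 * x^2" by (simp add: eq_neg_iff_add_eq_0 add.commute)
    have "x^3 + a * x + b = b - 2 * x^3" by (simp add: a power2_eq_square power3_eq_cube)
    then have b: "b = 2 * x^3" using True by simp
    have "x \<noteq> 0" using ab a b by auto
    have "short_psi3 a b (- 3 * x) = 0"
      unfolding a b by (simp add: short_psi3_def algebra_simps power2_eq_square power3_eq_cube power4_eq_xxxx)
    moreover have "(- 3 * x)^3 + a * (- 3 * x) + b = - (4 * 4 * x^3)"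
      unfolding a b by (simp add: algebra_simps power2_eq_square power3_eq_cube)
    then have "(- 3 * x)^3 + a * (- 3 * x) + b \<noteq> 0"
      using \<open>x \<noteq> 0\<close> nz by (metis mult_eq_0_iff neg_equal_0_iff_equal power_eq_0_iff)
    ultimately show ?thesis using that by blast
  qed (use that x in blast)
qed

lemma psi3_locus_residue:
  fixes A B :: "'p padic_int"
  assumes "\<not> (padic_p dvd A \<and> padic_p dvd B)"
  shows "(A, B) \<in> psi3_locus \<longleftrightarrow> (padic_red A, padic_red B) \<in> residue_pairs"
proof
  assume "(A, B) \<in> psi3_locus"
  then obtain x where "short_psi3 A B x = 0" by (auto simp: psi3_locus_def)
  then have "short_psi3 (padic_red A) (padic_red B) (padic_red x) = 0"
    by (metis padic_red_short_psi3 padic_red_simps(1))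
  then show "(padic_red A, padic_red B) \<in> residue_pairs"
    using assms unfolding residue_pairs_def by (auto simp: padic_red_eq_0_iff)
next
  assume "(padic_red A, padic_red B) \<in> residue_pairs"
  then obtain y where y: "short_psi3 (padic_red A) (padic_red B) y = 0" "y^3 + padic_red A * y + padic_red B \<noteq> 0"
    by (rule residue_pairs_simple_root)
  obtain x0 where x0: "padic_red x0 = y" using padic_red_surj by blast
  define f where "f = [:- (A^2), 12 * B, 6 * A, 0, 3:]"
  have f: "poly f x = short_psi3 A B x" for x
    by (simp add: f_def short_psi3_def algebra_simps power2_eq_square power4_eq_xxxx)
  obtain x where "poly f x = 0"
  proof (rule padic_hensel[of f x0])
    show "padic_p dvd poly f x0"
      unfolding f using y(1) by (simp add: padic_red_short_psi3 x0 flip: padic_red_eq_0_iff)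
    have deriv: "poly (pderiv f) x0 = 12 * (x0^3 + A * x0 + B)"
      by (simp add: f_def pderiv_pCons algebra_simps power2_eq_square power3_eq_cube)
    show "\<not> padic_p dvd poly (pderiv f) x0"
      unfolding deriv padic_p_dvd_12 using y(2) by (simp add: x0 flip: padic_red_eq_0_iff)
  qed
  then show "(A, B) \<in> psi3_locus" unfolding f by (auto simp: psi3_locus_def)
qed

text \<open>After x = p z and division by p^2, only the linear and the constant term survive modulo
  p. The digits in the name are the exponents of p taken out of the two coefficients.\<close>

lemma psi3_locus_1_1:
  fixes A B :: "'p padic_int"
  assumes "\<not> padic_p dvd B" shows "(padic_p * A, padic_p * B) \<in> psi3_locus"
proof -
  obtain z where z: "padic_p * (3 * padic_p) * z^4 + padic_p * (6 * A) * z^2 + (12 * B) * z - A^2 = 0"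
    by (rule padic_quartic_root[of "12 * B" "3 * padic_p" "6 * A" "A^2"]) (use assms padic_p_dvd_12 in auto)
  have "short_psi3 (padic_p * A) (padic_p * B) (padic_p * z)
      = padic_p^2 * (padic_p * (3 * padic_p) * z^4 + padic_p * (6 * A) * z^2 + (12 * B) * z - A^2)"
    by (simp add: short_psi3_def algebra_simps power2_eq_square power4_eq_xxxx)
  then show ?thesis unfolding z by (auto simp: psi3_locus_def)
qed

text \<open>The root now has valuation at least 2: one substitutes x = p^2 z and divides by
  p^4.\<close>

lemma psi3_locus_2_2:
  fixes A B :: "'p padic_int"
  assumes "\<not> padic_p dvd B" shows "(padic_p^2 * A, padic_p^2 * B) \<in> psi3_locus"
proof -
  obtain z where z: "padic_p * (3 * padic_p^3) * z^4 + padic_p * (6 * padic_p * A) * z^2 + (12 * B) * z - A^2 = 0"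
    by (rule padic_quartic_root[of "12 * B" "3 * padic_p^3" "6 * padic_p * A" "A^2"]) (use assms padic_p_dvd_12 in auto)
  have "short_psi3 (padic_p^2 * A) (padic_p^2 * B) (padic_p^2 * z)
      = padic_p^4 * (padic_p * (3 * padic_p^3) * z^4 + padic_p * (6 * padic_p * A) * z^2 + (12 * B) * z - A^2)"
    by (simp add: short_psi3_def algebra_simps power2_eq_square power3_eq_cube power4_eq_xxxx)
  then show ?thesis unfolding z by (auto simp: psi3_locus_def)
qed

lemma short_psi3_root_dvd:
  fixes A B :: "'p padic_int"
  assumes "short_psi3 A B x = 0" "padic_p dvd A" "padic_p dvd B"
  shows "padic_p dvd x"
proof -
  have "3 * x^4 = A^2 - 6 * A * x^2 - 12 * B * x"
    using assms(1) by (simp add: short_psi3_def algebra_simps)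
  then have "padic_p dvd 3 * x^4" using assms(2,3) by (simp add: power2_eq_square)
  then show ?thesis by (simp add: padic_p_dvd_12 padic_p_dvd_power_iff)
qed

text \<open>A root would be divisible by p, which gives every term valuation at least 3 except the
  constant one, whose valuation is exactly 2.\<close>

lemma psi3_locus_1_2:
  fixes A B :: "'p padic_int"
  assumes "\<not> padic_p dvd A" shows "(padic_p * A, padic_p^2 * B) \<notin> psi3_locus"
proof
  assume "(padic_p * A, padic_p^2 * B) \<in> psi3_locus"
  then obtain x where x: "short_psi3 (padic_p * A) (padic_p^2 * B) x = 0" by (auto simp: psi3_locus_def)
  then have "padic_p dvd x" by (rule short_psi3_root_dvd) (auto simp: power2_eq_square)
  then obtain z where z: "x = padic_p * z" by blast
  have "short_psi3 (padic_p * A) (padic_p^2 * B) x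
      = padic_p^2 * (padic_p * (3 * padic_p * z^4 + 6 * A * z^2 + 12 * B * z) - A^2)"
    by (simp add: short_psi3_def z algebra_simps power2_eq_square power4_eq_xxxx)
  then have "A^2 = padic_p * (3 * padic_p * z^4 + 6 * A * z^2 + 12 * B * z)" using x by simp
  then have "padic_p dvd A^2" by simp
  then show False using assms by (simp add: padic_p_dvd_power_iff)
qed

text \<open>The quartic is homogeneous of degree 4 when x, A, B have weights 1, 2, 3. The forward
  direction also uses that every root is divisible by p.\<close>

lemma psi3_locus_scale:
  fixes A B :: "'p padic_int"
  shows "(padic_p^2 * A, padic_p^3 * B) \<in> psi3_locus \<longleftrightarrow> (A, B) \<in> psi3_locus"
proof -
  have eq: "short_psi3 (padic_p^2 * A) (padic_p^3 * B) (padic_p * z) = padic_p^4 * short_psi3 A B z" for z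
    by (simp add: short_psi3_def algebra_simps power2_eq_square power3_eq_cube power4_eq_xxxx)
  show ?thesis
  proof
    assume "(padic_p^2 * A, padic_p^3 * B) \<in> psi3_locus"
    then obtain x where x: "short_psi3 (padic_p^2 * A) (padic_p^3 * B) x = 0" by (auto simp: psi3_locus_def)
    then have "padic_p dvd x" by (rule short_psi3_root_dvd) (auto simp: power2_eq_square power3_eq_cube)
    then obtain z where z: "x = padic_p * z" by blast
    then have "short_psi3 A B z = 0" using x eq by simp
    then show "(A, B) \<in> psi3_locus" by (auto simp: psi3_locus_def)
  next
    assume "(A, B) \<in> psi3_locus"
    then obtain z where "short_psi3 A B z = 0" by (auto simp: psi3_locus_def)
    then have "short_psi3 (padic_p^2 * A) (padic_p^3 * B) (padic_p * z) = 0" using eq by simp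
    then show "(padic_p^2 * A, padic_p^3 * B) \<in> psi3_locus" by (auto simp: psi3_locus_def)
  qed
qed

theorem psi3_locus_iff:
  fixes A B :: "'p padic_int"
  assumes "\<not> (padic_p^2 dvd A \<and> padic_p^3 dvd B)"
  shows "(A, B) \<in> psi3_locus \<longleftrightarrow> (padic_red A, padic_red B) \<in> residue_pairs \<or>
    (padic_p dvd A \<and> padic_p dvd B \<and> \<not> padic_p^2 dvd B) \<or>
    (padic_p^2 dvd A \<and> padic_p^2 dvd B \<and> \<not> padic_p^3 dvd B)"
proof (cases "padic_p dvd A \<and> padic_p dvd B")
  case False
  moreover have "padic_p dvd z" if "padic_p^2 dvd z" for z :: "'p padic_int"
    using that by (metis dvd_mult_left power2_eq_square)
  ultimately show ?thesis using psi3_locus_residue[OF False] by blast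
next
  case True
  then have nR: "(padic_red A, padic_red B) \<notin> residue_pairs"
    by (auto simp: residue_pairs_def padic_red_eq_0_iff)
  have cancel: "padic_p^n * z dvd padic_p^n * w \<longleftrightarrow> z dvd w" for n and z w :: "'p padic_int"
    by simp
  obtain A1 B1 where 1: "A = padic_p * A1" "B = padic_p * B1" using True by blast
  have iff2: "padic_p^2 dvd padic_p * z \<longleftrightarrow> padic_p dvd z" for z :: "'p padic_int"
    by (simp add: power2_eq_square)
  show ?thesis
  proof (cases "padic_p dvd B1")
    case False
    then show ?thesis using psi3_locus_1_1[of B1 A1] True 1 iff2 by auto
  next
    case B1: True
    then obtain B2 where B2: "B = padic_p^2 * B2" using 1 by (auto simp: power2_eq_square mult.assoc)
    have nB: "padic_p^2 dvd B" using B2 by simp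
    have iff3: "padic_p^3 dvd B \<longleftrightarrow> padic_p dvd B2"
      unfolding B2 by (simp add: power2_eq_square power3_eq_cube)
    show ?thesis
    proof (cases "padic_p dvd A1")
      case False
      then show ?thesis using psi3_locus_1_2[of A1 B2] 1 B2 nR nB iff2 by auto
    next
      case A1: True
      then obtain A2 where A2: "A = padic_p^2 * A2" using 1 by (auto simp: power2_eq_square mult.assoc)
      then have "\<not> padic_p dvd B2" using assms iff3 by auto
      then show ?thesis using psi3_locus_2_2[of B2 A2] A2 B2 iff3 by auto
    qed
  qed
qed

end

section \<open>Haar measure\<close>

definition padic_haar :: "'p::prime_card padic_int measure" where
  "padic_haar = (SOME M. normalized_haar M)"

lemma normalized_haar_padic_haar: "normalized_haar (padic_haar :: 'p::prime_card padic_int measure)"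
  unfolding padic_haar_def by (rule someI_ex) (rule normalized_haar_padic_int_exists)

lemma sets_padic_haar [simp, measurable_cong]: "sets (padic_haar :: 'p::prime_card padic_int measure) = sets borel"
  using normalized_haar_padic_haar[where 'p = 'p] by (simp add: normalized_haar_def)

lemma space_padic_haar [simp]: "space (padic_haar :: 'p::prime_card padic_int measure) = UNIV"
  using sets_eq_imp_space_eq[OF sets_padic_haar] by simp

interpretation padic_haar: prob_space "padic_haar :: 'p::prime_card padic_int measure"
  by (rule normalized_haar_prob_space) (rule normalized_haar_padic_haar)

lemma padic_ball_sets [measurable]: "padic_ball n r \<in> sets borel"
  by (intro borel_open open_padic_ball)

text \<open>The p^n residue classes are translates of one another and cover the whole space.\<close>

lemma measure_padic_ball:
  assumes "0 \<le> r" "r < int CARD('p) ^ n"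
  shows "measure padic_haar (padic_ball n r :: 'p::prime_card padic_int set) = 1 / real CARD('p) ^ n"
proof -
  define p where "p = CARD('p)"
  have p: "p > 0" unfolding p_def by simp
  define c where "c = measure padic_haar (padic_ball n 0 :: 'p padic_int set)"
  have eq: "measure padic_haar (padic_ball n s :: 'p padic_int set) = c" if s: "0 \<le> s" "s < int p ^ n" for s
  proof -
    have "(\<lambda>x. of_int s + x) -` padic_ball n s = (padic_ball n 0 :: 'p padic_int set)"
    proof (rule Set.set_eqI)
      fix x :: "'p padic_int"
      have x: "padic_res x n = padic_res x n mod int p ^ n" by (simp add: p_def)
      have "(s + padic_res x n) mod int p ^ n = s \<longleftrightarrow> (s + padic_res x n) mod int p ^ n = s mod int p ^ n"
        using s by simp
      also have "\<dots> \<longleftrightarrow> padic_res x n mod int p ^ n = 0" by (simp add: mod_eq_dvd_iff mod_eq_0_iff_dvd)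
      finally show "x \<in> (\<lambda>x. of_int s + x) -` padic_ball n s \<longleftrightarrow> x \<in> padic_ball n 0"
        using x by (simp add: padic_ball_def plus_padic_int.rep_eq padic_res_of_int mod_simps p_def[symmetric])
    qed
    moreover have "emeasure padic_haar ((\<lambda>x. of_int s + x) -` (padic_ball n s :: 'p padic_int set))
        = emeasure padic_haar (padic_ball n s :: 'p padic_int set)"
      by (rule normalized_haar_vimage[OF normalized_haar_padic_haar padic_ball_sets])
    ultimately show ?thesis by (simp add: c_def measure_def)
  qed
  have "(\<Union>s\<in>{0..<int p ^ n}. padic_ball n s) = (UNIV :: 'p padic_int set)"
    using padic_res_range[where 'p = 'p and n = n] by (auto simp: padic_ball_def p_def)
  then have "1 = measure padic_haar (\<Union>s\<in>{0..<int p ^ n}. padic_ball n s :: 'p padic_int set)"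
    using padic_haar.prob_space by simp
  also have "\<dots> = (\<Sum>s\<in>{0..<int p ^ n}. measure padic_haar (padic_ball n s :: 'p padic_int set))"
    by (rule padic_haar.finite_measure_finite_Union) (auto simp: disjoint_family_on_def padic_ball_sets, auto simp: padic_ball_def)
  also have "\<dots> = real p ^ n * c" by (simp add: eq)
  finally have "c = 1 / real p ^ n" using p by (simp add: field_simps)
  then show ?thesis using eq[of r] assms by (simp add: p_def)
qed

lemma measure_padic_dvd:
  "measure padic_haar {x :: 'p::prime_card padic_int. of_nat CARD('p) ^ n dvd x} = 1 / real CARD('p) ^ n"
  "{x :: 'p::prime_card padic_int. of_nat CARD('p) ^ n dvd x} \<in> sets borel"
proof -
  have "{x :: 'p padic_int. of_nat CARD('p) ^ n dvd x} = padic_ball n 0"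
    by (auto simp: padic_power_dvd_iff padic_ball_def)
  then show "measure padic_haar {x :: 'p padic_int. of_nat CARD('p) ^ n dvd x} = 1 / real CARD('p) ^ n"
    "{x :: 'p padic_int. of_nat CARD('p) ^ n dvd x} \<in> sets borel"
    using measure_padic_ball[of 0 n, where 'p = 'p] by simp_all
qed

lemma measure_padic_red:
  "measure padic_haar {x. padic_red x = (a :: 'p::prime_card mod_ring)} = 1 / real CARD('p)"
  "{x. padic_red x = (a :: 'p mod_ring)} \<in> sets borel"
proof -
  obtain y :: "'p padic_int" where y: "padic_red y = a" using padic_red_surj by blast
  have "{x. padic_red x = a} = padic_ball 1 (padic_res y 1)"
  proof (rule Set.set_eqI)
    fix x :: "'p padic_int"
    have "padic_red x = a \<longleftrightarrow> padic_red (x - y) = 0" by (simp add: y)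
    also have "\<dots> \<longleftrightarrow> (padic_res x 1 - padic_res y 1) mod int CARD('p) = 0"
      unfolding padic_red_eq_0_iff padic_dvd_iff padic_res_diff by simp
    also have "\<dots> \<longleftrightarrow> padic_res x 1 mod int CARD('p) = padic_res y 1 mod int CARD('p)"
      by (simp add: mod_eq_dvd_iff mod_eq_0_iff_dvd)
    also have "\<dots> \<longleftrightarrow> padic_res x 1 = padic_res y 1" using padic_res_mod[of x 1] padic_res_mod[of y 1] by simp
    finally show "x \<in> {x. padic_red x = a} \<longleftrightarrow> x \<in> padic_ball 1 (padic_res y 1)" by (simp add: padic_ball_def)
  qed
  then show "measure padic_haar {x. padic_red x = a} = 1 / real CARD('p)" "{x. padic_red x = a} \<in> sets borel"
    using measure_padic_ball[of "padic_res y 1" 1, where 'p = 'p] padic_res_range[of y 1] by simp_all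
qed

lemma padic_singleton_sets: "{x :: 'p::prime_card padic_int} \<in> sets borel"
proof -
  have "{x} = (\<Inter>n. padic_ball n (padic_res x n))"
    by (auto simp: padic_ball_def intro: padic_int_eqI)
  also have "\<dots> \<in> sets borel" by (intro sets.countable_INT'') (auto simp: padic_ball_sets)
  finally show ?thesis .
qed

lemma emeasure_padic_singleton: "emeasure padic_haar {x :: 'p::prime_card padic_int} = 0"
proof -
  have "measure padic_haar {x} \<le> (1 / real CARD('p)) ^ n" for n
  proof -
    have "measure padic_haar {x} \<le> measure padic_haar (padic_ball n (padic_res x n) :: 'p padic_int set)"
      by (rule padic_haar.finite_measure_mono) (auto simp: padic_ball_sets, auto simp: padic_ball_def)
    then show ?thesis using padic_res_range[of x n] by (simp add: measure_padic_ball power_one_over)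
  qed
  moreover have "(\<lambda>n. (1 / real CARD('p)) ^ n) \<longlonglongrightarrow> 0"
    using prime_gt_1_nat[OF prime_card[where 'a = 'p]] by (intro LIMSEQ_power_zero) simp
  ultimately have "measure padic_haar {x} \<le> 0" by (intro LIMSEQ_le_const) auto
  then show ?thesis by (simp add: padic_haar.emeasure_eq_measure measure_le_0_iff)
qed

lemma continuous_on_padicI:
  fixes f :: "'a::topological_space \<Rightarrow> 'p::prime_card padic_int"
  assumes "\<And>n r. open (f -` padic_ball n r)"
  shows "continuous_on UNIV f"
proof -
  have "\<forall>B. open B \<longrightarrow> open (f -` B)"
  proof (intro allI impI)
    fix B :: "'p padic_int set" assume "open B"
    then obtain C where C: "C \<subseteq> range (\<lambda>(n, r). padic_ball n r)" "B = \<Union> C"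
      using topological_basis_padic_ball unfolding topological_basis_def by metis
    have "open (f -` c)" if "c \<in> C" for c using C(1) that assms by auto
    then have "open (\<Union>c\<in>C. f -` c)" by blast
    then show "open (f -` B)" by (simp add: C(2) vimage_Union)
  qed
  then show ?thesis by (simp add: continuous_on_open_vimage)
qed

lemma open_padic_res: "open {x :: 'p::prime_card padic_int. P (padic_res x n)}"
  unfolding open_padic_int_def by (auto simp: padic_ball_def intro!: exI[of _ n])

instance padic_int :: (prime_card) topological_semigroup_mult
proof
  fix a b :: "'a padic_int"
  show "((\<lambda>z. fst z * snd z) \<longlongrightarrow> a * b) (nhds a \<times>\<^sub>F nhds b)"
  proof (rule topological_tendstoI)
    fix S assume "open S" "a * b \<in> S"
    then obtain n where n: "padic_ball n (padic_res (a * b) n) \<subseteq> S"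
      unfolding open_padic_int_def by blast
    have "\<forall>\<^sub>F x in nhds a. padic_res x n = padic_res a n" "\<forall>\<^sub>F x in nhds b. padic_res x n = padic_res b n"
      using eventually_nhds_in_open[OF open_padic_ball[of n]] by (auto simp: padic_ball_def)
    then show "\<forall>\<^sub>F x in nhds a \<times>\<^sub>F nhds b. fst x * snd x \<in> S"
      by (rule eventually_prodI[THEN eventually_mono])
         (use n in \<open>auto simp: padic_ball_def times_padic_int.rep_eq\<close>)
  qed
qed

lemma continuous_padic_shift: "continuous_on UNIV (padic_shift :: 'p::prime_card padic_int \<Rightarrow> _)"
proof (rule continuous_on_padicI)
  fix n r
  have "(padic_shift :: 'p padic_int \<Rightarrow> _) -` padic_ball n r = {x. padic_res x (Suc n) div int CARD('p) = r}"
    by (auto simp: padic_ball_def padic_shift.rep_eq)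
  then show "open ((padic_shift :: 'p padic_int \<Rightarrow> _) -` padic_ball n r)"
    using open_padic_res[of "\<lambda>k. k div int CARD('p) = r" "Suc n"] by simp
qed

section \<open>Haar measure on pairs and the scaling by (p^2, p^3)\<close>

definition padic_haar2 :: "('p::prime_card padic_int \<times> 'p padic_int) measure" where
  "padic_haar2 = padic_haar \<Otimes>\<^sub>M padic_haar"

lemma normalized_haar_padic_haar2:
  "continuous_on UNIV (\<lambda>x :: ('p::prime_card padic_int \<times> 'p padic_int) \<times> _. fst x + snd x)"
  "normalized_haar (padic_haar2 :: ('p padic_int \<times> 'p padic_int) measure)"
  unfolding padic_haar2_def
  by (rule normalized_haar_pair[OF continuous_on_padic_add continuous_on_padic_add
        normalized_haar_padic_haar normalized_haar_padic_haar])+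

lemma sets_padic_haar2 [simp, measurable_cong]:
  "sets (padic_haar2 :: ('p::prime_card padic_int \<times> 'p padic_int) measure) = sets borel"
  using normalized_haar_padic_haar2(2)[where 'p = 'p] by (simp add: normalized_haar_def)

lemma space_padic_haar2 [simp]: "space (padic_haar2 :: ('p::prime_card padic_int \<times> 'p padic_int) measure) = UNIV"
  using sets_eq_imp_space_eq[OF sets_padic_haar2] by simp

interpretation padic_haar2: prob_space "padic_haar2 :: ('p::prime_card padic_int \<times> 'p padic_int) measure"
  by (rule normalized_haar_prob_space) (rule normalized_haar_padic_haar2)

lemma padic_haar2_Times:
  fixes U V :: "'p::prime_card padic_int set"
  assumes "U \<in> sets borel" "V \<in> sets borel"
  shows "U \<times> V \<in> sets borel" "measure padic_haar2 (U \<times> V) = measure padic_haar U * measure padic_haar V"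
proof -
  have "U \<times> V \<in> sets padic_haar2"
    unfolding padic_haar2_def using assms by (intro pair_measureI) simp_all
  then show "U \<times> V \<in> sets borel" by simp
  have "emeasure padic_haar2 (U \<times> V) = emeasure padic_haar U * emeasure padic_haar V"
    unfolding padic_haar2_def using assms by (intro padic_haar.emeasure_pair_measure_Times) simp_all
  then show "measure padic_haar2 (U \<times> V) = measure padic_haar U * measure padic_haar V"
    by (simp add: measure_def enn2real_mult)
qed

lemma emeasure_padic_haar2_fst:
  fixes Y :: "('p::prime_card padic_int \<times> 'p padic_int) set"
  assumes "Y \<in> sets borel"
  shows "emeasure padic_haar2 Y = (\<integral>\<^sup>+x. emeasure padic_haar (Pair x -` Y) \<partial>padic_haar)"
  using assms sets_padic_haar2[where 'p = 'p] unfolding padic_haar2_def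
  by (intro padic_haar.emeasure_pair_measure_alt) simp

definition padic_scale :: "'p::prime_card padic_int \<times> 'p padic_int \<Rightarrow> 'p padic_int \<times> 'p padic_int" where
  "padic_scale z = (of_nat CARD('p) ^ 2 * fst z, of_nat CARD('p) ^ 3 * snd z)"

text \<open>A left inverse of the scaling that is total and continuous, because it drops digits
  instead of dividing. It turns images under the scaling into preimages, whose measurability is
  clear.\<close>

definition padic_unscale :: "'p::prime_card padic_int \<times> 'p padic_int \<Rightarrow> 'p padic_int \<times> 'p padic_int" where
  "padic_unscale z = (padic_shift (padic_shift (fst z)), padic_shift (padic_shift (padic_shift (snd z))))"

lemma padic_unscale_scale [simp]: "padic_unscale (padic_scale z) = z"
  by (simp add: padic_scale_def padic_unscale_def padic_shift_mult power2_eq_square power3_eq_cube mult.assoc)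

lemma padic_scale_add: "padic_scale (z + w) = padic_scale z + padic_scale w"
  by (simp add: padic_scale_def distrib_left)

lemma padic_scale_image:
  fixes Y :: "('p::prime_card padic_int \<times> 'p padic_int) set"
  shows "padic_scale ` Y = range padic_scale \<inter> padic_unscale -` Y"
proof -
  have "padic_scale (padic_unscale z) = z" if "z \<in> range padic_scale" for z :: "'p padic_int \<times> 'p padic_int"
    using that by auto
  then show ?thesis by (force simp: image_iff)
qed

lemma range_padic_scale:
  "range (padic_scale :: 'p::prime_card padic_int \<times> 'p padic_int \<Rightarrow> _)
    = {x. of_nat CARD('p) ^ 2 dvd x} \<times> {x. of_nat CARD('p) ^ 3 dvd x}"
  by (auto simp: padic_scale_def image_iff elim!: dvdE)

lemma measurable_padic_unscale:
  "(padic_unscale :: 'p::prime_card padic_int \<times> 'p padic_int \<Rightarrow> _) \<in> borel \<rightarrow>\<^sub>M borel"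
proof (rule borel_measurable_continuous_onI)
  note shift = continuous_on_compose2[OF continuous_padic_shift _ subset_UNIV]
  show "continuous_on UNIV (padic_unscale :: 'p padic_int \<times> 'p padic_int \<Rightarrow> _)"
    unfolding padic_unscale_def by (intro continuous_on_Pair shift continuous_intros)
qed

lemma padic_scale_sets:
  fixes Y :: "('p::prime_card padic_int \<times> 'p padic_int) set"
  assumes "Y \<in> sets borel" shows "padic_scale ` Y \<in> sets borel"
proof -
  have "padic_unscale -` Y \<in> sets borel"
    using measurable_sets_borel[OF measurable_padic_unscale assms] .
  then show ?thesis unfolding padic_scale_image[of Y] range_padic_scale
    by (rule sets.Int[OF padic_haar2_Times(1)[OF measure_padic_dvd(2) measure_padic_dvd(2)]])
qed

text \<open>The pushforward of the normalized restriction to the image of the scaling is again translation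
  invariant, hence is the Haar measure.\<close>

lemma measure_padic_scale:
  fixes Y :: "('p::prime_card padic_int \<times> 'p padic_int) set"
  assumes Y: "Y \<in> sets borel"
  shows "measure padic_haar2 (padic_scale ` Y) = measure padic_haar2 Y / real CARD('p) ^ 5"
proof -
  define q where "q = real CARD('p) ^ 5"
  have q: "q > 0" by (simp add: q_def)
  define N where "N = distr (density padic_haar2 (\<lambda>z. ennreal q * indicator (range padic_scale) z)) borel
    (padic_unscale :: 'p padic_int \<times> 'p padic_int \<Rightarrow> _)"
  have range_sets: "range (padic_scale :: 'p padic_int \<times> 'p padic_int \<Rightarrow> _) \<in> sets borel"
    using padic_scale_sets[of "UNIV :: ('p padic_int \<times> 'p padic_int) set"] by simp
  have N: "emeasure N V = ennreal q * emeasure padic_haar2 (padic_scale ` V)" if V: "V \<in> sets borel" for V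
  proof -
    have pre: "padic_unscale -` V \<in> sets borel"
      using measurable_sets_borel[OF measurable_padic_unscale V] .
    have "emeasure N V = emeasure (density padic_haar2 (\<lambda>z. ennreal q * indicator (range padic_scale) z)) (padic_unscale -` V)"
      unfolding N_def using measurable_padic_unscale V
      by (subst emeasure_distr) (auto cong: measurable_cong_sets)
    also have "\<dots> = (\<integral>\<^sup>+z. ennreal q * indicator (range padic_scale) z * indicator (padic_unscale -` V) z \<partial>padic_haar2)"
      using range_sets pre by (subst emeasure_density) auto
    also have "\<dots> = (\<integral>\<^sup>+z. ennreal q * indicator (padic_scale ` V) z \<partial>padic_haar2)"
      unfolding padic_scale_image[of V] by (simp add: indicator_inter_arith mult.assoc)
    also have "\<dots> = ennreal q * emeasure padic_haar2 (padic_scale ` V)"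
      using padic_scale_sets[OF V] by (subst nn_integral_cmult_indicator) auto
    finally show ?thesis .
  qed
  have "normalized_haar N"
    unfolding normalized_haar_def
  proof (intro conjI allI ballI)
    show sets: "sets N = sets borel" by (simp add: N_def)
    \<comment> \<open>The image is a product of multiples of p^2 and multiples of p^3, so its
      measure is 1 / p^5; this fixes the normalizing constant \<open>q\<close>.\<close>
    have "measure padic_haar2 (range (padic_scale :: 'p padic_int \<times> 'p padic_int \<Rightarrow> _)) = 1 / q"
      unfolding range_padic_scale padic_haar2_Times(2)[OF measure_padic_dvd(2) measure_padic_dvd(2)]
        measure_padic_dvd(1) q_def by (simp flip: power_add)
    then show "emeasure N UNIV = 1"
      using q by (simp add: N padic_haar2.emeasure_eq_measure flip: ennreal_mult)
    fix t V assume "V \<in> sets N"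
    then have V: "V \<in> sets borel" by (simp add: sets)
    have tV: "(\<lambda>x. t + x) ` V \<in> sets borel"
      unfolding image_plus_eq_vimage
      using measurable_sets_borel[OF measurable_translation[OF normalized_haar_padic_haar2(1)] V] .
    have "padic_scale ` ((\<lambda>x. t + x) ` V) = (\<lambda>x. padic_scale t + x) ` (padic_scale ` V)"
      by (auto simp: padic_scale_add image_iff)
    moreover have "emeasure padic_haar2 ((\<lambda>x. padic_scale t + x) ` (padic_scale ` V)) = emeasure padic_haar2 (padic_scale ` V)"
      using normalized_haar_padic_haar2(2) padic_scale_sets[OF V] sets_padic_haar2
      unfolding normalized_haar_def by blast
    ultimately show "emeasure N ((\<lambda>x. t + x) ` V) = emeasure N V" by (simp add: N V tV)
  qed
  then have "N = padic_haar2"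
    using normalized_haar_unique[OF normalized_haar_padic_haar2(1) _ normalized_haar_padic_haar2(2)] by blast
  then have "emeasure padic_haar2 Y = ennreal q * emeasure padic_haar2 (padic_scale ` Y)" using N[OF Y] by simp
  then have "measure padic_haar2 Y = q * measure padic_haar2 (padic_scale ` Y)"
    using q by (simp add: padic_haar2.emeasure_eq_measure flip: ennreal_mult)
  then show ?thesis using q by (simp add: q_def field_simps)
qed

text \<open>By Fubini one may fix a1, a2, a3; then \<Phi> translates a4 by a constant and a6 by a
  quantity that depends on a4 only. Both translations preserve the measure.\<close>

lemma measure_haar5_shear:
  fixes f :: "'p::prime_card padic_int \<Rightarrow> 'p padic_int \<Rightarrow> 'p padic_int \<Rightarrow> 'p padic_int"
    and g :: "'p padic_int \<Rightarrow> 'p padic_int \<Rightarrow> 'p padic_int \<Rightarrow> 'p padic_int \<Rightarrow> 'p padic_int"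
  defines "\<Phi> \<equiv> \<lambda>(a1, a2, a3, a4, a6). (a4 + f a1 a2 a3, a6 + g a1 a2 a3 a4)"
  assumes \<Phi>: "\<Phi> \<in> borel \<rightarrow>\<^sub>M borel" and Y: "Y \<in> sets borel"
  shows "measure haar_measure (\<Phi> -` Y) = measure padic_haar2 Y"
proof -
  note c1 = continuous_on_padic_add[where 'p = 'p] and M = normalized_haar_padic_haar[where 'p = 'p]
  define M1 :: "'p padic_int measure" where "M1 = padic_haar"
  note M = M[folded M1_def]
  define M3 :: "('p padic_int \<times> 'p padic_int \<times> 'p padic_int) measure" where "M3 = M1 \<Otimes>\<^sub>M padic_haar2"
  define M4 where "M4 = M1 \<Otimes>\<^sub>M M3"
  define M5 where "M5 = M1 \<Otimes>\<^sub>M M4"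
  note M3 = normalized_haar_pair[OF c1 normalized_haar_padic_haar2(1)[where 'p = 'p] M
        normalized_haar_padic_haar2(2)[where 'p = 'p], folded M3_def]
  note M4 = normalized_haar_pair[OF c1 M3(1) M M3(2), folded M4_def]
  note M5 = normalized_haar_pair[OF c1 M4(1) M M4(2), folded M5_def]
  have haar: "haar_measure = M5"
    by (rule normalized_haar_unique[OF M5(1) normalized_haar_haar_measure_padic5 M5(2)])
  interpret M3: prob_space M3 using M3(2) by (rule normalized_haar_prob_space)
  interpret M4: prob_space M4 using M4(2) by (rule normalized_haar_prob_space)
  interpret M5: prob_space M5 using M5(2) by (rule normalized_haar_prob_space)
  have sets: "sets M1 = sets borel" "sets M3 = sets borel" "sets M4 = sets borel" "sets M5 = sets borel"
    using M M3(2) M4(2) M5(2) by (simp_all add: normalized_haar_def)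
  have Y5: "\<Phi> -` Y \<in> sets M5" using measurable_sets_borel[OF \<Phi> Y] by (simp add: sets)
  have sec: "Pair x -` V \<in> sets N" if "V \<in> sets (M1 \<Otimes>\<^sub>M N)" for V x and N :: "'b measure"
    using that by (rule sets_Pair1)
  have inner: "emeasure padic_haar2 (Pair a3 -` Pair a2 -` Pair a1 -` (\<Phi> -` Y)) = emeasure padic_haar2 Y" for a1 a2 a3
  proof -
    define F where "F = f a1 a2 a3"
    define W where "W = Pair a3 -` Pair a2 -` Pair a1 -` (\<Phi> -` Y)"
    have W: "W \<in> sets borel"
      using sec[OF sec[OF sec[OF Y5[unfolded M5_def], of a1, unfolded M4_def], of a2, unfolded M3_def], of a3]
      by (simp add: W_def)
    \<comment> \<open>Slicing at \<open>a4\<close> removes the translation of the last coordinate;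
      what remains is the shift of \<open>a4\<close> by \<open>F\<close>, undone by invariance in
      the outer integral.\<close>
    have slice: "emeasure padic_haar (Pair a4 -` W) = emeasure padic_haar (Pair (F + a4) -` Y)" for a4
    proof -
      have "Y \<in> sets padic_haar2" using Y by simp
      then have "Pair (F + a4) -` Y \<in> sets padic_haar" unfolding padic_haar2_def by (rule sets_Pair1)
      moreover have "Pair a4 -` W = (\<lambda>x. g a1 a2 a3 a4 + x) -` (Pair (F + a4) -` Y)"
        by (auto simp: W_def \<Phi>_def F_def add.commute)
      ultimately show ?thesis
        using normalized_haar_vimage[OF normalized_haar_padic_haar] by simp
    qed
    have h: "(\<lambda>a. emeasure padic_haar (Pair a -` Y)) \<in> borel_measurable padic_haar"
      using Y sets_padic_haar2[where 'p = 'p] unfolding padic_haar2_def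
      by (intro padic_haar.measurable_emeasure_Pair) simp
    have tr: "(\<lambda>x. F + x) \<in> padic_haar \<rightarrow>\<^sub>M borel"
      using measurable_translation[OF c1] by (simp cong: measurable_cong_sets)
    have "emeasure padic_haar2 W = (\<integral>\<^sup>+a. emeasure padic_haar (Pair (F + a) -` Y) \<partial>padic_haar)"
      unfolding emeasure_padic_haar2_fst[OF W] slice ..
    also have "\<dots> = (\<integral>\<^sup>+a. emeasure padic_haar (Pair a -` Y) \<partial>distr padic_haar borel (\<lambda>x. F + x))"
      using h tr by (subst nn_integral_distr) (auto cong: measurable_cong_sets)
    also have "distr padic_haar borel (\<lambda>x. F + x) = padic_haar"
      using normalized_haar_padic_haar normalized_haar_iff_distr[OF c1] by blast
    also have "(\<integral>\<^sup>+a. emeasure padic_haar (Pair a -` Y) \<partial>padic_haar) = emeasure padic_haar2 Y"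
      unfolding emeasure_padic_haar2_fst[OF Y] ..
    finally show ?thesis unfolding W_def .
  qed
  have one: "emeasure M1 UNIV = 1" using M by (simp add: normalized_haar_def)
  have sp: "space M1 = UNIV" by (simp add: M1_def)
  have 3: "emeasure M3 (Pair a2 -` Pair a1 -` (\<Phi> -` Y)) = emeasure padic_haar2 Y" for a1 a2
    using sec[OF sec[OF Y5[unfolded M5_def], of a1, unfolded M4_def], of a2] one sp
    unfolding M3_def by (subst padic_haar2.emeasure_pair_measure_alt) (simp_all add: inner)
  have 4: "emeasure M4 (Pair a1 -` (\<Phi> -` Y)) = emeasure padic_haar2 Y" for a1
    using sec[OF Y5[unfolded M5_def], of a1] one sp
    unfolding M4_def by (subst M3.emeasure_pair_measure_alt) (simp_all add: 3)
  have "emeasure M5 (\<Phi> -` Y) = emeasure padic_haar2 Y"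
    using Y5 one sp unfolding M5_def by (subst M4.emeasure_pair_measure_alt) (simp_all add: 4)
  then show ?thesis unfolding haar by (simp add: measure_def)
qed

section \<open>The measure of the locus\<close>

context
  assumes card_gt_3: "CARD('p::prime_card) > 3"
begin

text \<open>With v the p-adic valuation, the three disjoint pieces are the pairs that are nonzero
  modulo p and have a root there, those with v(A) at least 1 and v(B) = 1, and those with v(A) at
  least 2 and v(B) = 2.\<close>

lemma psi3_locus_not_scaled:
  "(psi3_locus :: ('p padic_int \<times> 'p padic_int) set) - range padic_scale
    = {z. (padic_red (fst z), padic_red (snd z)) \<in> residue_pairs}
      \<union> {A. padic_p dvd A} \<times> ({B. padic_p dvd B} - {B. padic_p^2 dvd B})
      \<union> {A. padic_p^2 dvd A} \<times> ({B. padic_p^2 dvd B} - {B. padic_p^3 dvd B})" (is "_ = ?R \<union> ?E1 \<union> ?E2")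
proof (rule Set.set_eqI)
  fix z :: "'p padic_int \<times> 'p padic_int"
  obtain A B where z: "z = (A, B)" by fastforce
  show "z \<in> psi3_locus - range padic_scale \<longleftrightarrow> z \<in> ?R \<union> ?E1 \<union> ?E2"
  proof (cases "padic_p^2 dvd A \<and> padic_p^3 dvd B")
    case True
    have low: "padic_p dvd w" if "padic_p^2 dvd w \<or> padic_p^3 dvd w" for w :: "'p padic_int"
      using that by (metis dvd_trans dvd_power pos2 zero_less_numeral)
    have "padic_p^2 dvd B" using True le_imp_power_dvd[of 2 3 "padic_p :: 'p padic_int"] dvd_trans by fastforce
    moreover have "(padic_red A, padic_red B) = (0, 0)" using True low by (simp add: padic_red_eq_0_iff)
    then have "z \<notin> ?R" by (simp add: z residue_pairs_def)
    moreover have "z \<in> range padic_scale" using True by (simp add: z range_padic_scale)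
    ultimately show ?thesis using True z by auto
  next
    case False
    then have "z \<notin> range padic_scale" by (auto simp: z range_padic_scale)
    then show ?thesis using psi3_locus_iff[OF card_gt_3 False] by (auto simp: z)
  qed
qed

lemma measure_padic_annulus:
  "measure padic_haar ({x :: 'p padic_int. padic_p^m dvd x} - {x. padic_p^Suc m dvd x})
    = 1 / real CARD('p) ^ m - 1 / real CARD('p) ^ Suc m"
proof -
  have "{x :: 'p padic_int. padic_p^Suc m dvd x} \<subseteq> {x. padic_p^m dvd x}"
    by (auto intro: dvd_mult_right)
  then show ?thesis
    using padic_haar.finite_measure_Diff[of "{x :: 'p padic_int. padic_p^m dvd x}" "{x. padic_p^Suc m dvd x}"]
      measure_padic_dvd[of m, where 'p = 'p] measure_padic_dvd[of "Suc m", where 'p = 'p] by simp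
qed

lemma padic_red_preimage:
  fixes S :: "('p mod_ring \<times> 'p mod_ring) set"
  shows "{z. (padic_red (fst z), padic_red (snd z)) \<in> S} \<in> sets borel"
    "measure padic_haar2 {z. (padic_red (fst z), padic_red (snd z)) \<in> S} = real (card S) / real CARD('p) ^ 2"
proof -
  define U where "U s = {x. padic_red x = fst s} \<times> {x. padic_red x = snd s}" for s :: "'p mod_ring \<times> 'p mod_ring"
  have eq: "{z. (padic_red (fst z), padic_red (snd z)) \<in> S} = (\<Union>s\<in>S. U s)"
    by (auto simp: U_def)
  have U: "U s \<in> sets borel" for s unfolding U_def by (intro padic_haar2_Times(1) measure_padic_red)
  have mU: "measure padic_haar2 (U s) = 1 / real CARD('p) ^ 2" for s
    unfolding U_def padic_haar2_Times(2)[OF measure_padic_red(2) measure_padic_red(2)] measure_padic_red(1)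
    by (simp add: power2_eq_square)
  show "{z. (padic_red (fst z), padic_red (snd z)) \<in> S} \<in> sets borel"
    unfolding eq using U by (intro sets.finite_UN) auto
  have "measure padic_haar2 (\<Union>s\<in>S. U s) = (\<Sum>s\<in>S. measure padic_haar2 (U s))"
    using U by (intro padic_haar2.finite_measure_finite_Union) (auto simp: disjoint_family_on_def, auto simp: U_def)
  then show "measure padic_haar2 {z. (padic_red (fst z), padic_red (snd z)) \<in> S} = real (card S) / real CARD('p) ^ 2"
    unfolding eq mU by simp
qed

lemma measure_psi3_locus_not_scaled:
  "(psi3_locus :: ('p padic_int \<times> 'p padic_int) set) - range padic_scale \<in> sets borel" (is "?C \<in> _")
  "measure padic_haar2 ((psi3_locus :: ('p padic_int \<times> 'p padic_int) set) - range padic_scale)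
    = real (card (residue_pairs :: ('p mod_ring \<times> 'p mod_ring) set)) / real CARD('p) ^ 2
      + (1 / real CARD('p)) * (1 / real CARD('p) - 1 / real CARD('p) ^ 2)
      + (1 / real CARD('p) ^ 2) * (1 / real CARD('p) ^ 2 - 1 / real CARD('p) ^ 3)"
proof -
  let ?R = "{z :: 'p padic_int \<times> 'p padic_int. (padic_red (fst z), padic_red (snd z)) \<in> residue_pairs}"
  let ?P = "\<lambda>n. {x :: 'p padic_int. padic_p^n dvd x}"
  let ?E1 = "?P 1 \<times> (?P 1 - ?P 2)" and ?E2 = "?P 2 \<times> (?P 2 - ?P 3)"
  have C: "?C = ?R \<union> ?E1 \<union> ?E2" using psi3_locus_not_scaled by simp
  note P = measure_padic_dvd(2)[where 'p = 'p]
  have annulus: "?P m - ?P n \<in> sets borel" for m n using P by (intro sets.Diff)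
  have sets: "?R \<in> sets borel" "?E1 \<in> sets borel" "?E2 \<in> sets borel"
    by (rule padic_red_preimage padic_haar2_Times P annulus)+
  then show "?C \<in> sets borel" unfolding C by (intro sets.Un)
  have d12: "?E1 \<inter> ?E2 = {}" by auto
  have dR: "?R \<inter> (?E1 \<union> ?E2) = {}"
  proof -
    have low: "padic_p dvd w" if "padic_p^2 dvd w" for w :: "'p padic_int"
      using that by (metis dvd_mult_left power2_eq_square)
    have "padic_red (fst z) = 0 \<and> padic_red (snd z) = 0" if "z \<in> ?E1 \<union> ?E2" for z
      using that low by (auto simp: padic_red_eq_0_iff)
    then show ?thesis by (fastforce simp: residue_pairs_def)
  qed
  have "measure padic_haar2 ?C = measure padic_haar2 ?R + measure padic_haar2 (?E1 \<union> ?E2)"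
    unfolding C Un_assoc using sets dR by (intro padic_haar2.finite_measure_Union) auto
  also have "measure padic_haar2 (?E1 \<union> ?E2) = measure padic_haar2 ?E1 + measure padic_haar2 ?E2"
    using sets d12 by (intro padic_haar2.finite_measure_Union) auto
  also have "measure padic_haar2 ?E1 = (1 / real CARD('p)) * (1 / real CARD('p) - 1 / real CARD('p) ^ 2)"
    unfolding padic_haar2_Times(2)[OF P annulus]
    using measure_padic_annulus[of 1] measure_padic_dvd(1)[of 1, where 'p = 'p] by (simp add: numeral_2_eq_2)
  also have "measure padic_haar2 ?E2 = (1 / real CARD('p) ^ 2) * (1 / real CARD('p) ^ 2 - 1 / real CARD('p) ^ 3)"
    unfolding padic_haar2_Times(2)[OF P annulus]
    using measure_padic_annulus[of 2] measure_padic_dvd(1)[of 2, where 'p = 'p] by (simp add: numeral_3_eq_3)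
  finally show "measure padic_haar2 ?C = real (card (residue_pairs :: ('p mod_ring \<times> 'p mod_ring) set)) / real CARD('p) ^ 2
      + (1 / real CARD('p)) * (1 / real CARD('p) - 1 / real CARD('p) ^ 2)
      + (1 / real CARD('p) ^ 2) * (1 / real CARD('p) ^ 2 - 1 / real CARD('p) ^ 3)"
    by (simp add: padic_red_preimage(2))
qed

lemma psi3_locus_scale_image:
  "(psi3_locus :: ('p padic_int \<times> 'p padic_int) set) = (psi3_locus - range padic_scale) \<union> padic_scale ` psi3_locus"
proof -
  have "padic_scale z \<in> psi3_locus \<longleftrightarrow> z \<in> psi3_locus" for z :: "'p padic_int \<times> 'p padic_int"
    using psi3_locus_scale[OF card_gt_3, of "fst z" "snd z"] by (simp add: padic_scale_def)
  then show ?thesis by auto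
qed

text \<open>The definition involves an existential quantifier over an uncountable ring, so
  measurability needs an argument. Iterating the self-similarity exhausts the locus by the countably
  many scaled copies \<open>C n\<close>, up to points in the range of every power of the scaling.
  Such a point is divisible by all powers of p, hence is (0, 0).\<close>

lemma psi3_locus_sets: "(psi3_locus :: ('p padic_int \<times> 'p padic_int) set) \<in> sets borel"
proof -
  let ?L = "psi3_locus :: ('p padic_int \<times> 'p padic_int) set"
  define C where "C n = (padic_scale ^^ n) ` (?L - range padic_scale)" for n :: nat
  have C_sets: "C n \<in> sets borel" for n
  proof (induction n)
    case 0
    show ?case using measure_psi3_locus_not_scaled(1) by (simp add: C_def)
  next
    case (Suc n)
    have "C (Suc n) = padic_scale ` C n" by (simp add: C_def image_comp)
    then show ?case using padic_scale_sets[OF Suc] by simp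
  qed
  have iter: "?L = (\<Union>k<n. C k) \<union> (padic_scale ^^ n) ` ?L" for n
  proof (induction n)
    case (Suc n)
    have "(padic_scale ^^ n) ` ?L = C n \<union> (padic_scale ^^ Suc n) ` ?L"
      by (subst psi3_locus_scale_image) (simp add: C_def image_Un image_comp funpow_swap1 del: funpow.simps(2) add: funpow_Suc_right)
    then show ?case using Suc by (simp add: lessThan_Suc Un_ac)
  qed simp
  have pow: "padic_p ^ n dvd fst z \<and> padic_p ^ n dvd snd z" if "z \<in> range (padic_scale ^^ n)" for n and z :: "'p padic_int \<times> 'p padic_int"
    using that
  proof (induction n arbitrary: z)
    case (Suc n)
    then obtain y where "z = padic_scale ((padic_scale ^^ n) y)" by auto
    then obtain w where w: "z = padic_scale w" "w \<in> range (padic_scale ^^ n)" by blast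
    have *: "padic_p ^ Suc n dvd padic_p ^ Suc k * t" if "padic_p ^ n dvd t" for k and t :: "'p padic_int"
      using mult_dvd_mono[of "padic_p" "padic_p ^ Suc k" "padic_p ^ n" t] that by simp
    show ?case using Suc.IH[OF w(2)] *[of _ 1] *[of _ 2] by (simp add: w(1) padic_scale_def eval_nat_numeral)
  qed simp
  have zero: "(0, 0) \<in> ?L" by (auto simp: psi3_locus_def short_psi3_def intro: exI[of _ 0])
  have "?L = (\<Union>n. C n) \<union> {(0, 0)}"
  proof (rule equalityI; rule subsetI)
    fix z assume z: "z \<in> ?L"
    show "z \<in> (\<Union>n. C n) \<union> {(0, 0)}"
    proof (cases "z \<in> (\<Union>n. C n)")
      case False
      then have "z \<in> range (padic_scale ^^ n)" for n using z iter[of n] by blast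
      then have "fst z = 0" "snd z = 0" using pow unfolding padic_eq_0_iff by blast+
      then show ?thesis by (cases z) simp
    qed simp
  next
    fix z assume "z \<in> (\<Union>n. C n) \<union> {(0, 0)}"
    moreover have "C n \<subseteq> ?L" for n using iter[of "Suc n"] by blast
    ultimately show "z \<in> ?L" using zero by blast
  qed
  moreover have "{(0, 0)} = {0 :: 'p padic_int} \<times> {0 :: 'p padic_int}" by simp
  then have "{(0, 0) :: 'p padic_int \<times> 'p padic_int} \<in> sets borel"
    using padic_haar2_Times(1)[OF padic_singleton_sets padic_singleton_sets] by metis
  moreover have "(\<Union>n. C n) \<in> sets borel" using C_sets by (intro sets.countable_UN) auto
  ultimately show ?thesis by (metis sets.Un)
qed

lemma measure_psi3_locus:
  "measure padic_haar2 (psi3_locus :: ('p padic_int \<times> 'p padic_int) set) * (1 - 1 / real CARD('p) ^ 5)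
    = measure padic_haar2 ((psi3_locus :: ('p padic_int \<times> 'p padic_int) set) - range padic_scale)"
proof -
  let ?L = "psi3_locus :: ('p padic_int \<times> 'p padic_int) set"
  have "measure padic_haar2 ?L = measure padic_haar2 ((?L - range padic_scale) \<union> padic_scale ` ?L)"
    using psi3_locus_scale_image by simp
  also have "\<dots> = measure padic_haar2 (?L - range padic_scale) + measure padic_haar2 (padic_scale ` ?L)"
    using measure_psi3_locus_not_scaled(1) padic_scale_sets[OF psi3_locus_sets]
    by (intro padic_haar2.finite_measure_Union) auto
  finally show ?thesis by (simp add: measure_padic_scale[OF psi3_locus_sets] algebra_simps)
qed

end


section \<open>The discriminant locus and the passage from five coordinates to two\<close>

definition disc_locus :: "('p::prime_card padic_int \<times> 'p padic_int) set" where
  "disc_locus = {(A, B). 4 * A^3 + 27 * B^2 = 0}"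

text \<open>For each A the fibre contains at most the two points B and - B, and points have measure
  0.\<close>

lemma disc_locus_null:
  "(disc_locus :: ('p::prime_card padic_int \<times> 'p padic_int) set) \<in> sets borel"
  "measure padic_haar2 (disc_locus :: ('p padic_int \<times> 'p padic_int) set) = 0"
proof -
  let ?D = "disc_locus :: ('p padic_int \<times> 'p padic_int) set"
  have "continuous_on UNIV (\<lambda>z :: 'p padic_int \<times> 'p padic_int. 4 * (fst z * fst z * fst z) + 27 * (snd z * snd z))"
    by (intro continuous_intros)
  then have "(\<lambda>z :: 'p padic_int \<times> 'p padic_int. 4 * (fst z * fst z * fst z) + 27 * (snd z * snd z)) -` {0} \<in> sets borel"
    using padic_singleton_sets by (intro measurable_sets_borel[OF borel_measurable_continuous_onI])
  moreover have "?D = (\<lambda>z. 4 * (fst z * fst z * fst z) + 27 * (snd z * snd z)) -` {0}"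
    by (auto simp: disc_locus_def power2_eq_square power3_eq_cube)
  ultimately show D: "?D \<in> sets borel" by simp
  have "emeasure padic_haar (Pair A -` ?D) = 0" for A :: "'p padic_int"
  proof -
    have fin: "finite (Pair A -` ?D)"
    proof (cases "Pair A -` ?D = {}")
      case False
      then obtain B where B: "4 * A^3 + 27 * B^2 = 0" by (auto simp: disc_locus_def)
      have "Pair A -` ?D \<subseteq> {B, - B}"
      proof
        fix B' assume "B' \<in> Pair A -` ?D"
        then have "4 * A^3 + 27 * B'^2 = 4 * A^3 + 27 * B^2" using B by (simp add: disc_locus_def)
        then have "B'^2 = B^2" by simp
        then show "B' \<in> {B, - B}" by (simp add: power2_eq_iff)
      qed
      then show ?thesis by (rule finite_subset) simp
    qed simp
    have "emeasure padic_haar (Pair A -` ?D) = (\<Sum>x\<in>Pair A -` ?D. emeasure padic_haar {x})"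
      using fin padic_singleton_sets by (intro emeasure_eq_sum_singleton) auto
    then show ?thesis by (simp add: emeasure_padic_singleton)
  qed
  then have "emeasure padic_haar2 ?D = 0" by (simp add: emeasure_padic_haar2_fst[OF D])
  then show "measure padic_haar2 ?D = 0" by (simp add: measure_def)
qed

lemma padic_twelfth:
  assumes "CARD('p::prime_card) > 3"
  obtains i :: "'p::prime_card padic_int" where "12 * i = 1"
proof -
  have "padic_red (12 :: 'p padic_int) \<noteq> 0" using mod_ring_2_3(4)[OF assms] by simp
  then have "(12 :: 'p padic_int) dvd 1" by (intro padic_unit) (simp flip: padic_red_eq_0_iff)
  then show ?thesis using that by (metis dvdE)
qed

lemma short_coeffs_Fract:
  "short_coeffs (Fract i 1) (map_coeffs (\<lambda>c. Fract c 1) a) = (Fract (fst (short_coeffs i a)) 1, Fract (snd (short_coeffs i a)) (1 :: 'a::idom))"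
  by (cases a) (simp add: Let_def Fract_homs del: mult_fract add_fract diff_fract)

lemma W_iso_eq:
  fixes i :: "'p::prime_card padic_int"
  assumes "CARD('p) > 3" and i: "12 * i = 1"
  shows "W_iso = short_coeffs i -` (psi3_locus - disc_locus)"
proof (rule Set.set_eqI)
  fix a :: "'p padic_int coeffs"
  define E where "E = map_coeffs (\<lambda>c. Fract c 1) a"
  obtain a1 a2 a3 a4 a6 where a: "a = (a1, a2, a3, a4, a6)" by (metis prod_cases5)
  obtain A B where AB: "short_coeffs i a = (A, B)" by fastforce
  have iF: "12 * Fract i 1 = 1"
    using arg_cong[OF i, of "\<lambda>c. Fract c 1"] by (simp only: Fract_homs One_fract_def)
  have "elliptic_curve E \<longleftrightarrow> 4 * (Fract A 1)^3 + 27 * (Fract B 1)^2 \<noteq> 0"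
    unfolding E_def by (rule elliptic_curve_iff[OF iF]) (simp add: short_coeffs_Fract AB)
  also have "\<dots> \<longleftrightarrow> Fract (4 * A^3 + 27 * B^2) 1 \<noteq> 0"
    by (simp only: Fract_homs)
  also have "\<dots> \<longleftrightarrow> (A, B) \<notin> disc_locus" unfolding Fract_hom(4) by (simp add: disc_locus_def)
  finally have ell: "elliptic_curve E \<longleftrightarrow> (A, B) \<notin> disc_locus" .
  have "(\<exists>z. psi3 E z = 0) \<longleftrightarrow> (\<exists>x. short_psi3 A B (x + i * (a1^2 + 4 * a2)) = 0)"
    unfolding E_def padic_psi3_root_integral[OF assms(1)] a psi3_short_coeffs[OF i AB[unfolded a]] ..
  also have "\<dots> \<longleftrightarrow> (\<exists>x. short_psi3 A B x = 0)" by (metis diff_add_cancel)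
  finally have root: "(\<exists>z. psi3 E z = 0) \<longleftrightarrow> (A, B) \<in> psi3_locus" by (simp add: psi3_locus_def)
  have "a \<in> W_iso \<longleftrightarrow> elliptic_curve E \<and> has_rational_isogeny E 3"
    by (simp only: W_iso_def Let_def mem_Collect_eq E_def)
  also have "\<dots> \<longleftrightarrow> (A, B) \<in> psi3_locus - disc_locus"
    using ell root has_rational_3_isogeny_iff[of E] by blast
  finally show "a \<in> W_iso \<longleftrightarrow> a \<in> short_coeffs i -` (psi3_locus - disc_locus)"
    by (simp only: vimage_eq AB)
qed

text \<open>Since 12 i = 1, the coefficients of a4 in A and of a6 in B are 1, so
  \<open>short_coeffs i\<close> is a shear followed by a projection. Removing the discriminant locus
  does not change the measure.\<close>

lemma measure_W_iso:
  assumes card: "CARD('p::prime_card) > 3"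
  shows "measure haar_measure (W_iso :: 'p padic_int coeffs set) = measure padic_haar2 (psi3_locus :: ('p padic_int \<times> 'p padic_int) set)"
proof -
  obtain i :: "'p padic_int" where i: "12 * i = 1" using padic_twelfth[OF card] .
  \<comment> \<open>Powers are spelled out as products, so that continuity reduces to that of
    addition and multiplication.\<close>
  define c where "c a1 a2 = i * (a1 * a1 + 4 * a2)" for a1 a2
  define f where "f a1 a2 a3 = 6 * (i * (a1 * a3)) - 3 * (c a1 a2 * c a1 a2)" for a1 a2 a3
  define g where "g a1 a2 a3 a4 = 3 * (i * (a3 * a3)) - 6 * (i * (c a1 a2 * (2 * a4 + a1 * a3))) + 2 * (c a1 a2 * (c a1 a2 * c a1 a2))"
    for a1 a2 a3 a4
  define \<Phi> where "\<Phi> = (\<lambda>(a1, a2, a3, a4, a6). (a4 + f a1 a2 a3, a6 + g a1 a2 a3 a4))"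
  have i': "12 * (i * t) = t" for t using i by (metis mult.assoc mult_1)
  have \<Phi>_eq: "short_coeffs i = \<Phi>"
  proof
    fix a :: "'p padic_int coeffs"
    obtain a1 a2 a3 a4 a6 where a: "a = (a1, a2, a3, a4, a6)" by (metis prod_cases5)
    have "6 * i * (2 * a4 + a1 * a3) - 3 * (c a1 a2)^2 = 12 * (i * a4) + f a1 a2 a3"
      by (simp add: f_def algebra_simps power2_eq_square)
    moreover have "3 * i * (a3^2 + 4 * a6) - 6 * i * c a1 a2 * (2 * a4 + a1 * a3) + 2 * (c a1 a2)^3
        = 12 * (i * a6) + g a1 a2 a3 a4"
      by (simp add: g_def algebra_simps power2_eq_square power3_eq_cube)
    moreover have "i * (a1^2 + 4 * a2) = c a1 a2" by (simp add: c_def power2_eq_square)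
    ultimately show "short_coeffs i a = \<Phi> a" by (simp only: a short_coeffs.simps Let_def \<Phi>_def prod.case i')
  qed
  have "\<Phi> \<in> borel \<rightarrow>\<^sub>M borel"
  proof (rule borel_measurable_continuous_onI)
    have "\<Phi> = (\<lambda>a. (fst (snd (snd (snd a))) + f (fst a) (fst (snd a)) (fst (snd (snd a))),
        snd (snd (snd (snd a))) + g (fst a) (fst (snd a)) (fst (snd (snd a))) (fst (snd (snd (snd a))))))"
      by (auto simp: \<Phi>_def)
    then show "continuous_on UNIV \<Phi>"
      unfolding f_def g_def c_def by (simp only:) (intro continuous_intros)
  qed
  moreover have "(psi3_locus :: ('p padic_int \<times> 'p padic_int) set) - disc_locus \<in> sets borel"
    using psi3_locus_sets[OF card] disc_locus_null(1) by (rule sets.Diff)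
  ultimately have "measure haar_measure (W_iso :: 'p padic_int coeffs set) = measure padic_haar2 (psi3_locus - disc_locus :: ('p padic_int \<times> 'p padic_int) set)"
    unfolding W_iso_eq[OF card i] \<Phi>_eq unfolding \<Phi>_def by (rule measure_haar5_shear)
  also have "\<dots> = measure padic_haar2 (psi3_locus :: ('p padic_int \<times> 'p padic_int) set)"
    using psi3_locus_sets[OF card] disc_locus_null
    by (intro measure_Diff_null_set) (auto simp: null_sets_def padic_haar2.emeasure_eq_measure)
  finally show ?thesis .
qed

theorem theorem1p2:
  fixes p :: nat
  assumes "p = CARD('p::prime_card)" and "p > 3"
  shows "(p mod 3 = 1 \<longrightarrow>
      measure haar_measure (W_iso :: 'p padic_int coeffs set) =
        (3 * real p ^ 4 + 3 * real p ^ 3 + 4 * real p ^ 2 + 4)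
          / (4 * (real p ^ 4 + real p ^ 3 + real p ^ 2 + real p + 1))) \<and>
    (p mod 3 = 2 \<longrightarrow>
      measure haar_measure (W_iso :: 'p padic_int coeffs set) =
        (real p ^ 4 + real p ^ 3 + 2 * real p ^ 2 + 2)
          / (2 * (real p ^ 4 + real p ^ 3 + real p ^ 2 + real p + 1)))"
proof -
  have card: "CARD('p) > 3" using assms by simp
  define q where "q = real p"
  have q: "q > 3" using assms(2) by (simp add: q_def)
  define m where "m = measure haar_measure (W_iso :: 'p padic_int coeffs set)"
  define r where "r = real (card (residue_pairs :: ('p mod_ring \<times> 'p mod_ring) set))"
  have "m * (1 - 1 / q ^ 5) = r / q^2 + (1 / q) * (1 / q - 1 / q^2) + (1 / q^2) * (1 / q^2 - 1 / q^3)"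
    using measure_psi3_locus[OF card] measure_psi3_locus_not_scaled(2)[OF card]
    by (simp add: m_def r_def q_def measure_W_iso[OF card] assms(1))
  then have "q ^ 5 * (m * (1 - 1 / q ^ 5))
      = q ^ 5 * (r / q^2 + (1 / q) * (1 / q - 1 / q^2) + (1 / q^2) * (1 / q^2 - 1 / q^3))" by simp
  moreover have "q ^ 5 * (m * (1 - 1 / q ^ 5)) = m * (q ^ 5 - 1)" using q by (simp add: field_simps)
  moreover have "q ^ 5 * (r / q^2 + (1 / q) * (1 / q - 1 / q^2) + (1 / q^2) * (1 / q^2 - 1 / q^3))
      = r * q^3 + (q^3 - q^2) + (q - 1)"
    using q by (simp add: field_simps eval_nat_numeral)
  ultimately have key: "m * (q ^ 5 - 1) = r * q^3 + q^3 - q^2 + q - 1" by simp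
  \<comment> \<open>The right side of \<open>key\<close> contains the factor q - 1 as well:
    \<open>r\<close> is a multiple of q^2 - 1, and q^3 - q^2 + q - 1 = (q - 1) (q^2 + 1). Cancelling
    it leaves the stated denominators.\<close>
  have fac: "q ^ 5 - 1 = (q - 1) * (q ^ 4 + q ^ 3 + q ^ 2 + q + 1)"
    by (simp add: algebra_simps eval_nat_numeral)
  define d where "d = q ^ 4 + q ^ 3 + q ^ 2 + q + 1"
  have d: "d > 0" unfolding d_def using q by (intro add_pos_pos) auto
  show ?thesis
    unfolding m_def[symmetric]
  proof (intro conjI impI)
    assume "p mod 3 = 1"
    then have r: "r = 3 * (q^2 - 1) / 4"
      using card_residue_pairs(1)[OF card] assms(1) by (simp add: r_def q_def)
    have "(q - 1) * (4 * d * m) = 4 * (m * (q ^ 5 - 1))" unfolding fac d_def by simp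
    also have "\<dots> = (q - 1) * (3 * q ^ 4 + 3 * q ^ 3 + 4 * q ^ 2 + 4)"
      unfolding key r by (simp add: field_simps eval_nat_numeral)
    finally have "4 * d * m = 3 * q ^ 4 + 3 * q ^ 3 + 4 * q ^ 2 + 4" using q by simp
    then show "m = (3 * real p ^ 4 + 3 * real p ^ 3 + 4 * real p ^ 2 + 4)
          / (4 * (real p ^ 4 + real p ^ 3 + real p ^ 2 + real p + 1))"
      using d unfolding q_def[symmetric] d_def[symmetric] by (simp add: field_simps)
  next
    assume "p mod 3 = 2"
    then have r: "r = (q^2 - 1) / 2"
      using card_residue_pairs(2)[OF card] assms(1) by (simp add: r_def q_def)
    have "(q - 1) * (2 * d * m) = 2 * (m * (q ^ 5 - 1))" unfolding fac d_def by simp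
    also have "\<dots> = (q - 1) * (q ^ 4 + q ^ 3 + 2 * q ^ 2 + 2)"
      unfolding key r by (simp add: field_simps eval_nat_numeral)
    finally have "2 * d * m = q ^ 4 + q ^ 3 + 2 * q ^ 2 + 2" using q by simp
    then show "m = (real p ^ 4 + real p ^ 3 + 2 * real p ^ 2 + 2)
          / (2 * (real p ^ 4 + real p ^ 3 + real p ^ 2 + real p + 1))"
      using d unfolding q_def[symmetric] d_def[symmetric] by (simp add: field_simps)
  qed
qed

end
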